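(* Let $(G,P,\theta)$ be an algebraic dynamical system and $S=G\rtimes_\theta P$. Let $(\xi_g)_{g\in G}$ be the standard orthonormal basis of $\ell^2(G)$, let $(U_g)_{g\in G}$ be the unitary representation of $G$ on $\ell^2(G)$ given by $U_g\xi_h=\xi_{gh}$, and for $p\in P$ let $S_p$ be the isometry on $\ell^2(G)$ given by $S_p\xi_h=\xi_{\theta_p(h)}$. Then the assignment $\bar u_g\bar s_p\mapsto U_gS_p$ ($g\in G$, $p\in P$) defines a representation $\lambda$ of $\mathcal{Q}(S)$ on $\ell^2(G)$ if and only if $P$ is directed.
   Context: All semigroups are countable, discrete and left cancellative. A semigroup is right LCM if the intersection of two principal right ideals is either empty or again a principal right ideal. An algebraic dynamical system $(G,P,\theta)$ is an action $\theta$ of a right LCM semigroup $P$ with identity by injective endomorphisms of a group $G$ (so $\theta_p\theta_q=\theta_{pq}$, $\theta_1=\mathrm{id}$) such that $pP\cap qP=rP$ implies $\theta_p(G)\cap\theta_q(G)=\theta_r(G)$ for all $p,q,r\in P$. $G\rtimes_\theta P$ is the set $G\times P$ with product $(g,p)(h,q)=(g\theta_p(h),pq)$; it is a right LCM semigroup with identity. $P$ is directed if $pP\cap qP\neq\emptyset$ for all $p,q\in P$ (i.e. directed for the relation $p\geq q:\Leftrightarrow p\in qP$). For a right LCM semigroup $S$ with identity, $\mathcal{J}(S)=\{sS\mid s\in S\}\cup\{\emptyset\}$, and $C^*(S)$ is the universal $C^*$-algebra generated by isometries $(v_s)_{s\in S}$ and projections $(e_X)_{X\in\mathcal{J}(S)}$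 satisfying $v_sv_t=v_{st}$, $v_se_Xv_s^*=e_{sX}$, $e_S=1$, $e_\emptyset=0$, $e_Xe_Y=e_{X\cap Y}$ for all $s,t\in S$, $X,Y\in\mathcal{J}(S)$. A finite subset $F\subset S$ is a foundation set for $S$ if for every $s\in S$ there is $t\in F$ with $sS\cap tS\neq\emptyset$. The boundary quotient $\mathcal{Q}(S)$ is the quotient of $C^*(S)$ by the relations $\prod_{s\in F}(1-e_{sS})=0$ for every foundation set $F$ for $S$; the image of $v_s$ is $\bar v_s$. For $S=G\rtimes_\theta P$ write $\bar u_g=\bar v_{(g,1)}$ and $\bar s_p=\bar v_{(1,p)}$, so $\bar u_g\bar s_p=\bar v_{(g,p)}$. *)

theory Defs
  imports
    "HOL-Analysis.Infinite_Sum"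
    "HOL-Library.Countable_Set"
    "HOL-Library.Poly_Mapping"
    "HOL-Algebra.QuotRing"
    "HOL-Algebra.Module"
begin

section \<open>Semigroups and algebraic dynamical systems\<close>

abbreviation principal_right_ideal :: "('s, 'm) monoid_scheme \<Rightarrow> 's \<Rightarrow> 's set"
  where "principal_right_ideal S s \<equiv> s <#\<^bsub>S\<^esub> carrier S"

definition left_cancellative :: "('s, 'm) monoid_scheme \<Rightarrow> bool"
  where "left_cancellative S \<longleftrightarrow>
    (\<forall>s\<in>carrier S. \<forall>t\<in>carrier S. \<forall>u\<in>carrier S. s \<otimes>\<^bsub>S\<^esub> t = s \<otimes>\<^bsub>S\<^esub> u \<longrightarrow> t = u)"

definition right_LCM :: "('s, 'm) monoid_scheme \<Rightarrow> bool"
  where "right_LCM S \<longleftrightarrow>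
    (\<forall>s\<in>carrier S. \<forall>t\<in>carrier S.
      principal_right_ideal S s \<inter> principal_right_ideal S t = {} \<or>
      (\<exists>r\<in>carrier S.
        principal_right_ideal S s \<inter> principal_right_ideal S t = principal_right_ideal S r))"

definition directed :: "('s, 'm) monoid_scheme \<Rightarrow> bool"
  where "directed S \<longleftrightarrow>
    (\<forall>s\<in>carrier S. \<forall>t\<in>carrier S.
      principal_right_ideal S s \<inter> principal_right_ideal S t \<noteq> {})"

locale algebraic_dynamical_system = G?: group G + P?: monoid P
  for G :: "('g, 'm) monoid_scheme" (structure)
    and P :: "('p, 'n) monoid_scheme" (structure)
    and \<theta> :: "'p \<Rightarrow> 'g \<Rightarrow> 'g" +
  assumes countable_G: "countable (carrier G)"
    and countable_P: "countable (carrier P)"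
    and left_cancellative_P: "left_cancellative P"
    and right_LCM_P: "right_LCM P"
    and endomorphism: "p \<in> carrier P \<Longrightarrow> \<theta> p \<in> hom G G"
    and injective: "p \<in> carrier P \<Longrightarrow> inj_on (\<theta> p) (carrier G)"
    and action_mult:
      "\<lbrakk>p \<in> carrier P; q \<in> carrier P; g \<in> carrier G\<rbrakk> \<Longrightarrow> \<theta> p (\<theta> q g) = \<theta> (p \<otimes>\<^bsub>P\<^esub> q) g"
    and action_one: "g \<in> carrier G \<Longrightarrow> \<theta> \<one>\<^bsub>P\<^esub> g = g"
    and preserves_order:
      "\<lbrakk>p \<in> carrier P; q \<in> carrier P; r \<in> carrier P;
        principal_right_ideal P p \<inter> principal_right_ideal P q = principal_right_ideal P r\<rbrakk>
       \<Longrightarrow> \<theta> p ` carrier G \<inter> \<theta> q ` carrier G = \<theta> r ` carrier G"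

definition semidirect_product ::
    "('g, 'm) monoid_scheme \<Rightarrow> ('p, 'n) monoid_scheme \<Rightarrow> ('p \<Rightarrow> 'g \<Rightarrow> 'g) \<Rightarrow> ('g \<times> 'p) monoid"
  where "semidirect_product G P \<theta> =
    \<lparr>carrier = carrier G \<times> carrier P,
     mult = (\<lambda>(g, p) (h, q). (g \<otimes>\<^bsub>G\<^esub> \<theta> p h, p \<otimes>\<^bsub>P\<^esub> q)),
     one = (\<one>\<^bsub>G\<^esub>, \<one>\<^bsub>P\<^esub>)\<rparr>"

definition constructible_right_ideals :: "('s, 'm) monoid_scheme \<Rightarrow> 's set set"
  where "constructible_right_ideals S = principal_right_ideal S ` carrier S \<union> {{}}"

definition foundation_set :: "('s, 'm) monoid_scheme \<Rightarrow> 's set \<Rightarrow> bool"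
  where "foundation_set S F \<longleftrightarrow> finite F \<and> F \<subseteq> carrier S \<and>
    (\<forall>s\<in>carrier S. \<exists>t\<in>F. principal_right_ideal S s \<inter> principal_right_ideal S t \<noteq> {})"


section \<open>Complex star-algebras\<close>

record 'a star_algebra = "(complex, 'a) module" +
  star :: "'a \<Rightarrow> 'a"

record 'a normed_star_algebra = "'a star_algebra" +
  nrm :: "'a \<Rightarrow> real"

definition star_hom ::
    "('a, 'm) star_algebra_scheme \<Rightarrow> ('b, 'n) star_algebra_scheme \<Rightarrow> ('a \<Rightarrow> 'b) set"
  where "star_hom A B = {\<phi> \<in> ring_hom A B.
    (\<forall>c. \<forall>a\<in>carrier A. \<phi> (c \<odot>\<^bsub>A\<^esub> a) = c \<odot>\<^bsub>B\<^esub> \<phi> a) \<and>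
    (\<forall>a\<in>carrier A. \<phi> (star A a) = star B (\<phi> a))}"


section \<open>Universal C*-algebras given by generators and relations\<close>

subsection \<open>The free unital star-algebra\<close>

datatype 'x letter = Gen 'x | Gen_star 'x

text \<open>
  Words form a type of their own because the convolution product of \<^theory>\<open>HOL-Library.Poly_Mapping\<close>
  needs an additive monoid of exponents; here addition is (noncommutative) concatenation.
\<close>

datatype 'x star_word = Star_Word (letters: "'x letter list")

instantiation star_word :: (type) monoid_add
begin

definition "0 = Star_Word []"

definition "v + w = Star_Word (letters v @ letters w)"

instance
  by standard (simp_all add: zero_star_word_def plus_star_word_def)

end

type_synonym 'x star_poly = "'x star_word \<Rightarrow>\<^sub>0 complex"

primrec letter_gen :: "'x letter \<Rightarrow> 'x"
  where
    "letter_gen (Gen x) = x"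
  | "letter_gen (Gen_star x) = x"

primrec letter_star :: "'x letter \<Rightarrow> 'x letter"
  where
    "letter_star (Gen x) = Gen_star x"
  | "letter_star (Gen_star x) = Gen x"

definition word_star :: "'x star_word \<Rightarrow> 'x star_word"
  where "word_star w = Star_Word (rev (map letter_star (letters w)))"

definition gen :: "'x \<Rightarrow> 'x star_poly"
  where "gen x = Poly_Mapping.single (Star_Word [Gen x]) 1"

definition poly_star :: "'x star_poly \<Rightarrow> 'x star_poly"
  where "poly_star a =
    (\<Sum>w\<in>Poly_Mapping.keys a. Poly_Mapping.single (word_star w) (cnj (Poly_Mapping.lookup a w)))"

definition free_star_algebra :: "'x set \<Rightarrow> 'x star_poly star_algebra"
  where "free_star_algebra X =
    \<lparr>carrier = {a. \<forall>w\<in>Poly_Mapping.keys a. letter_gen ` set (letters w) \<subseteq> X},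
     mult = (*), one = 1, zero = 0, add = (+),
     smult = (\<lambda>c a. Poly_Mapping.single 0 c * a),
     star = poly_star\<rparr>"

subsection \<open>The universal C*-seminorm\<close>

definition cstar_seminorm :: "('a, 'm) star_algebra_scheme \<Rightarrow> ('a \<Rightarrow> real) \<Rightarrow> bool"
  where "cstar_seminorm A N \<longleftrightarrow>
    (\<forall>a\<in>carrier A. 0 \<le> N a) \<and>
    (\<forall>a\<in>carrier A. \<forall>b\<in>carrier A. N (a \<oplus>\<^bsub>A\<^esub> b) \<le> N a + N b) \<and>
    (\<forall>c. \<forall>a\<in>carrier A. N (c \<odot>\<^bsub>A\<^esub> a) = cmod c * N a) \<and>
    (\<forall>a\<in>carrier A. \<forall>b\<in>carrier A. N (a \<otimes>\<^bsub>A\<^esub> b) \<le> N a * N b) \<and>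
    (\<forall>a\<in>carrier A. N (star A a \<otimes>\<^bsub>A\<^esub> a) = (N a)\<^sup>2)"

text \<open>
  The elements of \<open>R\<close> are the relators, i.e. the elements that are to become zero. The supremum is
  the largest C*-seminorm killing \<open>R\<close> whenever it is finite on the generators, which is the
  condition for the universal C*-algebra to exist.
\<close>

definition universal_seminorm :: "('a, 'm) star_algebra_scheme \<Rightarrow> 'a set \<Rightarrow> 'a \<Rightarrow> real"
  where "universal_seminorm A R a =
    (SUP N\<in>{N. cstar_seminorm A N \<and> (\<forall>r\<in>R. N r = 0)}. N a)"

subsection \<open>The Hausdorff completion with respect to a seminorm\<close>

definition cauchy_sequences ::
    "('a, 'm) star_algebra_scheme \<Rightarrow> ('a \<Rightarrow> real) \<Rightarrow> (nat \<Rightarrow> 'a) set"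
  where "cauchy_sequences A N = {a. (\<forall>n. a n \<in> carrier A) \<and>
    (\<forall>\<epsilon>>0. \<exists>M. \<forall>m\<ge>M. \<forall>n\<ge>M. N (a m \<ominus>\<^bsub>A\<^esub> a n) < \<epsilon>)}"

definition null_relation ::
    "('a, 'm) star_algebra_scheme \<Rightarrow> ('a \<Rightarrow> real) \<Rightarrow> ((nat \<Rightarrow> 'a) \<times> (nat \<Rightarrow> 'a)) set"
  where "null_relation A N = {(a, b). a \<in> cauchy_sequences A N \<and> b \<in> cauchy_sequences A N \<and>
    (\<lambda>n. N (a n \<ominus>\<^bsub>A\<^esub> b n)) \<longlonglongrightarrow> 0}"

definition completion ::
    "('a, 'm) star_algebra_scheme \<Rightarrow> ('a \<Rightarrow> real) \<Rightarrow> (nat \<Rightarrow> 'a) set normed_star_algebra"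
  where "completion A N = (let cls = (\<lambda>a. null_relation A N `` {a}) in
    \<lparr>carrier = cauchy_sequences A N // null_relation A N,
     mult = (\<lambda>X Y. \<Union>a\<in>X. \<Union>b\<in>Y. cls (\<lambda>n. a n \<otimes>\<^bsub>A\<^esub> b n)),
     one = cls (\<lambda>n. \<one>\<^bsub>A\<^esub>),
     zero = cls (\<lambda>n. \<zero>\<^bsub>A\<^esub>),
     add = (\<lambda>X Y. \<Union>a\<in>X. \<Union>b\<in>Y. cls (\<lambda>n. a n \<oplus>\<^bsub>A\<^esub> b n)),
     smult = (\<lambda>c X. \<Union>a\<in>X. cls (\<lambda>n. c \<odot>\<^bsub>A\<^esub> a n)),
     star = (\<lambda>X. \<Union>a\<in>X. cls (\<lambda>n. star A (a n))),
     nrm = (\<lambda>X. THE l. \<forall>a\<in>X. (\<lambda>n. N (a n)) \<longlonglongrightarrow> l)\<rparr>)"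

definition completion_map ::
    "('a, 'm) star_algebra_scheme \<Rightarrow> ('a \<Rightarrow> real) \<Rightarrow> 'a \<Rightarrow> (nat \<Rightarrow> 'a) set"
  where "completion_map A N a = null_relation A N `` {\<lambda>n. a}"

definition universal_cstar ::
    "'x set \<Rightarrow> 'x star_poly set \<Rightarrow> (nat \<Rightarrow> 'x star_poly) set normed_star_algebra"
  where "universal_cstar X R =
    completion (free_star_algebra X) (universal_seminorm (free_star_algebra X) R)"

definition universal_gen :: "'x set \<Rightarrow> 'x star_poly set \<Rightarrow> 'x \<Rightarrow> (nat \<Rightarrow> 'x star_poly) set"
  where "universal_gen X R x =
    completion_map (free_star_algebra X) (universal_seminorm (free_star_algebra X) R) (gen x)"


section \<open>Quotients of C*-algebras\<close>

definition closed_ideal :: "('a, 'm) normed_star_algebra_scheme \<Rightarrow> 'a set \<Rightarrow> bool"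
  where "closed_ideal A I \<longleftrightarrow> ideal I A \<and>
    (\<forall>a. \<forall>x\<in>carrier A. (\<forall>n::nat. a n \<in> I) \<and> (\<lambda>n. nrm A (a n \<ominus>\<^bsub>A\<^esub> x)) \<longlonglongrightarrow> 0 \<longrightarrow> x \<in> I)"

definition closed_ideal_generated_by ::
    "('a, 'm) normed_star_algebra_scheme \<Rightarrow> 'a set \<Rightarrow> 'a set"
  where "closed_ideal_generated_by A K = \<Inter>{I. closed_ideal A I \<and> K \<subseteq> I}"

definition cstar_quotient ::
    "('a, 'm) normed_star_algebra_scheme \<Rightarrow> 'a set \<Rightarrow> 'a set normed_star_algebra"
  where "cstar_quotient A I =
    \<lparr>carrier = carrier (A Quot I), mult = mult (A Quot I), one = one (A Quot I),
     zero = zero (A Quot I), add = add (A Quot I),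
     smult = (\<lambda>c X. \<Union>x\<in>X. I +>\<^bsub>A\<^esub> (c \<odot>\<^bsub>A\<^esub> x)),
     star = (\<lambda>X. \<Union>x\<in>X. I +>\<^bsub>A\<^esub> star A x),
     nrm = (\<lambda>X. INF x\<in>X. nrm A x)\<rparr>"


section \<open>The C*-algebra and the boundary quotient of a right LCM semigroup\<close>

datatype 's semigroup_gen = Isom 's | Proj "'s set"

abbreviation isom :: "'s \<Rightarrow> 's semigroup_gen star_poly"
  where "isom s \<equiv> gen (Isom s)"

abbreviation proj :: "'s set \<Rightarrow> 's semigroup_gen star_poly"
  where "proj X \<equiv> gen (Proj X)"

definition semigroup_gens :: "('s, 'm) monoid_scheme \<Rightarrow> 's semigroup_gen set"
  where "semigroup_gens S = Isom ` carrier S \<union> Proj ` constructible_right_ideals S"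

text \<open>A relation \<open>a = b\<close> is encoded by the relator \<open>a - b\<close>.\<close>

definition semigroup_relators :: "('s, 'm) monoid_scheme \<Rightarrow> 's semigroup_gen star_poly set"
  where "semigroup_relators S =
    {poly_star (isom s) * isom s - 1 | s. s \<in> carrier S} \<union>
    {poly_star (proj X) - proj X | X. X \<in> constructible_right_ideals S} \<union>
    {proj X * proj X - proj X | X. X \<in> constructible_right_ideals S} \<union>
    {isom s * isom t - isom (s \<otimes>\<^bsub>S\<^esub> t) | s t. s \<in> carrier S \<and> t \<in> carrier S} \<union>
    {isom s * proj X * poly_star (isom s) - proj (s <#\<^bsub>S\<^esub> X) | s X.
      s \<in> carrier S \<and> X \<in> constructible_right_ideals S} \<union>
    {proj (carrier S) - 1} \<union>
    {proj {}} \<union>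
    {proj X * proj Y - proj (X \<inter> Y) | X Y.
      X \<in> constructible_right_ideals S \<and> Y \<in> constructible_right_ideals S}"

type_synonym 's semigroup_cstar_elem = "(nat \<Rightarrow> 's semigroup_gen star_poly) set"

definition semigroup_cstar ::
    "('s, 'm) monoid_scheme \<Rightarrow> 's semigroup_cstar_elem normed_star_algebra"
  where "semigroup_cstar S = universal_cstar (semigroup_gens S) (semigroup_relators S)"

definition semigroup_isom :: "('s, 'm) monoid_scheme \<Rightarrow> 's \<Rightarrow> 's semigroup_cstar_elem"
  where "semigroup_isom S s = universal_gen (semigroup_gens S) (semigroup_relators S) (Isom s)"

definition semigroup_proj :: "('s, 'm) monoid_scheme \<Rightarrow> 's set \<Rightarrow> 's semigroup_cstar_elem"
  where "semigroup_proj S X = universal_gen (semigroup_gens S) (semigroup_relators S) (Proj X)"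

text \<open>
  The factors \<open>1 - e\<^bsub>sS\<^esub>\<close> commute, so the product over a finite set is the product along any
  enumeration of it.
\<close>

definition foundation_product :: "('s, 'm) monoid_scheme \<Rightarrow> 's list \<Rightarrow> 's semigroup_cstar_elem"
  where "foundation_product S ss = (let A = semigroup_cstar S in
    foldr (\<lambda>s a. (\<one>\<^bsub>A\<^esub> \<ominus>\<^bsub>A\<^esub> semigroup_proj S (principal_right_ideal S s)) \<otimes>\<^bsub>A\<^esub> a) ss \<one>\<^bsub>A\<^esub>)"

definition boundary_ideal :: "('s, 'm) monoid_scheme \<Rightarrow> 's semigroup_cstar_elem set"
  where "boundary_ideal S = closed_ideal_generated_by (semigroup_cstar S)
    {foundation_product S ss | ss. distinct ss \<and> foundation_set S (set ss)}"

definition boundary_quotient ::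
    "('s, 'm) monoid_scheme \<Rightarrow> 's semigroup_cstar_elem set normed_star_algebra"
  where "boundary_quotient S = cstar_quotient (semigroup_cstar S) (boundary_ideal S)"

definition boundary_isom :: "('s, 'm) monoid_scheme \<Rightarrow> 's \<Rightarrow> 's semigroup_cstar_elem set"
  where "boundary_isom S s = boundary_ideal S +>\<^bsub>semigroup_cstar S\<^esub> semigroup_isom S s"


section \<open>Bounded operators on \<open>\<ell>\<^sup>2(X)\<close>\<close>

text \<open>
  Vectors of \<open>\<ell>\<^sup>2(X)\<close> vanish outside \<open>X\<close>, and operators are undefined outside \<open>\<ell>\<^sup>2(X)\<close>, so that
  equality of vectors and of operators is equality of functions. The inner product is linear in
  its second argument.
\<close>

definition ell2 :: "'x set \<Rightarrow> ('x \<Rightarrow> complex) set"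
  where "ell2 X = {f. (\<forall>x. x \<notin> X \<longrightarrow> f x = 0) \<and> (\<lambda>x. (cmod (f x))\<^sup>2) summable_on X}"

definition ell2_norm :: "'x set \<Rightarrow> ('x \<Rightarrow> complex) \<Rightarrow> real"
  where "ell2_norm X f = sqrt (\<Sum>\<^sub>\<infinity>x\<in>X. (cmod (f x))\<^sup>2)"

definition ell2_inner :: "'x set \<Rightarrow> ('x \<Rightarrow> complex) \<Rightarrow> ('x \<Rightarrow> complex) \<Rightarrow> complex"
  where "ell2_inner X f g = (\<Sum>\<^sub>\<infinity>x\<in>X. cnj (f x) * g x)"

definition ket :: "'x \<Rightarrow> 'x \<Rightarrow> complex"
  where "ket x = (\<lambda>y. if y = x then 1 else 0)"

definition ell2_operators :: "'x set \<Rightarrow> (('x \<Rightarrow> complex) \<Rightarrow> ('x \<Rightarrow> complex)) set"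
  where "ell2_operators X = {T \<in> ell2 X \<rightarrow>\<^sub>E ell2 X.
    (\<forall>f\<in>ell2 X. \<forall>g\<in>ell2 X. T (\<lambda>x. f x + g x) = (\<lambda>x. T f x + T g x)) \<and>
    (\<forall>c. \<forall>f\<in>ell2 X. T (\<lambda>x. c * f x) = (\<lambda>x. c * T f x)) \<and>
    (\<exists>C. \<forall>f\<in>ell2 X. ell2_norm X (T f) \<le> C * ell2_norm X f)}"

definition adjoint :: "'x set \<Rightarrow> (('x \<Rightarrow> complex) \<Rightarrow> ('x \<Rightarrow> complex)) \<Rightarrow> ('x \<Rightarrow> complex) \<Rightarrow> ('x \<Rightarrow> complex)"
  where "adjoint X T = (THE T'. T' \<in> ell2_operators X \<and>
    (\<forall>f\<in>ell2 X. \<forall>g\<in>ell2 X. ell2_inner X (T f) g = ell2_inner X f (T' g)))"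

definition bounded_operators :: "'x set \<Rightarrow> (('x \<Rightarrow> complex) \<Rightarrow> ('x \<Rightarrow> complex)) normed_star_algebra"
  where "bounded_operators X =
    \<lparr>carrier = ell2_operators X,
     mult = (\<lambda>T T'. compose (ell2 X) T T'),
     one = (\<lambda>f\<in>ell2 X. f),
     zero = (\<lambda>f\<in>ell2 X. \<lambda>x. 0),
     add = (\<lambda>T T'. \<lambda>f\<in>ell2 X. \<lambda>x. T f x + T' f x),
     smult = (\<lambda>c T. \<lambda>f\<in>ell2 X. \<lambda>x. c * T f x),
     star = adjoint X,
     nrm = (\<lambda>T. SUP f\<in>{f \<in> ell2 X. ell2_norm X f \<le> 1}. ell2_norm X (T f))\<rparr>"

abbreviation representations ::
    "('a, 'm) normed_star_algebra_scheme \<Rightarrow> 'x set \<Rightarrow> ('a \<Rightarrow> ('x \<Rightarrow> complex) \<Rightarrow> ('x \<Rightarrow> complex)) set"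
  where "representations A X \<equiv> star_hom A (bounded_operators X)"

text \<open>The isometry of \<open>\<ell>\<^sup>2(X)\<close> induced by an injection \<open>\<phi>\<close> of \<open>X\<close> into itself.\<close>

definition induced_isometry :: "'x set \<Rightarrow> ('x \<Rightarrow> 'x) \<Rightarrow> ('x \<Rightarrow> complex) \<Rightarrow> ('x \<Rightarrow> complex)"
  where "induced_isometry X \<phi> =
    (\<lambda>f\<in>ell2 X. \<lambda>y. if y \<in> \<phi> ` X then f (inv_into X \<phi> y) else 0)"

lemma ket_in_ell2: "x \<in> X \<Longrightarrow> ket x \<in> ell2 X"
proof -
  assume "x \<in> X"
  moreover have "(\<lambda>y. (cmod (ket x y))\<^sup>2) summable_on X"
    by (rule finite_nonzero_values_imp_summable_on, rule finite_subset[of _ "{x}"])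
      (auto simp: ket_def)
  ultimately show ?thesis
    by (auto simp: ell2_def ket_def)
qed

lemma induced_isometry_ket:
  assumes "inj_on \<phi> X" "x \<in> X"
  shows "induced_isometry X \<phi> (ket x) = ket (\<phi> x)"
  using assms ket_in_ell2[of x X]
  by (auto simp: induced_isometry_def ket_def fun_eq_iff inv_into_f_f)

definition translation_unitary ::
    "('g, 'm) monoid_scheme \<Rightarrow> 'g \<Rightarrow> ('g \<Rightarrow> complex) \<Rightarrow> ('g \<Rightarrow> complex)"
  where "translation_unitary G g = induced_isometry (carrier G) (\<lambda>h. g \<otimes>\<^bsub>G\<^esub> h)"

definition endomorphism_isometry ::
    "('g, 'm) monoid_scheme \<Rightarrow> ('p \<Rightarrow> 'g \<Rightarrow> 'g) \<Rightarrow> 'p \<Rightarrow> ('g \<Rightarrow> complex) \<Rightarrow> ('g \<Rightarrow> complex)"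
  where "endomorphism_isometry G \<theta> p = induced_isometry (carrier G) (\<theta> p)"

context algebraic_dynamical_system
begin

lemma translation_unitary_ket:
  "\<lbrakk>g \<in> carrier G; h \<in> carrier G\<rbrakk> \<Longrightarrow> translation_unitary G g (ket h) = ket (g \<otimes>\<^bsub>G\<^esub> h)"
  unfolding translation_unitary_def by (intro induced_isometry_ket G.inj_on_cmult) auto

lemma endomorphism_isometry_ket:
  "\<lbrakk>p \<in> carrier P; h \<in> carrier G\<rbrakk> \<Longrightarrow> endomorphism_isometry G \<theta> p (ket h) = ket (\<theta> p h)"
  unfolding endomorphism_isometry_def by (intro induced_isometry_ket injective) auto

end

end

theory Submission
  imports Defs "HOL-Analysis.L2_Norm"
begin

text \<open>
  Every generator of \<open>C\<^sup>*(S)\<close> acts on \<open>\<ell>\<^sup>2(G)\<close> through a partial bijection of \<open>G\<close>: the isometry of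
  \<open>(g, p)\<close> through \<open>h \<mapsto> g \<theta>\<^sub>p(h)\<close>, and the projection of \<open>(g, p)S\<close> through the identity of the coset
  \<open>g \<theta>\<^sub>p(G)\<close>. If \<open>P\<close> is directed, the ideals \<open>(g, p)S\<close> and \<open>(h, q)S\<close> meet exactly when their cosets do,
  so the defining relations become identities between partial bijections. For a foundation set the
  cosets cover \<open>G\<close>: given \<open>y\<close>, test the foundation property at \<open>(y, r)\<close> for a common multiple \<open>r\<close> of
  all the \<open>p\<close> involved. Hence the representation of \<open>C\<^sup>*(S)\<close> annihilates the boundary relations.

  Conversely, if \<open>pP \<inter> qP = \<emptyset>\<close>, then \<open>s\<^sub>p\<^sup>* s\<^sub>q = s\<^sub>p\<^sup>* e\<^bsub>pS\<^esub> e\<^bsub>qS\<^esub> s\<^sub>q = 0\<close>, whereas \<open>S\<^sub>p\<^sup>* S\<^sub>q\<close> fixes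
  the basis vector at the identity because \<open>\<theta>\<^sub>p\<close> and \<open>\<theta>\<^sub>q\<close> do.
\<close>

section \<open>The Hilbert space \<open>\<ell>\<^sup>2(X)\<close>\<close>

text \<open>\<open>boundary_quotient\<close> is not given by a universal property but built: a free
  star-algebra is completed in the supremum of the C*-seminorms killing the relators, and a closed
  ideal is divided out. To represent it, the operator norm of the action on polynomials is shown to
  be one of the competing seminorms. It is then dominated by the supremum, so the action extends to
  the completion as a contraction, the kernel of the extension is closed, and it contains the
  boundary ideal once it contains the generators of that ideal. The supremum is finite because the
  relations force every generator to have seminorm at most 1. Two encodings shape the details. The
  adjoint is a definite description, so the existence of adjoints has to be exhibited at every
  stage. The star of a coset is a union over its members, so the boundary ideal must be known to be
  invariant under the star before the quotient can be used at all.\<close>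

text \<open>\<open>L2_set\<close> is the Euclidean norm of a finite restriction. A bound on all
  finite restrictions gives square summability and the same bound for the norm, so the triangle
  inequality, completeness and the contraction property of relation operators are all checked on
  finite sets.\<close>

lemma ell2I:
  assumes outside: "\<And>x. x \<notin> X \<Longrightarrow> f x = 0"
    and bound: "\<And>F. finite F \<Longrightarrow> F \<subseteq> X \<Longrightarrow> L2_set (\<lambda>x. cmod (f x)) F \<le> C"
  shows "f \<in> ell2 X" and "ell2_norm X f \<le> C"
proof -
  have C: "0 \<le> C"
    using bound[of "{}"] by simp
  have le: "(\<Sum>x\<in>F. (cmod (f x))\<^sup>2) \<le> C\<^sup>2" if "finite F" "F \<subseteq> X" for F
    using bound[OF that] by (simp add: L2_set_def sqrt_le_D)
  have summable: "(\<lambda>x. (cmod (f x))\<^sup>2) summable_on X"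
    by (rule nonneg_bdd_above_summable_on) (auto intro!: bdd_aboveI2 le)
  then show "f \<in> ell2 X"
    using outside by (simp add: ell2_def)
  have "(\<Sum>\<^sub>\<infinity>x\<in>X. (cmod (f x))\<^sup>2) \<le> C\<^sup>2"
    by (rule infsum_le_finite_sums[OF summable le])
  then show "ell2_norm X f \<le> C"
    using C by (simp add: ell2_norm_def real_le_lsqrt infsum_nonneg)
qed

lemma ell2_outside: "f \<in> ell2 X \<Longrightarrow> x \<notin> X \<Longrightarrow> f x = 0"
  by (simp add: ell2_def)

lemma ell2_norm_nonneg [simp]: "0 \<le> ell2_norm X f"
  by (simp add: ell2_norm_def infsum_nonneg)

lemma L2_set_le_ell2_norm:
  assumes "f \<in> ell2 X" "finite F" "F \<subseteq> X"
  shows "L2_set (\<lambda>x. cmod (f x)) F \<le> ell2_norm X f"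
  unfolding L2_set_def ell2_norm_def
  using assms by (auto simp: ell2_def intro!: real_sqrt_le_mono finite_sum_le_infsum)

lemma cmod_le_ell2_norm: "f \<in> ell2 X \<Longrightarrow> cmod (f x) \<le> ell2_norm X f"
  using L2_set_le_ell2_norm[of f X "{x}"] by (cases "x \<in> X") (auto simp: ell2_outside)

lemma ell2_add_aux:
  assumes "f \<in> ell2 X" "g \<in> ell2 X" "finite F" "F \<subseteq> X"
  shows "L2_set (\<lambda>x. cmod (f x + g x)) F \<le> ell2_norm X f + ell2_norm X g"
proof -
  have "L2_set (\<lambda>x. cmod (f x + g x)) F \<le> L2_set (\<lambda>x. cmod (f x) + cmod (g x)) F"
    by (intro L2_set_mono norm_triangle_ineq) auto
  also have "\<dots> \<le> L2_set (\<lambda>x. cmod (f x)) F + L2_set (\<lambda>x. cmod (g x)) F"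
    by (rule L2_set_triangle_ineq)
  also have "\<dots> \<le> ell2_norm X f + ell2_norm X g"
    using assms by (intro add_mono L2_set_le_ell2_norm)
  finally show ?thesis .
qed

lemma
  assumes "f \<in> ell2 X" "g \<in> ell2 X"
  shows ell2_add: "(\<lambda>x. f x + g x) \<in> ell2 X"
    and ell2_norm_triangle: "ell2_norm X (\<lambda>x. f x + g x) \<le> ell2_norm X f + ell2_norm X g"
  using ell2I[OF _ ell2_add_aux[OF assms]] assms by (simp_all add: ell2_outside)

lemma ell2_norm_scale: "ell2_norm X (\<lambda>x. c * f x) = cmod c * ell2_norm X f"
  by (simp add: ell2_norm_def norm_mult power_mult_distrib infsum_cmult_right' real_sqrt_mult)

lemma ell2_scale: "f \<in> ell2 X \<Longrightarrow> (\<lambda>x. c * f x) \<in> ell2 X"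
  by (auto simp: ell2_def norm_mult power_mult_distrib intro!: summable_on_cmult_right)

lemma ell2_zero: "(\<lambda>x. 0) \<in> ell2 X"
  by (simp add: ell2_def)

lemma ell2_norm_zero [simp]: "ell2_norm X (\<lambda>x. 0) = 0"
  by (simp add: ell2_norm_def)

lemma ell2_diff: "f \<in> ell2 X \<Longrightarrow> g \<in> ell2 X \<Longrightarrow> (\<lambda>x. f x - g x) \<in> ell2 X"
  using ell2_add[of f X "\<lambda>x. - 1 * g x"] ell2_scale[of g X "-1"] by simp

lemma ell2_norm_minus_commute: "ell2_norm X (\<lambda>x. f x - g x) = ell2_norm X (\<lambda>x. g x - f x)"
  by (simp add: ell2_norm_def norm_minus_commute)

text \<open>The finite Cauchy-Schwarz inequality bounds every finite sum of absolute values by the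
  product of the norms; absolute summability and the inequality for the full sum are both
  consequences of this one bound.\<close>

lemma
  assumes "f \<in> ell2 X" "g \<in> ell2 X"
  shows ell2_inner_summable: "(\<lambda>x. cnj (f x) * g x) summable_on X"
    and ell2_Cauchy_Schwarz: "cmod (ell2_inner X f g) \<le> ell2_norm X f * ell2_norm X g"
proof -
  have le: "(\<Sum>x\<in>F. cmod (cnj (f x) * g x)) \<le> ell2_norm X f * ell2_norm X g"
    if "finite F" "F \<subseteq> X" for F
  proof -
    have "(\<Sum>x\<in>F. cmod (cnj (f x) * g x)) \<le> L2_set (\<lambda>x. cmod (f x)) F * L2_set (\<lambda>x. cmod (g x)) F"
      using L2_set_mult_ineq[of "\<lambda>x. cmod (f x)" "\<lambda>x. cmod (g x)" F] by (simp add: norm_mult)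
    also have "\<dots> \<le> ell2_norm X f * ell2_norm X g"
      using assms that by (intro mult_mono L2_set_le_ell2_norm) auto
    finally show ?thesis .
  qed
  have abs: "(\<lambda>x. cnj (f x) * g x) abs_summable_on X"
    by (rule nonneg_bdd_above_summable_on) (auto intro!: bdd_aboveI2 le)
  then show "(\<lambda>x. cnj (f x) * g x) summable_on X"
    by (rule abs_summable_summable)
  show "cmod (ell2_inner X f g) \<le> ell2_norm X f * ell2_norm X g"
    unfolding ell2_inner_def
    by (rule order_trans[OF norm_infsum_bound[OF abs] infsum_le_finite_sums[OF abs le]])
qed

lemma ell2_inner_self:
  assumes "f \<in> ell2 X"
  shows "ell2_inner X f f = of_real ((ell2_norm X f)\<^sup>2)"
proof -
  have "ell2_inner X f f = (\<Sum>\<^sub>\<infinity>x\<in>X. of_real ((cmod (f x))\<^sup>2))"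
    unfolding ell2_inner_def
    by (intro infsum_cong) (simp add: complex_norm_square mult.commute flip: of_real_power)
  also have "\<dots> = of_real (\<Sum>\<^sub>\<infinity>x\<in>X. (cmod (f x))\<^sup>2)"
    using assms by (intro infsumI has_sum_of_real has_sum_infsum) (simp add: ell2_def)
  finally show ?thesis
    by (simp add: ell2_norm_def infsum_nonneg)
qed

lemma ell2_inner_commute: "ell2_inner X g f = cnj (ell2_inner X f g)"
  unfolding ell2_inner_def infsum_cnj[symmetric] by (intro infsum_cong) (simp add: mult.commute)

lemma ell2_inner_add_right:
  assumes "f \<in> ell2 X" "g \<in> ell2 X" "h \<in> ell2 X"
  shows "ell2_inner X f (\<lambda>x. g x + h x) = ell2_inner X f g + ell2_inner X f h"
  using assms by (simp add: ell2_inner_def distrib_left infsum_add ell2_inner_summable)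

lemma ell2_inner_scale_right: "ell2_inner X f (\<lambda>x. c * g x) = c * ell2_inner X f g"
  by (simp add: ell2_inner_def mult.left_commute[of _ c] infsum_cmult_right')

lemma ell2_inner_add_left:
  assumes "f \<in> ell2 X" "g \<in> ell2 X" "h \<in> ell2 X"
  shows "ell2_inner X (\<lambda>x. f x + g x) h = ell2_inner X f h + ell2_inner X g h"
  by (simp add: ell2_inner_commute[of X _ h] ell2_inner_add_right assms)

lemma ell2_inner_scale_left: "ell2_inner X (\<lambda>x. c * f x) g = cnj c * ell2_inner X f g"
  by (simp add: ell2_inner_commute[of X _ g] ell2_inner_scale_right)

lemma ell2_inner_diff_right:
  assumes "f \<in> ell2 X" "g \<in> ell2 X" "h \<in> ell2 X"
  shows "ell2_inner X f (\<lambda>x. g x - h x) = ell2_inner X f g - ell2_inner X f h"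
  using ell2_inner_add_right[of f X g "\<lambda>x. -1 * h x"] ell2_inner_scale_right[of X f "-1" h]
    ell2_scale[of h X "-1"] assms by simp

lemma ell2_inner_ket: "x \<in> X \<Longrightarrow> ell2_inner X (ket x) f = f x"
  unfolding ell2_inner_def
  by (subst infsum_cong_neutral[of "{x}" X _ "\<lambda>y. cnj (ket x y) * f y"]) (auto simp: ket_def)

lemma ell2_inner_tendsto:
  assumes "f \<in> ell2 X" "\<And>n. g n \<in> ell2 X" "h \<in> ell2 X"
    and lim: "(\<lambda>n. ell2_norm X (\<lambda>x. g n x - h x)) \<longlonglongrightarrow> 0"
  shows "(\<lambda>n. ell2_inner X f (g n)) \<longlonglongrightarrow> ell2_inner X f h"
proof -
  have "(\<lambda>n. ell2_inner X f (g n) - ell2_inner X f h) \<longlonglongrightarrow> 0"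
  proof (rule tendsto_0_le[OF lim, where K = "ell2_norm X f"], rule always_eventually, rule allI)
    fix n
    show "norm (ell2_inner X f (g n) - ell2_inner X f h)
        \<le> norm (ell2_norm X (\<lambda>x. g n x - h x)) * ell2_norm X f"
      using ell2_Cauchy_Schwarz[OF assms(1) ell2_diff[OF assms(2,3)], of n] assms
      by (simp add: ell2_inner_diff_right mult.commute)
  qed
  then show ?thesis
    by (simp add: LIM_zero_iff)
qed

text \<open>Each coordinate is dominated by the norm, so a Cauchy sequence has a coordinatewise
  limit, which is then shown to be a norm limit. Both kinds of convergence are recorded: the
  extension to the completion is defined coordinatewise, but is multiplicative and respects adjoints
  because of norm convergence.\<close>

lemma ell2_complete:
  assumes mem: "\<And>n. f n \<in> ell2 X"
    and cauchy: "\<And>\<epsilon>. \<epsilon> > 0 \<Longrightarrow> \<exists>M. \<forall>m\<ge>M. \<forall>n\<ge>M. ell2_norm X (\<lambda>x. f m x - f n x) < \<epsilon>"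
  shows "\<exists>g\<in>ell2 X. (\<forall>x. (\<lambda>n. f n x) \<longlonglongrightarrow> g x) \<and> (\<lambda>n. ell2_norm X (\<lambda>x. f n x - g x)) \<longlonglongrightarrow> 0"
proof -
  have "Cauchy (\<lambda>n. f n x)" for x
  proof (rule CauchyI)
    fix e :: real assume "0 < e"
    then obtain M where M: "\<forall>m\<ge>M. \<forall>n\<ge>M. ell2_norm X (\<lambda>x. f m x - f n x) < e"
      using cauchy by blast
    have "cmod (f m x - f n x) \<le> ell2_norm X (\<lambda>x. f m x - f n x)" for m n
      by (rule cmod_le_ell2_norm[of "\<lambda>x. f m x - f n x" X x]) (simp add: ell2_diff mem)
    then show "\<exists>M. \<forall>m\<ge>M. \<forall>n\<ge>M. norm (f m x - f n x) < e"
      using M order.strict_trans1 by blast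
  qed
  then have "\<exists>l. (\<lambda>n. f n x) \<longlonglongrightarrow> l" for x
    by (simp add: Cauchy_convergent_iff convergent_def)
  then obtain g where g: "(\<lambda>n. f n x) \<longlonglongrightarrow> g x" for x
    by metis
  have g_outside: "g x = 0" if "x \<notin> X" for x
    using g[of x] by (simp add: ell2_outside[OF mem that] LIMSEQ_const_iff)
  \<comment> \<open>The limit in m is taken on a fixed finite set, where \<open>L2_set\<close> is a
    continuous function of finitely many coordinates; the resulting bound is independent of
    \<open>F\<close>, as \<open>ell2I\<close> demands.\<close>
  have close: "L2_set (\<lambda>x. cmod (g x - f n x)) F \<le> e"
    if M: "\<forall>m\<ge>M. \<forall>n\<ge>M. ell2_norm X (\<lambda>x. f m x - f n x) < e"
      and "n \<ge> M" "finite F" "F \<subseteq> X" for e M n F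
  proof (rule LIMSEQ_le_const2)
    show "(\<lambda>m. L2_set (\<lambda>x. cmod (f m x - f n x)) F) \<longlonglongrightarrow> L2_set (\<lambda>x. cmod (g x - f n x)) F"
      unfolding L2_set_def by (intro tendsto_intros g)
    show "\<exists>N. \<forall>m\<ge>N. L2_set (\<lambda>x. cmod (f m x - f n x)) F \<le> e"
    proof (intro exI[of _ M] allI impI)
      fix m assume "m \<ge> M"
      have "L2_set (\<lambda>x. cmod (f m x - f n x)) F \<le> ell2_norm X (\<lambda>x. f m x - f n x)"
        using that by (intro L2_set_le_ell2_norm ell2_diff mem)
      then show "L2_set (\<lambda>x. cmod (f m x - f n x)) F \<le> e"
        using M \<open>m \<ge> M\<close> \<open>n \<ge> M\<close> by force
    qed
  qed
  have diff: "(\<lambda>x. g x - f n x) \<in> ell2 X" "ell2_norm X (\<lambda>x. g x - f n x) \<le> e"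
    if "\<forall>m\<ge>M. \<forall>n\<ge>M. ell2_norm X (\<lambda>x. f m x - f n x) < e" "n \<ge> M" for e M n
    using ell2I[OF _ close[OF that]] g_outside ell2_outside[OF mem] by simp_all
  \<comment> \<open>Writing g = (g - f M) + f M, with M chosen for the tolerance 1, places g in the
    space.\<close>
  obtain M where "\<forall>m\<ge>M. \<forall>n\<ge>M. ell2_norm X (\<lambda>x. f m x - f n x) < 1"
    using cauchy[of 1] by auto
  from ell2_add[OF diff(1)[OF this order_refl] mem[of M]] have mem_g: "g \<in> ell2 X"
    by simp
  have "(\<lambda>n. ell2_norm X (\<lambda>x. f n x - g x)) \<longlonglongrightarrow> 0"
  proof (rule LIMSEQ_I)
    fix r :: real assume r: "0 < r"
    then obtain M where M: "\<forall>m\<ge>M. \<forall>n\<ge>M. ell2_norm X (\<lambda>x. f m x - f n x) < r/2"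
      using cauchy[of "r/2"] by auto
    have "norm (ell2_norm X (\<lambda>x. f n x - g x) - 0) < r" if "n \<ge> M" for n
      using diff(2)[OF M that] r by (simp add: ell2_norm_minus_commute[of X "f n"])
    then show "\<exists>no. \<forall>n\<ge>no. norm (ell2_norm X (\<lambda>x. f n x - g x) - 0) < r"
      by blast
  qed
  with mem_g g show ?thesis
    by blast
qed

section \<open>Bounded operators and the operator norm\<close>

lemma ell2_operatorsD:
  assumes "T \<in> ell2_operators X"
  shows "f \<in> ell2 X \<Longrightarrow> T f \<in> ell2 X"
    and "f \<in> ell2 X \<Longrightarrow> g \<in> ell2 X \<Longrightarrow> T (\<lambda>x. f x + g x) = (\<lambda>x. T f x + T g x)"
    and "f \<in> ell2 X \<Longrightarrow> T (\<lambda>x. c * f x) = (\<lambda>x. c * T f x)"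
    and "f \<notin> ell2 X \<Longrightarrow> T f = undefined"
  using assms by (auto simp: ell2_operators_def PiE_def extensional_def)

lemma ell2_operators_diff:
  assumes "T \<in> ell2_operators X" "f \<in> ell2 X" "g \<in> ell2 X"
  shows "T (\<lambda>x. f x - g x) = (\<lambda>x. T f x - T g x)"
  using ell2_operatorsD(2)[OF assms(1,2) ell2_scale[OF assms(3), of "-1"]]
    ell2_operatorsD(3)[OF assms(1,3), of "-1"] by simp

lemma ell2_operator_eqI:
  assumes "T \<in> ell2_operators X" "T' \<in> ell2_operators X" "\<And>f. f \<in> ell2 X \<Longrightarrow> T f = T' f"
  shows "T = T'"
  using assms by (metis ell2_operatorsD(4) ext)

lemma ell2_operatorsI:
  assumes "\<And>f. f \<in> ell2 X \<Longrightarrow> T f \<in> ell2 X"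
    and "\<And>f g. f \<in> ell2 X \<Longrightarrow> g \<in> ell2 X \<Longrightarrow> T (\<lambda>x. f x + g x) = (\<lambda>x. T f x + T g x)"
    and "\<And>c f. f \<in> ell2 X \<Longrightarrow> T (\<lambda>x. c * f x) = (\<lambda>x. c * T f x)"
    and "\<And>f. f \<in> ell2 X \<Longrightarrow> ell2_norm X (T f) \<le> C * ell2_norm X f"
    and "\<And>f. f \<notin> ell2 X \<Longrightarrow> T f = undefined"
  shows "T \<in> ell2_operators X"
  using assms unfolding ell2_operators_def by (auto intro!: PiE_I exI[of _ C])

lemma bounded_operators_nrm_bdd_above:
  assumes "T \<in> ell2_operators X"
  shows "bdd_above ((\<lambda>f. ell2_norm X (T f)) ` {f \<in> ell2 X. ell2_norm X f \<le> 1})"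
proof -
  obtain C where C: "\<forall>f\<in>ell2 X. ell2_norm X (T f) \<le> C * ell2_norm X f"
    using assms by (auto simp: ell2_operators_def)
  have "ell2_norm X (T f) \<le> \<bar>C\<bar>" if "f \<in> ell2 X" "ell2_norm X f \<le> 1" for f
  proof -
    have "C * ell2_norm X f \<le> \<bar>C\<bar> * 1"
      using that by (intro mult_mono) auto
    then show ?thesis
      using C that by fastforce
  qed
  then show ?thesis
    by (auto intro!: bdd_aboveI2)
qed

lemma bounded_operators_nrm_nonneg:
  assumes "T \<in> ell2_operators X"
  shows "0 \<le> nrm (bounded_operators X) T"
proof -
  have "ell2_norm X (T (\<lambda>x. 0)) \<le> nrm (bounded_operators X) T"
    unfolding bounded_operators_def
    by (simp, rule cSUP_upper[OF _ bounded_operators_nrm_bdd_above[OF assms]]) (simp add: ell2_zero)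
  then show ?thesis
    by (rule order_trans[OF ell2_norm_nonneg])
qed

text \<open>The supremum defining \<open>nrm\<close> runs over the unit ball, so f is rescaled to
  norm one. A vector of norm zero cannot be rescaled; there any constant bounding T already forces
  the image to have norm zero.\<close>

lemma bounded_operators_nrm_bound:
  assumes T: "T \<in> ell2_operators X" and f: "f \<in> ell2 X"
  shows "ell2_norm X (T f) \<le> nrm (bounded_operators X) T * ell2_norm X f"
proof (cases "ell2_norm X f = 0")
  case True
  moreover have "\<exists>C. ell2_norm X (T f) \<le> C * ell2_norm X f"
    using assms by (auto simp: ell2_operators_def)
  ultimately show ?thesis
    by auto
next
  case False
  define c :: complex where "c = of_real (inverse (ell2_norm X f))"
  have pos: "0 < ell2_norm X f"
    using False ell2_norm_nonneg[of X f] by linarith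
  have "ell2_norm X (T (\<lambda>x. c * f x)) \<le> nrm (bounded_operators X) T"
    unfolding bounded_operators_def
    by (simp, rule cSUP_upper[OF _ bounded_operators_nrm_bdd_above[OF T]])
      (use pos f in \<open>simp add: ell2_scale ell2_norm_scale c_def norm_inverse\<close>)
  moreover have "ell2_norm X (T (\<lambda>x. c * f x)) = inverse (ell2_norm X f) * ell2_norm X (T f)"
    using pos by (simp only: ell2_operatorsD(3)[OF T f] ell2_norm_scale)
      (simp add: c_def norm_inverse)
  ultimately show ?thesis
    using pos by (simp add: field_simps)
qed

lemma bounded_operators_nrm_leI:
  assumes T: "T \<in> ell2_operators X" and "0 \<le> C"
    and "\<And>f. f \<in> ell2 X \<Longrightarrow> ell2_norm X (T f) \<le> C * ell2_norm X f"
  shows "nrm (bounded_operators X) T \<le> C"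
proof -
  have "ell2_norm X (T f) \<le> C" if "f \<in> ell2 X" "ell2_norm X f \<le> 1" for f
    using assms(3)[OF that(1)] mult_left_le[OF that(2) \<open>0 \<le> C\<close>] by linarith
  then show ?thesis
    unfolding bounded_operators_def by (auto intro!: cSUP_least ell2_zero exI[of _ "\<lambda>x. 0"])
qed

section \<open>Operators with explicit adjoints\<close>

text \<open>Adjoints are exhibited instead of being obtained from the Riesz theorem: they start from
  a relation and its converse and survive sums, scalar multiples and limits.\<close>

definition adjoint_pair ::
    "'x set \<Rightarrow> (('x \<Rightarrow> complex) \<Rightarrow> ('x \<Rightarrow> complex)) \<Rightarrow> (('x \<Rightarrow> complex) \<Rightarrow> ('x \<Rightarrow> complex)) \<Rightarrow> bool"
  where "adjoint_pair X T T' \<longleftrightarrow> T \<in> ell2_operators X \<and> T' \<in> ell2_operators X \<and>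
    (\<forall>f\<in>ell2 X. \<forall>g\<in>ell2 X. ell2_inner X (T f) g = ell2_inner X f (T' g))"

lemma adjoint_pair_commute: "adjoint_pair X T T' \<Longrightarrow> adjoint_pair X T' T"
  unfolding adjoint_pair_def by (metis ell2_inner_commute)

text \<open>Pairing with a basis vector reads off a coordinate of \<open>T' g\<close>, so at most
  one operator can satisfy the defining equation and the definite description evaluates to the given
  partner.\<close>

lemma adjoint_eqI:
  assumes "adjoint_pair X T T'"
  shows "adjoint X T = T'"
  unfolding adjoint_def
proof (rule the_equality)
  show "T' \<in> ell2_operators X \<and> (\<forall>f\<in>ell2 X. \<forall>g\<in>ell2 X. ell2_inner X (T f) g = ell2_inner X f (T' g))"
    using assms by (simp add: adjoint_pair_def)
next
  fix T'' assume T'': "T'' \<in> ell2_operators X \<and>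
    (\<forall>f\<in>ell2 X. \<forall>g\<in>ell2 X. ell2_inner X (T f) g = ell2_inner X f (T'' g))"
  have T': "T' \<in> ell2_operators X"
    using assms by (simp add: adjoint_pair_def)
  show "T'' = T'"
  proof (rule ell2_operator_eqI[of _ X])
    fix g assume g: "g \<in> ell2 X"
    have "T'' g x = T' g x" if "x \<in> X" for x
      using assms T'' g ket_in_ell2[OF that] ell2_inner_ket[OF that]
      unfolding adjoint_pair_def by metis
    moreover have "T'' g x = T' g x" if "x \<notin> X" for x
      using T' T'' g that by (simp add: ell2_operatorsD(1) ell2_outside[of _ X])
    ultimately show "T'' g = T' g"
      by blast
  qed (use T' T'' in auto)
qed

text \<open>With n the operator norm, (n T)^2 <= n (T' T), because the squared norm of T f is the
  inner product of f with T' T f, estimated by Cauchy-Schwarz. Since n (T' T) <= n T' * n T,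
  cancelling n T gives n T <= n T'. Combined with the swapped pair, this yields the
  C*-identity.\<close>

lemma adjoint_pair_nrm_le:
  assumes "adjoint_pair X T T'"
  shows "nrm (bounded_operators X) T \<le> nrm (bounded_operators X) T'"
    and "(nrm (bounded_operators X) T)\<^sup>2 \<le> nrm (bounded_operators X) (compose (ell2 X) T' T)"
proof -
  let ?n = "nrm (bounded_operators X)"
  let ?TT = "compose (ell2 X) T' T"
  have T: "T \<in> ell2_operators X" and T': "T' \<in> ell2_operators X"
    using assms by (auto simp: adjoint_pair_def)
  have bound: "ell2_norm X (T' (T f)) \<le> ?n T' * ?n T * ell2_norm X f" if "f \<in> ell2 X" for f
    using order_trans[OF bounded_operators_nrm_bound[OF T' ell2_operatorsD(1)[OF T that]]
        mult_left_mono[OF bounded_operators_nrm_bound[OF T that]]]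
      bounded_operators_nrm_nonneg[OF T'] by (simp add: mult.assoc)
  have TT: "?TT \<in> ell2_operators X"
    using bound by (intro ell2_operatorsI[of _ _ "?n T' * ?n T"])
      (auto simp: compose_def ell2_operatorsD[OF T] ell2_operatorsD[OF T'] ell2_add ell2_scale)
  have "ell2_norm X (T f) \<le> sqrt (?n ?TT) * ell2_norm X f" if f: "f \<in> ell2 X" for f
  proof -
    have "complex_of_real ((ell2_norm X (T f))\<^sup>2) = ell2_inner X f (?TT f)"
      using assms f ell2_operatorsD(1)[OF T f]
      by (simp add: adjoint_pair_def compose_def flip: ell2_inner_self[of _ X] del: of_real_power)
    then have "(ell2_norm X (T f))\<^sup>2 = cmod (ell2_inner X f (?TT f))"
      by (metis abs_of_nonneg norm_of_real zero_le_power2)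
    also have "\<dots> \<le> ell2_norm X f * ell2_norm X (?TT f)"
      by (intro ell2_Cauchy_Schwarz f ell2_operatorsD(1)[OF TT])
    also have "\<dots> \<le> ell2_norm X f * (?n ?TT * ell2_norm X f)"
      by (intro mult_left_mono bounded_operators_nrm_bound TT f) simp
    also have "\<dots> = (sqrt (?n ?TT) * ell2_norm X f)\<^sup>2"
      using bounded_operators_nrm_nonneg[OF TT] by (simp add: power2_eq_square)
    finally show ?thesis
      by (rule power2_le_imp_le) (simp add: bounded_operators_nrm_nonneg[OF TT])
  qed
  then have "?n T \<le> sqrt (?n ?TT)"
    by (intro bounded_operators_nrm_leI T) (simp_all add: bounded_operators_nrm_nonneg[OF TT])
  then show *: "(?n T)\<^sup>2 \<le> ?n ?TT"
    using bounded_operators_nrm_nonneg[OF T] bounded_operators_nrm_nonneg[OF TT] real_le_rsqrt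
      real_sqrt_le_iff real_sqrt_unique by (metis power_mono real_sqrt_pow2)
  have "?n ?TT \<le> ?n T' * ?n T"
    using bound by (intro bounded_operators_nrm_leI TT)
      (simp_all add: compose_def bounded_operators_nrm_nonneg T T')
  with * have "?n T * ?n T \<le> ?n T' * ?n T"
    by (simp add: power2_eq_square)
  then show "?n T \<le> ?n T'"
    using bounded_operators_nrm_nonneg[OF T] bounded_operators_nrm_nonneg[OF T']
    by (cases "?n T = 0") auto
qed

lemma adjoint_pair_add:
  assumes "adjoint_pair X T T'" "adjoint_pair X W W'"
  shows "adjoint_pair X (\<lambda>f\<in>ell2 X. \<lambda>x. T f x + W f x) (\<lambda>f\<in>ell2 X. \<lambda>x. T' f x + W' f x)"
proof -
  have "(\<lambda>f\<in>ell2 X. \<lambda>x. T f x + W f x) \<in> ell2_operators X"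
    if T: "T \<in> ell2_operators X" and W: "W \<in> ell2_operators X" for T W
  proof (rule ell2_operatorsI)
    fix f assume f: "f \<in> ell2 X"
    show "ell2_norm X ((\<lambda>f\<in>ell2 X. \<lambda>x. T f x + W f x) f)
      \<le> (nrm (bounded_operators X) T + nrm (bounded_operators X) W) * ell2_norm X f"
      using ell2_norm_triangle[OF ell2_operatorsD(1)[OF T f] ell2_operatorsD(1)[OF W f]]
        bounded_operators_nrm_bound[OF T f] bounded_operators_nrm_bound[OF W f] f
      by (simp add: distrib_right)
  qed (use T W in \<open>simp_all add: ell2_operatorsD ell2_add ell2_scale algebra_simps\<close>)
  then show ?thesis
    using assms by (auto simp: adjoint_pair_def ell2_inner_add_left ell2_inner_add_right ell2_operatorsD(1))
qed

lemma adjoint_pair_scale: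
  assumes "adjoint_pair X T T'"
  shows "adjoint_pair X (\<lambda>f\<in>ell2 X. \<lambda>x. c * T f x) (\<lambda>f\<in>ell2 X. \<lambda>x. cnj c * T' f x)"
proof -
  have "(\<lambda>f\<in>ell2 X. \<lambda>x. c * T f x) \<in> ell2_operators X" if T: "T \<in> ell2_operators X" for T c
  proof (rule ell2_operatorsI)
    fix f assume f: "f \<in> ell2 X"
    show "ell2_norm X ((\<lambda>f\<in>ell2 X. \<lambda>x. c * T f x) f)
      \<le> (cmod c * nrm (bounded_operators X) T) * ell2_norm X f"
      using mult_left_mono[OF bounded_operators_nrm_bound[OF T f], of "cmod c"] f
      by (simp add: ell2_norm_scale mult.assoc)
  qed (use T in \<open>simp_all add: ell2_operatorsD ell2_add ell2_scale algebra_simps\<close>)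
  then show ?thesis
    using assms by (auto simp: adjoint_pair_def ell2_inner_scale_left ell2_inner_scale_right ell2_operatorsD(1))
qed

lemma adjoint_pair_zero: "adjoint_pair X (\<lambda>f\<in>ell2 X. \<lambda>x. 0) (\<lambda>f\<in>ell2 X. \<lambda>x. 0)"
proof -
  have "(\<lambda>f\<in>ell2 X. \<lambda>x. 0) \<in> ell2_operators X"
    by (rule ell2_operatorsI[of _ _ 0]) (auto simp: ell2_zero ell2_add ell2_scale)
  then show ?thesis
    by (simp add: adjoint_pair_def ell2_inner_def)
qed

subsection \<open>Operators induced by partial bijections\<close>

text \<open>A relation rather than a partial function, so that composition and inversion are
  \<open>O\<close> and converse, with domains and ranges taking care of themselves.\<close>

definition partial_bijection :: "'x set \<Rightarrow> 'x rel \<Rightarrow> bool"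
  where "partial_bijection X R \<longleftrightarrow> R \<subseteq> X \<times> X \<and> single_valued R \<and> single_valued (R\<inverse>)"

text \<open>For a partial bijection this is the partial isometry sending \<open>ket x\<close> to
  \<open>ket y\<close> whenever (x, y) is in R and killing \<open>ket x\<close> for x outside
  \<open>Domain R\<close>.\<close>

definition relation_operator :: "'x set \<Rightarrow> 'x rel \<Rightarrow> ('x \<Rightarrow> complex) \<Rightarrow> ('x \<Rightarrow> complex)"
  where "relation_operator X R =
    (\<lambda>f\<in>ell2 X. \<lambda>y. if y \<in> Range R then f (THE x. (x, y) \<in> R) else 0)"

lemma partial_bijection_converse: "partial_bijection X R \<Longrightarrow> partial_bijection X (R\<inverse>)"
  by (auto simp: partial_bijection_def)

lemma partial_bijection_relcomp:
  "partial_bijection X R \<Longrightarrow> partial_bijection X R' \<Longrightarrow> partial_bijection X (R O R')"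
  by (auto simp: partial_bijection_def converse_relcomp intro: single_valued_relcomp)

lemma partial_bijection_Id_on: "D \<subseteq> X \<Longrightarrow> partial_bijection X (Id_on D)"
  by (auto simp: partial_bijection_def single_valued_def)

lemma partial_bijection_the:
  assumes "partial_bijection X R" "(x, y) \<in> R"
  shows "(THE x. (x, y) \<in> R) = x" and "(THE y. (x, y) \<in> R) = y"
  using assms unfolding partial_bijection_def single_valued_def by (blast intro: the_equality)+

lemma relation_operator_related:
  assumes "partial_bijection X R" "f \<in> ell2 X" "(x, y) \<in> R"
  shows "relation_operator X R f y = f x"
  using assms by (auto simp: relation_operator_def partial_bijection_the(1)[OF assms(1,3)])

lemma relation_operator_unrelated:
  "f \<in> ell2 X \<Longrightarrow> y \<notin> Range R \<Longrightarrow> relation_operator X R f y = 0"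
  by (simp add: relation_operator_def)

lemma relation_operator_eqI:
  assumes "partial_bijection X R" "f \<in> ell2 X"
    and "\<And>x y. (x, y) \<in> R \<Longrightarrow> g y = f x" "\<And>y. y \<notin> Range R \<Longrightarrow> g y = 0"
  shows "relation_operator X R f = g"
proof
  fix y
  show "relation_operator X R f y = g y"
    using assms by (cases "y \<in> Range R") (auto simp: relation_operator_related relation_operator_unrelated)
qed

text \<open>On \<open>Range R\<close> the output is f read along the injection h that picks the
  unique preimage, so a finite sum of squares of the output is a finite sum of squares of f over an
  image of h.\<close>

lemma relation_operator_contraction:
  assumes R: "partial_bijection X R" and f: "f \<in> ell2 X"
  shows "relation_operator X R f \<in> ell2 X"
    and "ell2_norm X (relation_operator X R f) \<le> ell2_norm X f"
proof -
  define h where "h y = (THE x. (x, y) \<in> R)" for y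
  have h: "(h y, y) \<in> R" if "y \<in> Range R" for y
    unfolding h_def using that by (auto simp: partial_bijection_the[OF R])
  have inj: "inj_on h (Range R)"
    using R h unfolding inj_on_def partial_bijection_def single_valued_def by metis
  have outside: "relation_operator X R f x = 0" if "x \<notin> X" for x
    using R that by (intro relation_operator_unrelated f) (auto simp: partial_bijection_def)
  have le: "L2_set (\<lambda>y. cmod (relation_operator X R f y)) F \<le> ell2_norm X f"
    if F: "finite F" "F \<subseteq> X" for F
  proof -
    have "(\<Sum>y\<in>F. (cmod (relation_operator X R f y))\<^sup>2)
        = (\<Sum>y\<in>F \<inter> Range R. (cmod (relation_operator X R f y))\<^sup>2)"
      by (rule sum.mono_neutral_right) (auto simp: F f relation_operator_unrelated)
    also have "\<dots> = (\<Sum>y\<in>F \<inter> Range R. (cmod (f (h y)))\<^sup>2)"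
      by (rule sum.cong) (auto simp: f h_def relation_operator_def)
    also have "\<dots> = (\<Sum>x\<in>h ` (F \<inter> Range R). (cmod (f x))\<^sup>2)"
      by (rule sum.reindex_cong[symmetric, of h]) (auto intro: inj_on_subset[OF inj])
    finally have "L2_set (\<lambda>y. cmod (relation_operator X R f y)) F
        = L2_set (\<lambda>x. cmod (f x)) (h ` (F \<inter> Range R))"
      by (simp add: L2_set_def)
    also have "\<dots> \<le> ell2_norm X f"
      using h R F by (intro L2_set_le_ell2_norm f) (auto simp: partial_bijection_def)
    finally show ?thesis .
  qed
  show "relation_operator X R f \<in> ell2 X" "ell2_norm X (relation_operator X R f) \<le> ell2_norm X f"
    by - (rule ell2I[OF outside le]; assumption)+
qed

lemma relation_operator_in_ell2_operators:
  assumes R: "partial_bijection X R"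
  shows "relation_operator X R \<in> ell2_operators X"
proof (rule ell2_operatorsI[of _ _ 1])
  fix f assume f: "f \<in> ell2 X"
  show "relation_operator X R f \<in> ell2 X"
      "ell2_norm X (relation_operator X R f) \<le> 1 * ell2_norm X f"
    using relation_operator_contraction[OF R f] by simp_all
qed (auto simp: relation_operator_def ell2_add ell2_scale)

text \<open>Both inner products equal the sum of \<open>cnj (f x) * g y\<close> over all pairs (x,
  y) in R: one is indexed by second components, the other by first components.\<close>

lemma relation_operator_adjoint:
  assumes R: "partial_bijection X R"
  shows "adjoint_pair X (relation_operator X R) (relation_operator X (R\<inverse>))"
proof -
  have R': "partial_bijection X (R\<inverse>)"
    by (rule partial_bijection_converse[OF R])
  have "ell2_inner X (relation_operator X R f) g = ell2_inner X f (relation_operator X (R\<inverse>) g)"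
    if f: "f \<in> ell2 X" and g: "g \<in> ell2 X" for f g
  proof -
    have "ell2_inner X (relation_operator X R f) g
        = (\<Sum>\<^sub>\<infinity>y\<in>Range R. cnj (relation_operator X R f y) * g y)"
      unfolding ell2_inner_def using R
      by (intro infsum_cong_neutral) (auto simp: f relation_operator_unrelated partial_bijection_def)
    also have "\<dots> = (\<Sum>\<^sub>\<infinity>(x, y)\<in>R. cnj (f x) * g y)"
      using R by (intro infsum_reindex_bij_witness[of _ snd "\<lambda>y. (THE x. (x, y) \<in> R, y)"])
        (auto simp: relation_operator_related[OF R f] partial_bijection_the[OF R])
    also have "\<dots> = (\<Sum>\<^sub>\<infinity>x\<in>Domain R. cnj (f x) * relation_operator X (R\<inverse>) g x)"
      using R by (intro infsum_reindex_bij_witness[of _ "\<lambda>x. (x, THE y. (x, y) \<in> R)" fst])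
        (auto simp: relation_operator_related[OF R' g] partial_bijection_the[OF R])
    also have "\<dots> = ell2_inner X f (relation_operator X (R\<inverse>) g)"
      unfolding ell2_inner_def using R
      by (intro infsum_cong_neutral) (auto simp: g relation_operator_unrelated partial_bijection_def)
    finally show ?thesis .
  qed
  then show ?thesis
    using R R' by (simp add: adjoint_pair_def relation_operator_in_ell2_operators)
qed

text \<open>\<open>O\<close> applies its left argument first, whereas a product of operators applies
  its right factor first; the order is therefore reversed.\<close>

lemma relation_operator_relcomp:
  assumes "partial_bijection X R" "partial_bijection X R'" "f \<in> ell2 X"
  shows "relation_operator X (R O R') f = relation_operator X R' (relation_operator X R f)"
proof (rule relation_operator_eqI)
  note Rf = relation_operator_contraction(1)[OF assms(1,3)]
  show "relation_operator X R' (relation_operator X R f) z = f x" if "(x, z) \<in> R O R'" for x z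
    using that Rf assms by (auto simp: relation_operator_related)
  show "relation_operator X R' (relation_operator X R f) z = 0" if "z \<notin> Range (R O R')" for z
  proof (cases "z \<in> Range R'")
    case True
    then obtain y where "(y, z) \<in> R'"
      by blast
    moreover from this have "y \<notin> Range R"
      using that by blast
    ultimately show ?thesis
      using Rf assms by (simp add: relation_operator_related relation_operator_unrelated)
  qed (simp add: Rf relation_operator_unrelated)
qed (use assms in \<open>auto intro: partial_bijection_relcomp\<close>)

lemma relation_operator_Id_on:
  assumes "D \<subseteq> X" "f \<in> ell2 X"
  shows "relation_operator X (Id_on D) f = (\<lambda>x. if x \<in> D then f x else 0)"
  by (rule relation_operator_eqI) (use assms in \<open>auto intro: partial_bijection_Id_on\<close>)

lemma partial_bijection_graph:
  "inj_on \<phi> X \<Longrightarrow> \<phi> ` X \<subseteq> X \<Longrightarrow> partial_bijection X {(x, \<phi> x) | x. x \<in> X}"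
  by (auto simp: partial_bijection_def single_valued_def inj_on_def)

text \<open>Brings \<open>translation_unitary\<close> and \<open>endomorphism_isometry\<close>, both
  defined as induced isometries, into the calculus of relations.\<close>

lemma induced_isometry_eq_relation_operator:
  assumes "inj_on \<phi> X" "\<phi> ` X \<subseteq> X"
  shows "induced_isometry X \<phi> = relation_operator X {(x, \<phi> x) | x. x \<in> X}"
proof
  fix f
  show "induced_isometry X \<phi> f = relation_operator X {(x, \<phi> x) | x. x \<in> X} f"
  proof (cases "f \<in> ell2 X")
    case True
    show ?thesis
      by (rule relation_operator_eqI[symmetric])
        (use True assms in \<open>auto simp: induced_isometry_def inv_into_f_f intro: partial_bijection_graph\<close>)
  qed (simp add: induced_isometry_def relation_operator_def)
qed


section \<open>Seminormed star-algebras and their completions\<close>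

text \<open>
  Scalar multiplication is required to be multiplication by \<open>c \<odot> \<one>\<close>, so that its continuity and the
  scalar invariance of ideals come for free.
\<close>

locale seminormed_star_algebra = ring A
  for A :: "('a, 'm) star_algebra_scheme" (structure) and N :: "'a \<Rightarrow> real" +
  assumes smult_one_closed [simp]: "c \<odot> \<one> \<in> carrier A"
    and smult_eq_mult: "a \<in> carrier A \<Longrightarrow> c \<odot> a = (c \<odot> \<one>) \<otimes> a"
    and star_closed [simp]: "a \<in> carrier A \<Longrightarrow> star A a \<in> carrier A"
    and star_add: "\<lbrakk>a \<in> carrier A; b \<in> carrier A\<rbrakk> \<Longrightarrow> star A (a \<oplus> b) = star A a \<oplus> star A b"
    and star_mult: "\<lbrakk>a \<in> carrier A; b \<in> carrier A\<rbrakk> \<Longrightarrow> star A (a \<otimes> b) = star A b \<otimes> star A a"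
    and star_star: "a \<in> carrier A \<Longrightarrow> star A (star A a) = a"
    and N_nonneg: "a \<in> carrier A \<Longrightarrow> 0 \<le> N a"
    and N_zero: "N \<zero> = 0"
    and N_add: "\<lbrakk>a \<in> carrier A; b \<in> carrier A\<rbrakk> \<Longrightarrow> N (a \<oplus> b) \<le> N a + N b"
    and N_mult: "\<lbrakk>a \<in> carrier A; b \<in> carrier A\<rbrakk> \<Longrightarrow> N (a \<otimes> b) \<le> N a * N b"
    and N_uminus: "a \<in> carrier A \<Longrightarrow> N (\<ominus> a) = N a"
    and N_star: "a \<in> carrier A \<Longrightarrow> N (star A a) = N a"
begin

lemma smult_closed: "a \<in> carrier A \<Longrightarrow> c \<odot> a \<in> carrier A"
  by (subst smult_eq_mult) auto

lemma star_one: "star A \<one> = \<one>"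
  using star_mult[of "star A \<one>" \<one>] star_star[of \<one>] by simp

lemma star_zero: "star A \<zero> = \<zero>"
  using star_add[of \<zero> \<zero>] by (simp add: add.l_cancel_one')

lemma star_uminus: "a \<in> carrier A \<Longrightarrow> star A (\<ominus> a) = \<ominus> star A a"
  using star_add[of "\<ominus> a" a] by (simp add: l_neg star_zero minus_equality)

lemma star_minus:
  "\<lbrakk>a \<in> carrier A; b \<in> carrier A\<rbrakk> \<Longrightarrow> star A (a \<ominus> b) = star A a \<ominus> star A b"
  by (simp add: a_minus_def star_add star_uminus)

lemma N_minus_self: "a \<in> carrier A \<Longrightarrow> N (a \<ominus> a) = 0"
  by (simp add: r_neg N_zero a_minus_def)

lemma N_minus_commute: "\<lbrakk>a \<in> carrier A; b \<in> carrier A\<rbrakk> \<Longrightarrow> N (a \<ominus> b) = N (b \<ominus> a)"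
  using N_uminus[of "b \<ominus> a"] by (simp add: a_minus_def minus_add a_comm)

lemma N_minus_triangle:
  assumes "a \<in> carrier A" "b \<in> carrier A" "c \<in> carrier A"
  shows "N (a \<ominus> c) \<le> N (a \<ominus> b) + N (b \<ominus> c)"
proof -
  have "a \<ominus> c = (a \<ominus> b) \<oplus> (b \<ominus> c)"
    using assms by algebra
  then show ?thesis
    using assms N_add[of "a \<ominus> b" "b \<ominus> c"] by simp
qed

lemma N_reverse_triangle:
  assumes "a \<in> carrier A" "b \<in> carrier A"
  shows "\<bar>N a - N b\<bar> \<le> N (a \<ominus> b)"
proof -
  have "N x \<le> N (x \<ominus> y) + N y" if "x \<in> carrier A" "y \<in> carrier A" for x y
    using N_minus_triangle[of x y \<zero>] that by (simp add: a_minus_def)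
  from this[of a b] this[of b a] assms show ?thesis
    by (simp add: N_minus_commute[of b a])
qed

lemma N_add_minus_add:
  assumes "a \<in> carrier A" "b \<in> carrier A" "a' \<in> carrier A" "b' \<in> carrier A"
  shows "N (a \<oplus> b \<ominus> (a' \<oplus> b')) \<le> N (a \<ominus> a') + N (b \<ominus> b')"
proof -
  have "a \<oplus> b \<ominus> (a' \<oplus> b') = (a \<ominus> a') \<oplus> (b \<ominus> b')"
    using assms by algebra
  then show ?thesis
    using assms N_add[of "a \<ominus> a'" "b \<ominus> b'"] by simp
qed

text \<open>Telescoping through \<open>a' \<otimes> b\<close> changes one factor at a time. The
  coefficients N b and N a' are bounded along Cauchy sequences, which makes products of Cauchy
  sequences Cauchy and products of classes well defined.\<close>

lemma N_mult_minus_mult: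
  assumes "a \<in> carrier A" "b \<in> carrier A" "a' \<in> carrier A" "b' \<in> carrier A"
  shows "N (a \<otimes> b \<ominus> a' \<otimes> b') \<le> N b * N (a \<ominus> a') + N a' * N (b \<ominus> b')"
proof -
  have "a \<otimes> b \<ominus> a' \<otimes> b' = (a \<ominus> a') \<otimes> b \<oplus> a' \<otimes> (b \<ominus> b')"
    using assms by algebra
  then show ?thesis
    using assms N_add[of "(a \<ominus> a') \<otimes> b" "a' \<otimes> (b \<ominus> b')"] N_mult[of "a \<ominus> a'" b] N_mult[of a' "b \<ominus> b'"]
    by (simp add: mult.commute)
qed

lemma N_star_minus_star:
  "\<lbrakk>a \<in> carrier A; b \<in> carrier A\<rbrakk> \<Longrightarrow> N (star A a \<ominus> star A b) = N (a \<ominus> b)"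
  by (simp add: N_star flip: star_minus)

section \<open>Cauchy sequences and the null relation\<close>

lemma cauchy_sequencesD:
  assumes "a \<in> cauchy_sequences A N"
  shows cauchy_sequences_carrier: "a n \<in> carrier A"
    and "0 < \<epsilon> \<Longrightarrow> \<exists>M. \<forall>m\<ge>M. \<forall>n\<ge>M. N (a m \<ominus> a n) < \<epsilon>"
  using assms by (auto simp: cauchy_sequences_def)

lemma cauchy_sequences_const: "a \<in> carrier A \<Longrightarrow> (\<lambda>n. a) \<in> cauchy_sequences A N"
  by (simp add: cauchy_sequences_def N_minus_self)

lemma cauchy_sequences_convergent_N:
  assumes a: "a \<in> cauchy_sequences A N"
  shows "convergent (\<lambda>n. N (a n))"
proof -
  have "Cauchy (\<lambda>n. N (a n))"
  proof (rule CauchyI)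
    fix e :: real assume "0 < e"
    then obtain M where M: "\<forall>m\<ge>M. \<forall>n\<ge>M. N (a m \<ominus> a n) < e"
      using cauchy_sequencesD(2)[OF a] by blast
    have "norm (N (a m) - N (a n)) < e" if "m \<ge> M" "n \<ge> M" for m n
      using M that N_reverse_triangle[of "a m" "a n"] cauchy_sequences_carrier[OF a] by fastforce
    then show "\<exists>M. \<forall>m\<ge>M. \<forall>n\<ge>M. norm (N (a m) - N (a n)) < e"
      by blast
  qed
  then show ?thesis
    by (rule Cauchy_convergent)
qed

lemma cauchy_sequences_bounded:
  assumes a: "a \<in> cauchy_sequences A N"
  obtains B where "0 \<le> B" "\<And>n. N (a n) \<le> B"
proof -
  have "Bseq (\<lambda>n. N (a n))"
    by (intro convergent_imp_Bseq cauchy_sequences_convergent_N a)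
  then obtain B where "B > 0" "\<And>n. norm (N (a n)) \<le> B"
    by (auto elim: BseqE)
  then show ?thesis
    using that[of B] by (simp add: abs_le_iff)
qed

text \<open>K and L act as Lipschitz constants in the two arguments, so sums, products, stars and
  negatives of Cauchy sequences are all instances; operations in one argument use the same sequence
  twice.\<close>

lemma cauchy_sequencesI:
  assumes "\<And>n. c n \<in> carrier A" "a \<in> cauchy_sequences A N" "b \<in> cauchy_sequences A N"
    and "0 \<le> K" "0 \<le> L"
    and le: "\<And>m n. N (c m \<ominus> c n) \<le> K * N (a m \<ominus> a n) + L * N (b m \<ominus> b n)"
  shows "c \<in> cauchy_sequences A N"
proof -
  have "\<exists>M. \<forall>m\<ge>M. \<forall>n\<ge>M. N (c m \<ominus> c n) < e" if "0 < e" for e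
  proof -
    \<comment> \<open>The summand 1 keeps the denominator positive when K and L vanish and makes (K
      + L) * d strictly smaller than e.\<close>
    define d where "d = e / (K + L + 1)"
    have d: "0 < d" "(K + L) * d < e"
      using that assms(4,5) by (simp_all add: d_def field_simps)
    obtain M where M: "\<forall>m\<ge>M. \<forall>n\<ge>M. N (a m \<ominus> a n) < d"
      using cauchy_sequencesD(2)[OF assms(2) d(1)] by blast
    obtain M' where M': "\<forall>m\<ge>M'. \<forall>n\<ge>M'. N (b m \<ominus> b n) < d"
      using cauchy_sequencesD(2)[OF assms(3) d(1)] by blast
    have "N (c m \<ominus> c n) < e" if "m \<ge> max M M'" "n \<ge> max M M'" for m n
    proof -
      have "K * N (a m \<ominus> a n) + L * N (b m \<ominus> b n) \<le> K * d + L * d"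
        using M M' that assms(4,5) by (intro add_mono mult_left_mono) (auto intro: less_imp_le)
      then show ?thesis
        using le[of m n] d(2) by (simp add: distrib_right)
    qed
    then show ?thesis
      by blast
  qed
  then show ?thesis
    using assms(1) by (simp add: cauchy_sequences_def)
qed

lemma cauchy_sequences_add:
  assumes a: "a \<in> cauchy_sequences A N" and b: "b \<in> cauchy_sequences A N"
  shows "(\<lambda>n. a n \<oplus> b n) \<in> cauchy_sequences A N"
  by (rule cauchy_sequencesI[OF _ a b, of _ 1 1])
    (simp_all add: N_add_minus_add cauchy_sequences_carrier[OF a] cauchy_sequences_carrier[OF b])

lemma cauchy_sequences_mult:
  assumes a: "a \<in> cauchy_sequences A N" and b: "b \<in> cauchy_sequences A N"
  shows "(\<lambda>n. a n \<otimes> b n) \<in> cauchy_sequences A N"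
proof -
  note [simp] = cauchy_sequences_carrier[OF a] cauchy_sequences_carrier[OF b]
  obtain B where B: "0 \<le> B" "\<And>n. N (b n) \<le> B"
    using cauchy_sequences_bounded[OF b] by blast
  obtain B' where B': "0 \<le> B'" "\<And>n. N (a n) \<le> B'"
    using cauchy_sequences_bounded[OF a] by blast
  have le: "N (a m \<otimes> b m \<ominus> a n \<otimes> b n) \<le> B * N (a m \<ominus> a n) + B' * N (b m \<ominus> b n)" for m n
    using N_mult_minus_mult[of "a m" "b m" "a n" "b n"]
      mult_right_mono[OF B(2)[of m] N_nonneg[of "a m \<ominus> a n"]]
      mult_right_mono[OF B'(2)[of n] N_nonneg[of "b m \<ominus> b n"]]
    by simp
  show ?thesis
    by (rule cauchy_sequencesI[OF _ a b B(1) B'(1) le]) simp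
qed

lemma cauchy_sequences_star:
  assumes a: "a \<in> cauchy_sequences A N"
  shows "(\<lambda>n. star A (a n)) \<in> cauchy_sequences A N"
  by (rule cauchy_sequencesI[OF _ a a, of _ 1 0])
    (simp_all add: N_star_minus_star cauchy_sequences_carrier[OF a])

lemma cauchy_sequences_uminus:
  assumes a: "a \<in> cauchy_sequences A N"
  shows "(\<lambda>n. \<ominus> a n) \<in> cauchy_sequences A N"
proof -
  note [simp] = cauchy_sequences_carrier[OF a]
  have "\<ominus> a m \<ominus> \<ominus> a n = \<ominus> (a m \<ominus> a n)" for m n
    by (simp add: a_minus_def minus_add)
  then have le: "N (\<ominus> a m \<ominus> \<ominus> a n) \<le> 1 * N (a m \<ominus> a n) + 0 * N (a m \<ominus> a n)" for m n
    by (simp add: N_uminus)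
  show ?thesis
    by (rule cauchy_sequencesI[OF _ a a _ _ le]) simp_all
qed

lemma null_relation_iff:
  assumes "a \<in> cauchy_sequences A N" "b \<in> cauchy_sequences A N"
  shows "(a, b) \<in> null_relation A N \<longleftrightarrow> (\<lambda>n. N (a n \<ominus> b n)) \<longlonglongrightarrow> 0"
  using assms by (simp add: null_relation_def)

lemma null_relation_cauchy:
  assumes "(a, b) \<in> null_relation A N"
  shows "a \<in> cauchy_sequences A N" "b \<in> cauchy_sequences A N"
  using assms by (simp_all add: null_relation_def)

lemma null_relationI:
  assumes c: "c \<in> cauchy_sequences A N" "d \<in> cauchy_sequences A N"
    and a: "(a, a') \<in> null_relation A N" and b: "(b, b') \<in> null_relation A N"
    and le: "\<And>n. N (c n \<ominus> d n) \<le> K * N (a n \<ominus> a' n) + L * N (b n \<ominus> b' n)"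
  shows "(c, d) \<in> null_relation A N"
proof -
  have lim: "(\<lambda>n. K * N (a n \<ominus> a' n) + L * N (b n \<ominus> b' n)) \<longlonglongrightarrow> K * 0 + L * 0"
    using a b by (intro tendsto_intros) (simp_all add: null_relation_def)
  have "0 \<le> N (c n \<ominus> d n)" for n
    using c by (simp add: N_nonneg cauchy_sequences_carrier)
  then have "(\<lambda>n. N (c n \<ominus> d n)) \<longlonglongrightarrow> 0"
    using lim le by (intro real_tendsto_sandwich[OF _ _ tendsto_const lim[simplified]]) simp_all
  then show ?thesis
    using c by (simp add: null_relation_iff)
qed

lemma equiv_null_relation: "equiv (cauchy_sequences A N) (null_relation A N)"
proof (rule equivI)
  show "null_relation A N \<subseteq> cauchy_sequences A N \<times> cauchy_sequences A N"
    by (auto simp: null_relation_def)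
  show refl: "refl_on (cauchy_sequences A N) (null_relation A N)"
    by (auto simp: refl_on_def null_relation_def cauchy_sequences_def N_minus_self)
  show "sym (null_relation A N)"
  proof (rule symI)
    fix a b assume ab: "(a, b) \<in> null_relation A N"
    note cs = null_relation_cauchy[OF ab]
    show "(b, a) \<in> null_relation A N"
      by (rule null_relationI[OF cs(2,1) ab ab, of 1 0])
        (simp add: N_minus_commute cauchy_sequences_carrier[OF cs(1)] cauchy_sequences_carrier[OF cs(2)])
  qed
  show "trans (null_relation A N)"
  proof (rule transI)
    fix a b c assume ab: "(a, b) \<in> null_relation A N" and bc: "(b, c) \<in> null_relation A N"
    note cs = null_relation_cauchy[OF ab] null_relation_cauchy[OF bc]
    show "(a, c) \<in> null_relation A N"
      by (rule null_relationI[OF cs(1,4) ab bc, of 1 1])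
        (simp add: N_minus_triangle cauchy_sequences_carrier[OF cs(1)]
          cauchy_sequences_carrier[OF cs(2)] cauchy_sequences_carrier[OF cs(4)])
  qed
qed

section \<open>Operations and norm of the completion\<close>

abbreviation completion_class :: "(nat \<Rightarrow> 'a) \<Rightarrow> (nat \<Rightarrow> 'a) set"
  where "completion_class a \<equiv> null_relation A N `` {a}"

lemma completion_class_eqI:
  "(a, b) \<in> null_relation A N \<Longrightarrow> completion_class a = completion_class b"
  by (rule equiv_class_eq[OF equiv_null_relation])

lemma completion_class_eq_iff:
  assumes "a \<in> cauchy_sequences A N" "b \<in> cauchy_sequences A N"
  shows "completion_class a = completion_class b \<longleftrightarrow> (\<lambda>n. N (a n \<ominus> b n)) \<longlonglongrightarrow> 0"
  using assms by (simp add: eq_equiv_class_iff[OF equiv_null_relation] null_relation_iff)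

lemma completion_class_in_carrier:
  "a \<in> cauchy_sequences A N \<Longrightarrow> completion_class a \<in> carrier (completion A N)"
  by (simp add: completion_def Let_def quotientI)

lemma completion_carrierE:
  assumes "Y \<in> carrier (completion A N)"
  obtains a where "a \<in> cauchy_sequences A N" "\<forall>n. a n \<in> carrier A" "Y = completion_class a"
  using assms by (auto simp: completion_def Let_def cauchy_sequences_def elim: quotientE)

lemma completion_mult:
  assumes "a \<in> cauchy_sequences A N" "b \<in> cauchy_sequences A N"
  shows "completion_class a \<otimes>\<^bsub>completion A N\<^esub> completion_class b = completion_class (\<lambda>n. a n \<otimes> b n)"
proof -
  have "congruent2 (null_relation A N) (null_relation A N) (\<lambda>a b. completion_class (\<lambda>n. a n \<otimes> b n))"
  proof (rule congruent2I', rule completion_class_eqI)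
    fix a a' b b' assume aa: "(a, a') \<in> null_relation A N" and bb: "(b, b') \<in> null_relation A N"
    note cs = null_relation_cauchy[OF aa] null_relation_cauchy[OF bb]
    note [simp] = cs[THEN cauchy_sequences_carrier]
    obtain B where B: "0 \<le> B" "\<And>n. N (b n) \<le> B"
      using cauchy_sequences_bounded[OF cs(3)] by blast
    obtain B' where B': "0 \<le> B'" "\<And>n. N (a' n) \<le> B'"
      using cauchy_sequences_bounded[OF cs(2)] by blast
    have "N (a n \<otimes> b n \<ominus> a' n \<otimes> b' n) \<le> B * N (a n \<ominus> a' n) + B' * N (b n \<ominus> b' n)" for n
      using N_mult_minus_mult[of "a n" "b n" "a' n" "b' n"]
        mult_right_mono[OF B(2)[of n] N_nonneg[of "a n \<ominus> a' n"]]
        mult_right_mono[OF B'(2)[of n] N_nonneg[of "b n \<ominus> b' n"]]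
      by simp
    then show "(\<lambda>n. a n \<otimes> b n, \<lambda>n. a' n \<otimes> b' n) \<in> null_relation A N"
      by (intro null_relationI[OF _ _ aa bb] cauchy_sequences_mult cs)
  qed
  from UN_equiv_class2[OF equiv_null_relation equiv_null_relation this assms] show ?thesis
    by (simp add: completion_def Let_def)
qed

lemma completion_add:
  assumes "a \<in> cauchy_sequences A N" "b \<in> cauchy_sequences A N"
  shows "completion_class a \<oplus>\<^bsub>completion A N\<^esub> completion_class b = completion_class (\<lambda>n. a n \<oplus> b n)"
proof -
  have "congruent2 (null_relation A N) (null_relation A N) (\<lambda>a b. completion_class (\<lambda>n. a n \<oplus> b n))"
  proof (rule congruent2I', rule completion_class_eqI)
    fix a a' b b' assume aa: "(a, a') \<in> null_relation A N" and bb: "(b, b') \<in> null_relation A N"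
    note cs = null_relation_cauchy[OF aa] null_relation_cauchy[OF bb]
    show "(\<lambda>n. a n \<oplus> b n, \<lambda>n. a' n \<oplus> b' n) \<in> null_relation A N"
      by (rule null_relationI[OF _ _ aa bb, of _ _ 1 1])
        (simp_all add: cauchy_sequences_add cs N_add_minus_add cs[THEN cauchy_sequences_carrier])
  qed
  from UN_equiv_class2[OF equiv_null_relation equiv_null_relation this assms] show ?thesis
    by (simp add: completion_def Let_def)
qed

lemma completion_star:
  assumes "a \<in> cauchy_sequences A N"
  shows "star (completion A N) (completion_class a) = completion_class (\<lambda>n. star A (a n))"
proof -
  have "congruent (null_relation A N) (\<lambda>a. completion_class (\<lambda>n. star A (a n)))"
  proof (rule congruentI, rule completion_class_eqI)
    fix a b assume ab: "(a, b) \<in> null_relation A N"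
    note cs = null_relation_cauchy[OF ab]
    show "(\<lambda>n. star A (a n), \<lambda>n. star A (b n)) \<in> null_relation A N"
      by (rule null_relationI[OF _ _ ab ab, of _ _ 1 0])
        (simp_all add: cauchy_sequences_star cs N_star_minus_star cs[THEN cauchy_sequences_carrier])
  qed
  from UN_equiv_class[OF equiv_null_relation this assms] show ?thesis
    by (simp add: completion_def Let_def)
qed

lemma completion_one: "\<one>\<^bsub>completion A N\<^esub> = completion_class (\<lambda>n. \<one>)"
  and completion_zero: "\<zero>\<^bsub>completion A N\<^esub> = completion_class (\<lambda>n. \<zero>)"
  by (simp_all add: completion_def Let_def)

lemma cauchy_sequences_smult_eq_mult:
  "a \<in> cauchy_sequences A N \<Longrightarrow> (\<lambda>n. c \<odot> a n) = (\<lambda>n. (c \<odot> \<one>) \<otimes> a n)"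
  by (intro ext smult_eq_mult cauchy_sequences_carrier)

lemma cauchy_sequences_smult:
  assumes a: "a \<in> cauchy_sequences A N"
  shows "(\<lambda>n. c \<odot> a n) \<in> cauchy_sequences A N"
  unfolding cauchy_sequences_smult_eq_mult[OF a]
  by (rule cauchy_sequences_mult[OF cauchy_sequences_const[OF smult_one_closed] a])

lemma completion_smult:
  assumes "a \<in> cauchy_sequences A N"
  shows "c \<odot>\<^bsub>completion A N\<^esub> completion_class a = completion_class (\<lambda>n. c \<odot> a n)"
proof -
  have "congruent (null_relation A N) (\<lambda>a. completion_class (\<lambda>n. c \<odot> a n))"
  proof (rule congruentI)
    fix a b assume ab: "(a, b) \<in> null_relation A N"
    note cs = null_relation_cauchy[OF ab]
    have "completion_class (\<lambda>n. c \<odot> a n) = completion_class (\<lambda>n. c \<odot> \<one>) \<otimes>\<^bsub>completion A N\<^esub> completion_class a"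
      if "a \<in> cauchy_sequences A N" for a
      unfolding cauchy_sequences_smult_eq_mult[OF that]
      by (rule completion_mult[OF cauchy_sequences_const[OF smult_one_closed] that, symmetric])
    from this[OF cs(1)] this[OF cs(2)]
    show "completion_class (\<lambda>n. c \<odot> a n) = completion_class (\<lambda>n. c \<odot> b n)"
      by (simp only: completion_class_eqI[OF ab])
  qed
  from UN_equiv_class[OF equiv_null_relation this assms] show ?thesis
    by (simp add: completion_def Let_def)
qed

text \<open>By the reverse triangle inequality, N has the same limit along all representatives of a
  class, so the definite description in \<open>nrm\<close> is satisfied; norm estimates for the
  completion then follow by passing to limits.\<close>

lemma completion_nrm:
  assumes a: "a \<in> cauchy_sequences A N"
  shows "(\<lambda>n. N (a n)) \<longlonglongrightarrow> nrm (completion A N) (completion_class a)"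
proof -
  obtain l where l: "(\<lambda>n. N (a n)) \<longlonglongrightarrow> l"
    using cauchy_sequences_convergent_N[OF a] by (auto simp: convergent_def)
  have lb: "(\<lambda>n. N (b n)) \<longlonglongrightarrow> l" if ab: "(a, b) \<in> null_relation A N" for b
  proof -
    have b: "b \<in> cauchy_sequences A N"
      by (rule null_relation_cauchy[OF ab])
    have "(\<lambda>n. N (b n) - N (a n)) \<longlonglongrightarrow> 0"
    proof (rule tendsto_0_le[where K = 1])
      show "(\<lambda>n. N (a n \<ominus> b n)) \<longlonglongrightarrow> 0"
        using ab by (simp add: null_relation_def)
      have "norm (N (b n) - N (a n)) \<le> norm (N (a n \<ominus> b n)) * 1" for n
        using N_reverse_triangle[of "a n" "b n"] by (simp add: cauchy_sequences_carrier[OF a] cauchy_sequences_carrier[OF b])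
      then show "\<forall>\<^sub>F n in sequentially. norm (N (b n) - N (a n)) \<le> norm (N (a n \<ominus> b n)) * 1"
        by (intro always_eventually allI)
    qed
    from tendsto_add[OF this l] show ?thesis
      by simp
  qed
  have "nrm (completion A N) (completion_class a) = l"
    unfolding completion_def Let_def normed_star_algebra.simps
  proof (rule the_equality)
    show "\<forall>b\<in>completion_class a. (\<lambda>n. N (b n)) \<longlonglongrightarrow> l"
      using lb by blast
    fix l' assume "\<forall>b\<in>completion_class a. (\<lambda>n. N (b n)) \<longlonglongrightarrow> l'"
    moreover have "(a, a) \<in> null_relation A N"
      using equiv_class_self[OF equiv_null_relation a] by simp
    ultimately show "l' = l"
      using LIMSEQ_unique[OF _ l] by simp
  qed
  with l show ?thesis
    by simp
qed

lemma completion_nrm_leI: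
  assumes "a \<in> cauchy_sequences A N" "(\<lambda>n. b n) \<longlonglongrightarrow> l" "\<And>n. N (a n) \<le> b n"
  shows "nrm (completion A N) (completion_class a) \<le> l"
  using LIMSEQ_le[OF completion_nrm[OF assms(1)] assms(2)] assms(3) by blast

lemma completion_ring: "ring (completion A N)"
proof (rule ringI)
  note cs = cauchy_sequences_add cauchy_sequences_mult cauchy_sequences_const cauchy_sequences_uminus
  note ops = completion_add completion_mult completion_one completion_zero
  show "abelian_group (completion A N)"
  proof (rule abelian_groupI)
    fix x assume "x \<in> carrier (completion A N)"
    then obtain a where a: "a \<in> cauchy_sequences A N" "\<forall>n. a n \<in> carrier A" "x = completion_class a"
      by (rule completion_carrierE)
    show "\<exists>y\<in>carrier (completion A N). y \<oplus>\<^bsub>completion A N\<^esub> x = \<zero>\<^bsub>completion A N\<^esub>"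
      using a by (intro bexI[of _ "completion_class (\<lambda>n. \<ominus> a n)"])
        (simp_all add: ops cs l_neg completion_class_in_carrier)
  qed (auto elim!: completion_carrierE
      simp: ops cs completion_class_in_carrier a_ac)
  show "monoid (completion A N)"
    by (rule monoidI)
      (auto elim!: completion_carrierE
        simp: ops cs completion_class_in_carrier m_assoc)
qed (auto elim!: completion_carrierE
    simp: completion_add completion_mult cauchy_sequences_add cauchy_sequences_mult
      l_distr r_distr)

lemma completion_uminus:
  assumes a: "a \<in> cauchy_sequences A N"
  shows "\<ominus>\<^bsub>completion A N\<^esub> completion_class a = completion_class (\<lambda>n. \<ominus> a n)"
proof -
  interpret C: ring "completion A N"
    by (rule completion_ring)
  show ?thesis
    by (rule C.minus_equality)
      (simp_all add: a completion_add completion_zero cauchy_sequences_uminus l_neg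
        cauchy_sequences_carrier[OF a] completion_class_in_carrier)
qed

text \<open>The completion with its norm is again an instance of the locale, so ideals and quotients
  of \<open>semigroup_cstar\<close> are treated by the same lemmas.\<close>

lemma seminormed_star_algebra_completion:
  "seminormed_star_algebra (completion A N) (nrm (completion A N))"
proof -
  let ?C = "completion A N"
  note cs = cauchy_sequences_add cauchy_sequences_mult cauchy_sequences_const cauchy_sequences_uminus
    cauchy_sequences_star cauchy_sequences_smult
  note ops = completion_add completion_mult completion_star completion_one completion_smult
    completion_uminus completion_zero
  interpret C: ring ?C
    by (rule completion_ring)
  have nrm_eqI: "nrm ?C (completion_class a) = nrm ?C (completion_class b)"
    if "a \<in> cauchy_sequences A N" "b \<in> cauchy_sequences A N" "\<And>n. N (a n) = N (b n)" for a b
    using completion_nrm[OF that(1)] completion_nrm[OF that(2)] that(3) LIMSEQ_unique by simp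
  show ?thesis
  proof unfold_locales
    fix a c assume "a \<in> carrier ?C"
    then obtain a' where a: "a' \<in> cauchy_sequences A N" "\<forall>n. a' n \<in> carrier A" "a = completion_class a'"
      by (rule completion_carrierE)
    then show "c \<odot>\<^bsub>?C\<^esub> a = (c \<odot>\<^bsub>?C\<^esub> \<one>\<^bsub>?C\<^esub>) \<otimes>\<^bsub>?C\<^esub> a"
      by (simp only: cauchy_sequences_smult_eq_mult[OF a(1)] ops cs one_closed smult_one_closed)
  next
    fix a assume "a \<in> carrier ?C"
    then obtain a' where a: "a' \<in> cauchy_sequences A N" "\<forall>n. a' n \<in> carrier A" "a = completion_class a'"
      by (rule completion_carrierE)
    show "0 \<le> nrm ?C a"
      using a LIMSEQ_le_const[OF completion_nrm[OF a(1)], of 0]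
      by (auto simp: N_nonneg)
    show "nrm ?C (\<ominus>\<^bsub>?C\<^esub> a) = nrm ?C a"
      using a by (simp add: ops cs) (rule nrm_eqI; simp add: cs N_uminus)
    show "nrm ?C (star ?C a) = nrm ?C a"
      using a by (simp add: ops cs) (rule nrm_eqI; simp add: cs N_star)
  next
    show "nrm ?C \<zero>\<^bsub>?C\<^esub> = 0"
      using completion_nrm[OF cauchy_sequences_const[OF zero_closed]]
      by (simp add: completion_zero N_zero LIMSEQ_const_iff)
  next
    fix a b assume "a \<in> carrier ?C" "b \<in> carrier ?C"
    then obtain a' b' where a: "a' \<in> cauchy_sequences A N" "\<forall>n. a' n \<in> carrier A" "a = completion_class a'"
      and b: "b' \<in> cauchy_sequences A N" "\<forall>n. b' n \<in> carrier A" "b = completion_class b'"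
      by (auto elim!: completion_carrierE)
    show "nrm ?C (a \<oplus>\<^bsub>?C\<^esub> b) \<le> nrm ?C a + nrm ?C b"
      unfolding a(3) b(3) completion_add[OF a(1) b(1)]
      by (rule completion_nrm_leI[OF _ tendsto_add[OF completion_nrm[OF a(1)] completion_nrm[OF b(1)]]])
        (simp_all add: cs a b N_add)
    show "nrm ?C (a \<otimes>\<^bsub>?C\<^esub> b) \<le> nrm ?C a * nrm ?C b"
      unfolding a(3) b(3) completion_mult[OF a(1) b(1)]
      by (rule completion_nrm_leI[OF _ tendsto_mult[OF completion_nrm[OF a(1)] completion_nrm[OF b(1)]]])
        (simp_all add: cs a b N_mult)
  qed (auto elim!: completion_carrierE
      simp: ops cs completion_class_in_carrier star_add star_mult star_star)
qed

lemma completion_map_hom: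
  shows "completion_map A N \<in> ring_hom A (completion A N)"
    and "a \<in> carrier A \<Longrightarrow> completion_map A N (star A a) = star (completion A N) (completion_map A N a)"
  by (auto intro!: ring_hom_memI simp: completion_map_def completion_mult completion_add completion_one
      completion_star cauchy_sequences_const completion_class_in_carrier)

lemma completion_map_eq_iff:
  assumes "a \<in> carrier A" "b \<in> carrier A"
  shows "completion_map A N a = completion_map A N b \<longleftrightarrow> N (a \<ominus> b) = 0"
  using assms by (simp add: completion_map_def completion_class_eq_iff cauchy_sequences_const LIMSEQ_const_iff)

end


section \<open>Closed ideals, quotients and representations\<close>

lemma star_homD:
  assumes "\<phi> \<in> star_hom A B"
  shows "a \<in> carrier A \<Longrightarrow> \<phi> a \<in> carrier B"
    and "\<lbrakk>a \<in> carrier A; b \<in> carrier A\<rbrakk> \<Longrightarrow> \<phi> (a \<oplus>\<^bsub>A\<^esub> b) = \<phi> a \<oplus>\<^bsub>B\<^esub> \<phi> b"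
    and "\<lbrakk>a \<in> carrier A; b \<in> carrier A\<rbrakk> \<Longrightarrow> \<phi> (a \<otimes>\<^bsub>A\<^esub> b) = \<phi> a \<otimes>\<^bsub>B\<^esub> \<phi> b"
    and "\<phi> \<one>\<^bsub>A\<^esub> = \<one>\<^bsub>B\<^esub>"
    and "a \<in> carrier A \<Longrightarrow> \<phi> (c \<odot>\<^bsub>A\<^esub> a) = c \<odot>\<^bsub>B\<^esub> \<phi> a"
    and "a \<in> carrier A \<Longrightarrow> \<phi> (star A a) = star B (\<phi> a)"
  using assms unfolding star_hom_def ring_hom_def by auto

lemma star_homI:
  assumes "\<And>a. a \<in> carrier A \<Longrightarrow> \<phi> a \<in> carrier B"
    and "\<And>a b. \<lbrakk>a \<in> carrier A; b \<in> carrier A\<rbrakk> \<Longrightarrow> \<phi> (a \<oplus>\<^bsub>A\<^esub> b) = \<phi> a \<oplus>\<^bsub>B\<^esub> \<phi> b"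
    and "\<And>a b. \<lbrakk>a \<in> carrier A; b \<in> carrier A\<rbrakk> \<Longrightarrow> \<phi> (a \<otimes>\<^bsub>A\<^esub> b) = \<phi> a \<otimes>\<^bsub>B\<^esub> \<phi> b"
    and "\<phi> \<one>\<^bsub>A\<^esub> = \<one>\<^bsub>B\<^esub>"
    and "\<And>c a. a \<in> carrier A \<Longrightarrow> \<phi> (c \<odot>\<^bsub>A\<^esub> a) = c \<odot>\<^bsub>B\<^esub> \<phi> a"
    and "\<And>a. a \<in> carrier A \<Longrightarrow> \<phi> (star A a) = star B (\<phi> a)"
  shows "\<phi> \<in> star_hom A B"
  unfolding star_hom_def by (auto intro: ring_hom_memI assms)

lemma closed_idealI:
  assumes "ideal I A"
    and "\<And>a x. \<lbrakk>x \<in> carrier A; \<And>n::nat. a n \<in> I; (\<lambda>n. nrm A (a n \<ominus>\<^bsub>A\<^esub> x)) \<longlonglongrightarrow> 0\<rbrakk> \<Longrightarrow> x \<in> I"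
  shows "closed_ideal A I"
  using assms unfolding closed_ideal_def by blast

lemma closed_ideal_carrier:
  assumes "ring A"
  shows "closed_ideal A (carrier A)"
  using ring.oneideal[OF assms] by (simp add: closed_ideal_def)

lemma closed_ideal_generated_by_least:
  "closed_ideal A I \<Longrightarrow> K \<subseteq> I \<Longrightarrow> closed_ideal_generated_by A K \<subseteq> I"
  by (auto simp: closed_ideal_generated_by_def)

lemma ideal_closed_ideal_generated_by:
  assumes "ring A" "K \<subseteq> carrier A"
  shows "ideal (closed_ideal_generated_by A K) A"
  unfolding closed_ideal_generated_by_def
proof (rule ring.i_Intersect[OF assms(1)])
  show "{I. closed_ideal A I \<and> K \<subseteq> I} \<noteq> {}"
    using closed_ideal_carrier[OF assms(1)] assms(2) by blast
qed (simp add: closed_ideal_def)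

text \<open>The star is additive, isometric and reverses products, hence exchanges left and right
  absorption while preserving closedness. Applied to every closed ideal containing a given set of
  generators, this yields the star-invariance of the generated ideal.\<close>

lemma closed_ideal_star_preimage:
  assumes A: "seminormed_star_algebra A (nrm A)" and I: "closed_ideal A I"
  shows "closed_ideal A {x \<in> carrier A. star A x \<in> I}"
proof -
  interpret seminormed_star_algebra A "nrm A"
    by (rule A)
  interpret I: ideal I A
    using I by (simp add: closed_ideal_def)
  have "ideal {x \<in> carrier A. star A x \<in> I} A"
  proof (rule idealI)
    show "ring A"
      by (rule ring_axioms)
    show "subgroup {x \<in> carrier A. star A x \<in> I} (add_monoid A)"
      by (rule add.subgroupI)
        (auto simp: star_add star_uminus star_zero intro: I.a_closed I.a_inv_closed I.zero_closed)
  qed (auto simp: star_mult I.I_l_closed I.I_r_closed)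
  moreover have "x \<in> {x \<in> carrier A. star A x \<in> I}"
    if x: "x \<in> carrier A" and a: "\<And>n::nat. a n \<in> {x \<in> carrier A. star A x \<in> I}"
      and lim: "(\<lambda>n. nrm A (a n \<ominus>\<^bsub>A\<^esub> x)) \<longlonglongrightarrow> 0" for a x
  proof -
    have "nrm A (star A (a n) \<ominus>\<^bsub>A\<^esub> star A x) = nrm A (a n \<ominus>\<^bsub>A\<^esub> x)" for n
      using a[of n] x by (simp add: N_star_minus_star)
    then have "(\<lambda>n. nrm A (star A (a n) \<ominus>\<^bsub>A\<^esub> star A x)) \<longlonglongrightarrow> 0"
      using lim by simp
    moreover have "\<forall>n. star A (a n) \<in> I"
      using a by simp
    moreover have "star A x \<in> carrier A"
      using x by simp
    ultimately show ?thesis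
      using I[unfolded closed_ideal_def, THEN conjunct2, rule_format, of "star A x" "\<lambda>n. star A (a n)"] x
      by simp
  qed
  ultimately show ?thesis
    by (rule closed_idealI)
qed

text \<open>
  Every closed ideal of a C*-algebra is self-adjoint, but that needs approximate units; for a
  closed ideal generated by a self-adjoint set minimality suffices.
\<close>

lemma closed_ideal_generated_by_star:
  assumes A: "seminormed_star_algebra A (nrm A)"
    and K: "K \<subseteq> carrier A" "\<And>x. x \<in> K \<Longrightarrow> star A x \<in> K"
    and x: "x \<in> closed_ideal_generated_by A K"
  shows "star A x \<in> closed_ideal_generated_by A K"
  unfolding closed_ideal_generated_by_def
proof (clarify)
  fix I assume I: "closed_ideal A I" "K \<subseteq> I"
  have "K \<subseteq> {x \<in> carrier A. star A x \<in> I}"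
    using K I(2) by blast
  from closed_ideal_generated_by_least[OF closed_ideal_star_preimage[OF A I(1)] this] x
  show "star A x \<in> I"
    by blast
qed

text \<open>\<open>cstar_quotient\<close> defines the star of a coset as a union over its members;
  this is a single coset because the ideal is stable under the star.\<close>

locale star_ideal = seminormed_star_algebra A "nrm A" + ideal I A
  for A :: "('a, 'm) normed_star_algebra_scheme" (structure) and I +
  assumes star_in_ideal: "x \<in> I \<Longrightarrow> star A x \<in> I"
begin

lemma coset_memE:
  assumes "y \<in> I +> x"
  obtains h where "h \<in> I" "y = h \<oplus> x"
  using assms by (auto simp: a_r_coset_def')

lemma coset_add_eq: "\<lbrakk>h \<in> I; x \<in> carrier A\<rbrakk> \<Longrightarrow> I +> (h \<oplus> x) = I +> x"
  by (metis a_coset_add_assoc a_rcos_const a_subset Icarr)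

lemma coset_self: "x \<in> carrier A \<Longrightarrow> x \<in> I +> x"
  by (rule a_rcos_self)

lemma cstar_quotient_carrier: "x \<in> carrier A \<Longrightarrow> I +> x \<in> carrier (cstar_quotient A I)"
  by (auto simp: cstar_quotient_def FactRing_def A_RCOSETS_def')

lemma cstar_quotient_carrierE:
  assumes "Y \<in> carrier (cstar_quotient A I)"
  obtains x where "x \<in> carrier A" "Y = I +> x"
  using assms by (auto simp: cstar_quotient_def FactRing_def A_RCOSETS_def')

lemma cstar_quotient_mult:
  "\<lbrakk>x \<in> carrier A; y \<in> carrier A\<rbrakk> \<Longrightarrow> (I +> x) \<otimes>\<^bsub>cstar_quotient A I\<^esub> (I +> y) = I +> (x \<otimes> y)"
  by (simp add: cstar_quotient_def FactRing_def rcoset_mult_add)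

lemma cstar_quotient_add:
  "\<lbrakk>x \<in> carrier A; y \<in> carrier A\<rbrakk> \<Longrightarrow> (I +> x) \<oplus>\<^bsub>cstar_quotient A I\<^esub> (I +> y) = I +> (x \<oplus> y)"
  by (simp add: cstar_quotient_def FactRing_def a_rcos_sum)

lemma cstar_quotient_one: "\<one>\<^bsub>cstar_quotient A I\<^esub> = I +> \<one>"
  by (simp add: cstar_quotient_def FactRing_def)

lemma cstar_quotient_star:
  assumes x: "x \<in> carrier A"
  shows "star (cstar_quotient A I) (I +> x) = I +> star A x"
proof -
  have eq: "I +> star A y = I +> star A x" if "y \<in> I +> x" for y
    using that by (rule coset_memE) (simp add: x star_add star_in_ideal coset_add_eq Icarr)
  have "(\<Union>y\<in>I +> x. I +> star A y) = I +> star A x"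
    by (rule SUP_eq_const[OF _ eq]) (use coset_self[OF x] in blast)
  then show ?thesis
    by (simp add: cstar_quotient_def)
qed

lemma cstar_quotient_smult:
  assumes x: "x \<in> carrier A"
  shows "c \<odot>\<^bsub>cstar_quotient A I\<^esub> (I +> x) = I +> (c \<odot> x)"
proof -
  have eq: "I +> (c \<odot> y) = I +> (c \<odot> x)" if "y \<in> I +> x" for y
    using that
  proof (rule coset_memE)
    fix h assume h: "h \<in> I" "y = h \<oplus> x"
    have "c \<odot> y = (c \<odot> \<one>) \<otimes> h \<oplus> c \<odot> x"
      using h x by (simp add: smult_eq_mult[of "h \<oplus> x"] smult_eq_mult[of x] Icarr r_distr)
    then show "I +> (c \<odot> y) = I +> (c \<odot> x)"
      using h x by (simp add: coset_add_eq I_l_closed smult_closed)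
  qed
  have "(\<Union>y\<in>I +> x. I +> (c \<odot> y)) = I +> (c \<odot> x)"
    by (rule SUP_eq_const[OF _ eq]) (use coset_self[OF x] in blast)
  then show ?thesis
    by (simp add: cstar_quotient_def)
qed

text \<open>Every member of a coset has the form h + x with h in the ideal, and \<phi> kills h, so
  the chosen representative is immaterial; the law assumed for B removes the summand zero that is
  left.\<close>

lemma star_hom_quotient_lift:
  assumes \<phi>: "\<phi> \<in> star_hom A B" and zero: "\<And>x. x \<in> I \<Longrightarrow> \<phi> x = \<zero>\<^bsub>B\<^esub>"
    and B: "\<And>b. b \<in> carrier B \<Longrightarrow> \<zero>\<^bsub>B\<^esub> \<oplus>\<^bsub>B\<^esub> b = b"
  obtains \<Lambda> where "\<Lambda> \<in> star_hom (cstar_quotient A I) B" "\<And>x. x \<in> carrier A \<Longrightarrow> \<Lambda> (I +> x) = \<phi> x"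
proof -
  define \<Lambda> where "\<Lambda> Y = \<phi> (SOME y. y \<in> Y)" for Y
  have \<Lambda>: "\<Lambda> (I +> x) = \<phi> x" if x: "x \<in> carrier A" for x
  proof -
    have "(SOME y. y \<in> I +> x) \<in> I +> x"
      using coset_self[OF x] by (rule someI)
    then obtain h where "h \<in> I" "(SOME y. y \<in> I +> x) = h \<oplus> x"
      by (rule coset_memE)
    then show ?thesis
      using x by (simp add: \<Lambda>_def star_homD[OF \<phi>] Icarr zero B)
  qed
  have "\<Lambda> \<in> star_hom (cstar_quotient A I) B"
  proof (rule star_homI)
    show "\<Lambda> \<one>\<^bsub>cstar_quotient A I\<^esub> = \<one>\<^bsub>B\<^esub>"
      by (simp add: cstar_quotient_one \<Lambda> star_homD[OF \<phi>])
  qed (auto elim!: cstar_quotient_carrierE simp: cstar_quotient_mult cstar_quotient_add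
      cstar_quotient_star cstar_quotient_smult smult_closed \<Lambda> star_homD[OF \<phi>])
  with \<Lambda> that show ?thesis
    by blast
qed

end

lemma bounded_operators_simps [simp]:
  "carrier (bounded_operators X) = ell2_operators X"
  "\<one>\<^bsub>bounded_operators X\<^esub> = (\<lambda>f\<in>ell2 X. f)"
  "\<zero>\<^bsub>bounded_operators X\<^esub> = (\<lambda>f\<in>ell2 X. \<lambda>x. 0)"
  "T \<otimes>\<^bsub>bounded_operators X\<^esub> T' = compose (ell2 X) T T'"
  "T \<oplus>\<^bsub>bounded_operators X\<^esub> T' = (\<lambda>f\<in>ell2 X. \<lambda>x. T f x + T' f x)"
  "c \<odot>\<^bsub>bounded_operators X\<^esub> T = (\<lambda>f\<in>ell2 X. \<lambda>x. c * T f x)"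
  "star (bounded_operators X) = adjoint X"
  by (simp_all add: bounded_operators_def)

lemma representationsD:
  assumes \<phi>: "\<phi> \<in> star_hom A (bounded_operators X)" and f: "f \<in> ell2 X"
  shows "\<lbrakk>a \<in> carrier A; b \<in> carrier A\<rbrakk> \<Longrightarrow> \<phi> (a \<oplus>\<^bsub>A\<^esub> b) f = (\<lambda>x. \<phi> a f x + \<phi> b f x)"
    and "\<lbrakk>a \<in> carrier A; b \<in> carrier A\<rbrakk> \<Longrightarrow> \<phi> (a \<otimes>\<^bsub>A\<^esub> b) f = \<phi> a (\<phi> b f)"
    and "\<phi> \<one>\<^bsub>A\<^esub> f = f"
    and "a \<in> carrier A \<Longrightarrow> \<phi> (c \<odot>\<^bsub>A\<^esub> a) f = (\<lambda>x. c * \<phi> a f x)"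
  using f by (simp_all add: star_homD[OF \<phi>] compose_def)

text \<open>The operators are compared pointwise instead of as elements of a ring: the value at a
  difference is found by cancelling functions in (a - b) + b = a.\<close>

lemma representations_minus:
  assumes "ring A" and \<phi>: "\<phi> \<in> star_hom A (bounded_operators X)" and f: "f \<in> ell2 X"
    and "a \<in> carrier A" "b \<in> carrier A"
  shows "\<phi> (a \<ominus>\<^bsub>A\<^esub> b) f = (\<lambda>x. \<phi> a f x - \<phi> b f x)"
proof -
  interpret ring A by fact
  have "\<phi> (a \<ominus>\<^bsub>A\<^esub> b \<oplus>\<^bsub>A\<^esub> b) f = (\<lambda>x. \<phi> (a \<ominus>\<^bsub>A\<^esub> b) f x + \<phi> b f x)"
    using assms by (intro representationsD) auto
  moreover have "a \<ominus>\<^bsub>A\<^esub> b \<oplus>\<^bsub>A\<^esub> b = a"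
    using assms by algebra
  ultimately show ?thesis
    by (simp add: fun_eq_iff)
qed

lemma representations_zero:
  assumes "ring A" and \<phi>: "\<phi> \<in> star_hom A (bounded_operators X)" and f: "f \<in> ell2 X"
  shows "\<phi> \<zero>\<^bsub>A\<^esub> f = (\<lambda>x. 0)"
  using representationsD(1)[OF \<phi> f, of "\<zero>\<^bsub>A\<^esub>" "\<zero>\<^bsub>A\<^esub>"] ring.ring_simprules(2)[OF assms(1)]
    ring.ring_simprules(8)[OF assms(1)]
  by (simp add: fun_eq_iff)

lemma representation_eq_zero_iff:
  assumes "\<phi> \<in> star_hom A (bounded_operators X)" "a \<in> carrier A"
  shows "\<phi> a = \<zero>\<^bsub>bounded_operators X\<^esub> \<longleftrightarrow> (\<forall>f\<in>ell2 X. \<phi> a f = (\<lambda>x. 0))"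
  using star_homD(1)[OF assms] adjoint_pair_zero[of X]
  by (auto simp: adjoint_pair_def intro: ell2_operator_eqI)

text \<open>The norm estimate makes every coordinate of \<open>\<phi> x f\<close> continuous in x,
  whence the kernel is closed. The estimate is an explicit hypothesis because the extension from the
  free algebra delivers it along with the representation.\<close>

lemma closed_ideal_representation_kernel:
  assumes A: "ring A" and \<phi>: "\<phi> \<in> star_hom A (bounded_operators X)"
    and bound: "\<And>a f. \<lbrakk>a \<in> carrier A; f \<in> ell2 X\<rbrakk> \<Longrightarrow> ell2_norm X (\<phi> a f) \<le> nrm A a * ell2_norm X f"
  shows "closed_ideal A {a \<in> carrier A. \<phi> a = \<zero>\<^bsub>bounded_operators X\<^esub>}" (is "closed_ideal A ?K")
proof -
  interpret ring A by (rule A)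
  have K: "?K = {a \<in> carrier A. \<forall>f\<in>ell2 X. \<phi> a f = (\<lambda>x. 0)}"
    using representation_eq_zero_iff[OF \<phi>] by blast
  have mem: "\<phi> a f \<in> ell2 X" if "a \<in> carrier A" "f \<in> ell2 X" for a f
    using star_homD(1)[OF \<phi> that(1)] that(2) by (simp add: ell2_operatorsD)
  have op: "\<phi> a (\<lambda>x. 0) = (\<lambda>x. 0)" if "a \<in> carrier A" for a
    using star_homD(1)[OF \<phi> that] ell2_operatorsD(3)[of "\<phi> a" X "\<lambda>x. 0" 0] by (simp add: ell2_zero)
  have minus: "\<phi> (\<ominus>\<^bsub>A\<^esub> a) f = (\<lambda>x. - \<phi> a f x)" if "a \<in> carrier A" "f \<in> ell2 X" for a f
    using representations_minus[OF A \<phi> that(2) zero_closed that(1)] that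
    by (simp add: a_minus_def representations_zero[OF A \<phi>])
  have "ideal ?K A"
    unfolding K
  proof (rule idealI[OF A])
    show "subgroup {a \<in> carrier A. \<forall>f\<in>ell2 X. \<phi> a f = (\<lambda>x. 0)} (add_monoid A)"
      by (rule add.subgroupI)
        (auto simp: representationsD[OF \<phi>] minus representations_zero[OF A \<phi>])
  qed (auto simp: representationsD[OF \<phi>] mem op)
  moreover have "x \<in> ?K"
    if x: "x \<in> carrier A" and a: "\<And>n::nat. a n \<in> ?K"
      and lim: "(\<lambda>n. nrm A (a n \<ominus>\<^bsub>A\<^esub> x)) \<longlonglongrightarrow> 0" for a x
  proof -
    have "\<phi> x f y = 0" if f: "f \<in> ell2 X" for f y
    proof -
      have "cmod (\<phi> x f y) \<le> nrm A (a n \<ominus>\<^bsub>A\<^esub> x) * ell2_norm X f" for n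
      proof -
        have an: "a n \<in> carrier A" "\<phi> (a n) f = (\<lambda>x. 0)"
          using a[of n] f unfolding K by auto
        have "\<phi> (a n \<ominus>\<^bsub>A\<^esub> x) f = (\<lambda>y. - \<phi> x f y)"
          by (simp add: representations_minus[OF A \<phi> f an(1) x] an(2))
        then have "cmod (\<phi> x f y) = cmod (\<phi> (a n \<ominus>\<^bsub>A\<^esub> x) f y)"
          by simp
        also have "\<dots> \<le> ell2_norm X (\<phi> (a n \<ominus>\<^bsub>A\<^esub> x) f)"
          using an x f by (intro cmod_le_ell2_norm mem) auto
        also have "\<dots> \<le> nrm A (a n \<ominus>\<^bsub>A\<^esub> x) * ell2_norm X f"
          using an x f by (intro bound) auto
        finally show ?thesis .
      qed
      moreover have "(\<lambda>n. nrm A (a n \<ominus>\<^bsub>A\<^esub> x) * ell2_norm X f) \<longlonglongrightarrow> 0"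
        using tendsto_mult_right[OF lim, of "ell2_norm X f"] by simp
      ultimately have "cmod (\<phi> x f y) \<le> 0"
        by (intro LIMSEQ_le_const) auto
      then show ?thesis
        by simp
    qed
    then show ?thesis
      using x unfolding K by auto
  qed
  ultimately show ?thesis
    by (rule closed_idealI)
qed

context seminormed_star_algebra
begin

text \<open>
  Since \<^const>\<open>adjoint\<close> is a definite description, adjoints are carried along explicitly. This also
  makes it unnecessary to know that every bounded operator has one.
\<close>

lemma representation_completion_extension:
  assumes \<phi>: "\<phi> \<in> star_hom A (bounded_operators X)"
    and adj: "\<And>a. a \<in> carrier A \<Longrightarrow> adjoint_pair X (\<phi> a) (\<phi> (star A a))"
    and bound: "\<And>a f. \<lbrakk>a \<in> carrier A; f \<in> ell2 X\<rbrakk> \<Longrightarrow> ell2_norm X (\<phi> a f) \<le> N a * ell2_norm X f"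
  obtains \<Phi> where "\<Phi> \<in> representations (completion A N) X"
    and "\<And>a. a \<in> carrier A \<Longrightarrow> \<Phi> (completion_map A N a) = \<phi> a"
    and "\<And>Y f. \<lbrakk>Y \<in> carrier (completion A N); f \<in> ell2 X\<rbrakk>
      \<Longrightarrow> ell2_norm X (\<Phi> Y f) \<le> nrm (completion A N) Y * ell2_norm X f"
proof -
  let ?C = "completion A N"
  \<comment> \<open>A coordinatewise limit gives one explicit operator per sequence, before anything
    is known about convergence; completeness afterwards identifies it with the norm limit of the
    vectors \<open>\<phi> (a n) f\<close>.\<close>
  define L where "L a = (\<lambda>f\<in>ell2 X. \<lambda>x. lim (\<lambda>n. \<phi> (a n) f x))" for a :: "nat \<Rightarrow> 'a"
  have op: "\<phi> a \<in> ell2_operators X" if "a \<in> carrier A" for a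
    using star_homD(1)[OF \<phi> that] by simp
  have mem: "\<phi> a f \<in> ell2 X" if "a \<in> carrier A" "f \<in> ell2 X" for a f
    using ell2_operatorsD(1)[OF op[OF that(1)] that(2)] .
  have bound_diff: "ell2_norm X (\<lambda>x. \<phi> a f x - \<phi> b f x) \<le> N (a \<ominus> b) * ell2_norm X f"
    if "a \<in> carrier A" "b \<in> carrier A" "f \<in> ell2 X" for a b f
    using bound[of "a \<ominus> b" f] that by (simp add: representations_minus[OF ring_axioms \<phi> that(3,1,2)])
  have L: "L a f \<in> ell2 X" "(\<lambda>n. \<phi> (a n) f x) \<longlonglongrightarrow> L a f x"
    "(\<lambda>n. ell2_norm X (\<lambda>x. \<phi> (a n) f x - L a f x)) \<longlonglongrightarrow> 0"
    if a: "a \<in> cauchy_sequences A N" and f: "f \<in> ell2 X" for a f x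
  proof -
    note [simp] = cauchy_sequences_carrier[OF a]
    have cauchy: "\<exists>M. \<forall>m\<ge>M. \<forall>n\<ge>M. ell2_norm X (\<lambda>x. \<phi> (a m) f x - \<phi> (a n) f x) < e" if e: "0 < e" for e
    proof -
      have pos: "0 < ell2_norm X f + 1"
        using ell2_norm_nonneg[of X f] by linarith
      then obtain M where M: "\<forall>m\<ge>M. \<forall>n\<ge>M. N (a m \<ominus> a n) < e / (ell2_norm X f + 1)"
        using cauchy_sequencesD(2)[OF a divide_pos_pos[OF e]] by blast
      have "ell2_norm X (\<lambda>x. \<phi> (a m) f x - \<phi> (a n) f x) < e" if "m \<ge> M" "n \<ge> M" for m n
      proof -
        have "ell2_norm X (\<lambda>x. \<phi> (a m) f x - \<phi> (a n) f x) \<le> N (a m \<ominus> a n) * ell2_norm X f"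
          by (intro bound_diff f) simp_all
        also have "\<dots> \<le> N (a m \<ominus> a n) * (ell2_norm X f + 1)"
          by (intro mult_left_mono N_nonneg) simp_all
        also have "\<dots> < e"
          using M[rule_format, OF that] pos by (simp add: pos_less_divide_eq)
        finally show ?thesis .
      qed
      then show ?thesis
        by blast
    qed
    obtain g where g: "g \<in> ell2 X" "\<forall>x. (\<lambda>n. \<phi> (a n) f x) \<longlonglongrightarrow> g x"
      "(\<lambda>n. ell2_norm X (\<lambda>x. \<phi> (a n) f x - g x)) \<longlonglongrightarrow> 0"
      using ell2_complete[of "\<lambda>n. \<phi> (a n) f" X, OF mem[OF cauchy_sequences_carrier[OF a] f] cauchy]
      by blast
    have "L a f = g"
      using f g(2) by (simp add: L_def fun_eq_iff limI)
    with g show "L a f \<in> ell2 X" "(\<lambda>n. \<phi> (a n) f x) \<longlonglongrightarrow> L a f x"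
      "(\<lambda>n. ell2_norm X (\<lambda>x. \<phi> (a n) f x - L a f x)) \<longlonglongrightarrow> 0"
      by simp_all
  qed
  have L_eqI: "L a f = g" if "a \<in> cauchy_sequences A N" "f \<in> ell2 X" "\<And>x. (\<lambda>n. \<phi> (a n) f x) \<longlonglongrightarrow> g x"
    for a f g
    using LIMSEQ_unique[OF L(2)[OF that(1,2)] that(3)] by blast
  have L_undefined: "L a f = undefined" if "f \<notin> ell2 X" for a f
    using that by (simp add: L_def)
  have L_bound: "ell2_norm X (L a f) \<le> nrm ?C (completion_class a) * ell2_norm X f"
    if a: "a \<in> cauchy_sequences A N" and f: "f \<in> ell2 X" for a f
  proof (rule LIMSEQ_le_const)
    show "(\<lambda>n. ell2_norm X (\<lambda>x. \<phi> (a n) f x - L a f x) + N (a n) * ell2_norm X f)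
      \<longlonglongrightarrow> nrm ?C (completion_class a) * ell2_norm X f"
      using tendsto_add[OF L(3)[OF a f] tendsto_mult_right[OF completion_nrm[OF a]]] by simp
    have "ell2_norm X (L a f) \<le> ell2_norm X (\<lambda>x. \<phi> (a n) f x - L a f x) + N (a n) * ell2_norm X f" for n
    proof -
      have an: "a n \<in> carrier A"
        by (rule cauchy_sequences_carrier[OF a])
      have "ell2_norm X (L a f) \<le> ell2_norm X (\<lambda>x. L a f x - \<phi> (a n) f x) + ell2_norm X (\<phi> (a n) f)"
        using ell2_norm_triangle[OF ell2_diff[OF L(1)[OF a f] mem[OF an f]] mem[OF an f]] by simp
      then show ?thesis
        using bound[OF an f] by (simp add: ell2_norm_minus_commute[of X "L a f"])
    qed
    then show "\<exists>M. \<forall>n\<ge>M. ell2_norm X (L a f)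
      \<le> ell2_norm X (\<lambda>x. \<phi> (a n) f x - L a f x) + N (a n) * ell2_norm X f"
      by blast
  qed
  have L_op: "L a \<in> ell2_operators X" if a: "a \<in> cauchy_sequences A N" for a
  proof (rule ell2_operatorsI)
    fix f assume f: "f \<in> ell2 X"
    show "L a (\<lambda>x. c * f x) = (\<lambda>x. c * L a f x)" for c
      using tendsto_mult_left[OF L(2)[OF a f]]
      by (intro L_eqI[OF a ell2_scale[OF f]])
        (simp add: ell2_operatorsD(3)[OF op[OF cauchy_sequences_carrier[OF a]] f])
    fix g assume g: "g \<in> ell2 X"
    show "L a (\<lambda>x. f x + g x) = (\<lambda>x. L a f x + L a g x)"
      using tendsto_add[OF L(2)[OF a f] L(2)[OF a g]]
      by (intro L_eqI[OF a ell2_add[OF f g]])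
        (simp add: ell2_operatorsD(2)[OF op[OF cauchy_sequences_carrier[OF a]] f g])
  qed (use L(1)[OF a] L_bound[OF a] L_undefined in auto)
  have L_eq: "L a = L b" if ab: "(a, b) \<in> null_relation A N" for a b
  proof (rule ell2_operator_eqI)
    note cs = null_relation_cauchy[OF ab]
    fix f assume f: "f \<in> ell2 X"
    have diff: "(\<lambda>n. \<phi> (a n) f x - \<phi> (b n) f x) \<longlonglongrightarrow> 0" for x
    proof (rule tendsto_0_le)
      show "(\<lambda>n. N (a n \<ominus> b n)) \<longlonglongrightarrow> 0"
        using ab by (simp add: null_relation_def)
      have "cmod (\<phi> (a n) f x - \<phi> (b n) f x) \<le> norm (N (a n \<ominus> b n)) * ell2_norm X f" for n
      proof -
        note [simp] = cs[THEN cauchy_sequences_carrier]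
        have "cmod (\<phi> (a n) f x - \<phi> (b n) f x) \<le> ell2_norm X (\<lambda>x. \<phi> (a n) f x - \<phi> (b n) f x)"
          by (rule cmod_le_ell2_norm[of "\<lambda>x. \<phi> (a n) f x - \<phi> (b n) f x"]) (simp add: ell2_diff mem f)
        also have "\<dots> \<le> N (a n \<ominus> b n) * ell2_norm X f"
          by (intro bound_diff f) simp_all
        also have "\<dots> = norm (N (a n \<ominus> b n)) * ell2_norm X f"
          by (simp add: N_nonneg)
        finally show ?thesis .
      qed
      then show "\<forall>\<^sub>F n in sequentially. norm (\<phi> (a n) f x - \<phi> (b n) f x) \<le> norm (N (a n \<ominus> b n)) * ell2_norm X f"
        by (simp add: always_eventually)
    qed
    have "(\<lambda>n. \<phi> (a n) f x) \<longlonglongrightarrow> L b f x" for x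
      using tendsto_add[OF diff[of x] L(2)[OF cs(2) f, of x]] by simp
    then show "L a f = L b f"
      by (rule L_eqI[OF cs(1) f])
  qed (use null_relation_cauchy[OF ab] L_op in auto)
  define \<Phi> where "\<Phi> Y = L (SOME a. a \<in> Y)" for Y
  have \<Phi>: "\<Phi> (completion_class a) = L a" if a: "a \<in> cauchy_sequences A N" for a
  proof -
    have "a \<in> completion_class a"
      by (rule equiv_class_self[OF equiv_null_relation a])
    then have "(SOME b. b \<in> completion_class a) \<in> completion_class a"
      by (rule someI[where P = "\<lambda>b. b \<in> completion_class a"])
    then have "(a, SOME b. b \<in> completion_class a) \<in> null_relation A N"
      by simp
    then show ?thesis
      unfolding \<Phi>_def by (rule L_eq[symmetric])
  qed
  have L_const: "L (\<lambda>n. a) = \<phi> a" if "a \<in> carrier A" for a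
    by (rule ell2_operator_eqI[OF L_op[OF cauchy_sequences_const[OF that]] op[OF that]])
      (rule L_eqI[OF cauchy_sequences_const[OF that] _ tendsto_const])
  have L_add: "L (\<lambda>n. a n \<oplus> b n) = (\<lambda>f\<in>ell2 X. \<lambda>x. L a f x + L b f x)"
    if a: "a \<in> cauchy_sequences A N" and b: "b \<in> cauchy_sequences A N" for a b
  proof
    fix f
    show "L (\<lambda>n. a n \<oplus> b n) f = (\<lambda>f\<in>ell2 X. \<lambda>x. L a f x + L b f x) f"
    proof (cases "f \<in> ell2 X")
      case f: True
      have "(\<lambda>n. \<phi> (a n \<oplus> b n) f x) \<longlonglongrightarrow> L a f x + L b f x" for x
        using tendsto_add[OF L(2)[OF a f, of x] L(2)[OF b f, of x]]
        by (simp add: representationsD(1)[OF \<phi> f] cauchy_sequences_carrier[OF a] cauchy_sequences_carrier[OF b])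
      then have "L (\<lambda>n. a n \<oplus> b n) f = (\<lambda>x. L a f x + L b f x)"
        by (rule L_eqI[OF cauchy_sequences_add[OF a b] f])
      then show ?thesis
        using f by simp
    qed (simp add: L_undefined)
  qed
  have L_smult: "L (\<lambda>n. c \<odot> a n) = (\<lambda>f\<in>ell2 X. \<lambda>x. c * L a f x)"
    if a: "a \<in> cauchy_sequences A N" for a c
  proof
    fix f
    show "L (\<lambda>n. c \<odot> a n) f = (\<lambda>f\<in>ell2 X. \<lambda>x. c * L a f x) f"
    proof (cases "f \<in> ell2 X")
      case f: True
      have "(\<lambda>n. \<phi> (c \<odot> a n) f x) \<longlonglongrightarrow> c * L a f x" for x
        using tendsto_mult_left[OF L(2)[OF a f, of x]]
        by (simp add: representationsD(4)[OF \<phi> f] cauchy_sequences_carrier[OF a])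
      then have "L (\<lambda>n. c \<odot> a n) f = (\<lambda>x. c * L a f x)"
        by (rule L_eqI[OF cauchy_sequences_smult[OF a] f])
      then show ?thesis
        using f by simp
    qed (simp add: L_undefined)
  qed
  have L_mult: "L (\<lambda>n. a n \<otimes> b n) = compose (ell2 X) (L a) (L b)"
    if a: "a \<in> cauchy_sequences A N" and b: "b \<in> cauchy_sequences A N" for a b
  proof
    fix f
    note [simp] = cauchy_sequences_carrier[OF a] cauchy_sequences_carrier[OF b]
    show "L (\<lambda>n. a n \<otimes> b n) f = compose (ell2 X) (L a) (L b) f"
    proof (cases "f \<in> ell2 X")
      case f: True
      obtain B where B: "0 \<le> B" "\<And>n. N (a n) \<le> B"
        using cauchy_sequences_bounded[OF a] by blast
      \<comment> \<open>Both the operator and the vector vary with n. Replacing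
        \<open>\<phi> (b n) f\<close> by its limit \<open>L b f\<close> costs at most N (a n) times
        a norm tending to zero, and N (a n) is bounded; what remains is the convergence at the fixed
        vector \<open>L b f\<close>.\<close>
      have diff: "(\<lambda>n. \<phi> (a n) (\<phi> (b n) f) x - \<phi> (a n) (L b f) x) \<longlonglongrightarrow> 0" for x
      proof (rule tendsto_0_le)
        show "(\<lambda>n. ell2_norm X (\<lambda>x. \<phi> (b n) f x - L b f x)) \<longlonglongrightarrow> 0"
          by (rule L(3)[OF b f])
        have "cmod (\<phi> (a n) (\<phi> (b n) f) x - \<phi> (a n) (L b f) x)
            \<le> norm (ell2_norm X (\<lambda>x. \<phi> (b n) f x - L b f x)) * B" for n
        proof -
          let ?g = "\<lambda>x. \<phi> (b n) f x - L b f x"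
          have g: "?g \<in> ell2 X"
            by (intro ell2_diff mem L(1) b f) simp
          have "cmod (\<phi> (a n) (\<phi> (b n) f) x - \<phi> (a n) (L b f) x) = cmod (\<phi> (a n) ?g x)"
            by (simp add: ell2_operators_diff[OF op] mem f L(1) b)
          also have "\<dots> \<le> N (a n) * ell2_norm X ?g"
            using cmod_le_ell2_norm[OF mem[OF _ g], of "a n" x] bound[OF _ g, of "a n"] by simp
          also have "\<dots> \<le> B * ell2_norm X ?g"
            by (intro mult_right_mono B) simp
          finally show ?thesis
            by (simp add: mult.commute)
        qed
        then show "\<forall>\<^sub>F n in sequentially. norm (\<phi> (a n) (\<phi> (b n) f) x - \<phi> (a n) (L b f) x)
            \<le> norm (ell2_norm X (\<lambda>x. \<phi> (b n) f x - L b f x)) * B"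
          by (intro always_eventually allI)
      qed
      have "(\<lambda>n. \<phi> (a n \<otimes> b n) f x) \<longlonglongrightarrow> L a (L b f) x" for x
        using tendsto_add[OF diff[of x] L(2)[OF a L(1)[OF b f], of x]]
        by (simp add: representationsD(2)[OF \<phi> f])
      then have "L (\<lambda>n. a n \<otimes> b n) f = L a (L b f)"
        by (rule L_eqI[OF cauchy_sequences_mult[OF a b] f])
      then show ?thesis
        using f by (simp add: compose_def)
    qed (simp add: L_undefined compose_def)
  qed
  have L_adj: "adjoint_pair X (L a) (L (\<lambda>n. star A (a n)))" if a: "a \<in> cauchy_sequences A N" for a
    unfolding adjoint_pair_def
  proof (intro conjI ballI)
    note a' = cauchy_sequences_star[OF a]
    note [simp] = cauchy_sequences_carrier[OF a]
    show "L a \<in> ell2_operators X" "L (\<lambda>n. star A (a n)) \<in> ell2_operators X"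
      by (rule L_op[OF a], rule L_op[OF a'])
    fix f g assume f: "f \<in> ell2 X" and g: "g \<in> ell2 X"
    have "(\<lambda>n. ell2_inner X g (\<phi> (a n) f)) \<longlonglongrightarrow> ell2_inner X g (L a f)"
      by (rule ell2_inner_tendsto[OF g _ L(1)[OF a f] L(3)[OF a f]]) (simp add: mem f)
    then have "(\<lambda>n. ell2_inner X (\<phi> (a n) f) g) \<longlonglongrightarrow> ell2_inner X (L a f) g"
      unfolding ell2_inner_commute[of X _ g] by (rule tendsto_cnj)
    moreover have "(\<lambda>n. ell2_inner X f (\<phi> (star A (a n)) g)) \<longlonglongrightarrow> ell2_inner X f (L (\<lambda>n. star A (a n)) g)"
      by (rule ell2_inner_tendsto[OF f _ L(1)[OF a' g] L(3)[OF a' g]]) (simp add: mem g)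
    moreover have "ell2_inner X (\<phi> (a n) f) g = ell2_inner X f (\<phi> (star A (a n)) g)" for n
      using adj[of "a n"] f g by (simp add: adjoint_pair_def)
    ultimately show "ell2_inner X (L a f) g = ell2_inner X f (L (\<lambda>n. star A (a n)) g)"
      by (simp add: LIMSEQ_unique)
  qed
  have "\<Phi> \<in> representations ?C X"
  proof (rule star_homI)
    show "\<Phi> \<one>\<^bsub>?C\<^esub> = \<one>\<^bsub>bounded_operators X\<^esub>"
      by (simp only: completion_one \<Phi> cauchy_sequences_const L_const one_closed star_homD(4)[OF \<phi>])
  next
    fix Y assume "Y \<in> carrier ?C"
    then obtain a where a: "a \<in> cauchy_sequences A N" "\<forall>n. a n \<in> carrier A" "Y = completion_class a"
      by (rule completion_carrierE)
    show "\<Phi> Y \<in> carrier (bounded_operators X)"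
      by (simp add: a \<Phi> L_op)
    show "\<Phi> (c \<odot>\<^bsub>?C\<^esub> Y) = c \<odot>\<^bsub>bounded_operators X\<^esub> \<Phi> Y" for c
      by (simp add: a \<Phi> completion_smult cauchy_sequences_smult L_smult)
    show "\<Phi> (star ?C Y) = star (bounded_operators X) (\<Phi> Y)"
      by (simp add: a \<Phi> completion_star cauchy_sequences_star adjoint_eqI[OF L_adj])
    fix Z assume "Z \<in> carrier ?C"
    then obtain b where b: "b \<in> cauchy_sequences A N" "\<forall>n. b n \<in> carrier A" "Z = completion_class b"
      by (rule completion_carrierE)
    show "\<Phi> (Y \<oplus>\<^bsub>?C\<^esub> Z) = \<Phi> Y \<oplus>\<^bsub>bounded_operators X\<^esub> \<Phi> Z"
      by (simp add: a b \<Phi> completion_add cauchy_sequences_add L_add)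
    show "\<Phi> (Y \<otimes>\<^bsub>?C\<^esub> Z) = \<Phi> Y \<otimes>\<^bsub>bounded_operators X\<^esub> \<Phi> Z"
      by (simp add: a b \<Phi> completion_mult cauchy_sequences_mult L_mult)
  qed
  moreover have "\<Phi> (completion_map A N a) = \<phi> a" if "a \<in> carrier A" for a
    using that by (simp add: completion_map_def \<Phi> cauchy_sequences_const L_const)
  moreover have "ell2_norm X (\<Phi> Y f) \<le> nrm ?C Y * ell2_norm X f"
    if "Y \<in> carrier ?C" "f \<in> ell2 X" for Y f
    using that by (elim completion_carrierE) (simp add: \<Phi> L_bound)
  ultimately show ?thesis
    using that by blast
qed

end


section \<open>The universal seminorm on the free star-algebra\<close>

lemma star_poly_eq_sum: "a = (\<Sum>w\<in>Poly_Mapping.keys a. Poly_Mapping.single w (Poly_Mapping.lookup a w))"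
  for a :: "'x star_poly"
  by (rule poly_mapping_eqI)
    (simp add: lookup_sum lookup_single when_def sum.delta' in_keys_iff)

lemma star_poly_induct [case_names zero single add]:
  fixes a :: "'x star_poly"
  assumes "P 0" "\<And>w c. P (Poly_Mapping.single w c)" "\<And>a b. P a \<Longrightarrow> P b \<Longrightarrow> P (a + b)"
  shows "P a"
proof -
  have "P (\<Sum>w\<in>W. Poly_Mapping.single w (Poly_Mapping.lookup a w))" if "finite W" for W
    using that by (induction W) (auto intro: assms)
  then show ?thesis
    by (subst star_poly_eq_sum) simp
qed

text \<open>Cancellation can make the support of a + b smaller than the union of the supports, so
  all three sums are extended to that union, where the extra terms vanish by F w 0 = 0. Both the
  star and the action of polynomials on vectors are of this form.\<close>

lemma star_poly_sum_add:
  fixes F :: "'x star_word \<Rightarrow> complex \<Rightarrow> 'b::comm_monoid_add"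
  assumes F: "\<And>w. F w 0 = 0" "\<And>w c d. F w (c + d) = F w c + F w d"
  shows "(\<Sum>w\<in>Poly_Mapping.keys (a + b). F w (Poly_Mapping.lookup (a + b) w))
    = (\<Sum>w\<in>Poly_Mapping.keys a. F w (Poly_Mapping.lookup a w))
      + (\<Sum>w\<in>Poly_Mapping.keys b. F w (Poly_Mapping.lookup b w))"
proof -
  let ?K = "Poly_Mapping.keys a \<union> Poly_Mapping.keys b"
  have *: "(\<Sum>w\<in>Poly_Mapping.keys c. F w (Poly_Mapping.lookup c w)) = (\<Sum>w\<in>?K. F w (Poly_Mapping.lookup c w))"
    if "Poly_Mapping.keys c \<subseteq> ?K" for c
    using that by (intro sum.mono_neutral_left) (auto simp: F in_keys_iff)
  show ?thesis
    unfolding *[OF keys_add] *[of a, OF Un_upper1] *[of b, OF Un_upper2]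
    by (simp add: lookup_add F sum.distrib)
qed

lemma poly_star_add: "poly_star (a + b) = poly_star a + poly_star b"
  unfolding poly_star_def by (rule star_poly_sum_add) (simp_all add: single_add)

lemma poly_star_zero [simp]: "poly_star 0 = 0"
  by (simp add: poly_star_def)

lemma poly_star_single: "poly_star (Poly_Mapping.single w c) = Poly_Mapping.single (word_star w) (cnj c)"
  by (cases "c = 0") (simp_all add: poly_star_def)

lemma letter_star_letter_star [simp]: "letter_star (letter_star l) = l"
  by (cases l) simp_all

lemma word_star_word_star [simp]: "word_star (word_star w) = w"
  by (cases w) (simp add: word_star_def rev_map comp_def)

lemma word_star_plus: "word_star (v + w) = word_star w + word_star v"
  by (simp add: word_star_def plus_star_word_def)

lemma word_star_zero [simp]: "word_star 0 = 0"
  by (simp add: word_star_def zero_star_word_def)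

lemma poly_star_poly_star [simp]: "poly_star (poly_star a) = a"
  by (induction a rule: star_poly_induct) (simp_all add: poly_star_single poly_star_add)

lemma poly_star_mult: "poly_star (a * b) = poly_star b * poly_star a"
proof (induction a rule: star_poly_induct)
  case (single w c)
  show ?case
    by (induction b rule: star_poly_induct)
      (simp_all add: poly_star_single poly_star_add mult_single word_star_plus mult.commute algebra_simps)
qed (simp_all add: poly_star_add algebra_simps)

lemma poly_star_one [simp]: "poly_star 1 = 1"
  by (simp add: poly_star_single flip: single_one)

lemma letter_gen_letter_star [simp]: "letter_gen (letter_star l) = letter_gen l"
  by (cases l) simp_all

section \<open>The free star-algebra on a set of generators\<close>

lemma free_star_algebra_simps [simp]:
  "mult (free_star_algebra X) = (*)"
  "one (free_star_algebra X) = 1"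
  "zero (free_star_algebra X) = 0"
  "add (free_star_algebra X) = (+)"
  "smult (free_star_algebra X) = (\<lambda>c a. Poly_Mapping.single 0 c * a)"
  "star (free_star_algebra X) = poly_star"
  by (simp_all add: free_star_algebra_def)

lemma free_star_algebra_carrier:
  "a \<in> carrier (free_star_algebra X) \<longleftrightarrow>
    (\<forall>w\<in>Poly_Mapping.keys a. letter_gen ` set (letters w) \<subseteq> X)"
  by (simp add: free_star_algebra_def)

lemma free_star_algebra_carrier_sum:
  assumes "\<And>i. i \<in> I \<Longrightarrow> a i \<in> carrier (free_star_algebra X)"
  shows "(\<Sum>i\<in>I. a i) \<in> carrier (free_star_algebra X)"
  using assms keys_sum[of a I] by (fastforce simp: free_star_algebra_carrier)

lemma free_star_algebra_closed [simp]:
  shows "0 \<in> carrier (free_star_algebra X)"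
    and "1 \<in> carrier (free_star_algebra X)"
    and "Poly_Mapping.single 0 c \<in> carrier (free_star_algebra X)"
    and "\<lbrakk>a \<in> carrier (free_star_algebra X); b \<in> carrier (free_star_algebra X)\<rbrakk>
      \<Longrightarrow> a + b \<in> carrier (free_star_algebra X)"
    and "\<lbrakk>a \<in> carrier (free_star_algebra X); b \<in> carrier (free_star_algebra X)\<rbrakk>
      \<Longrightarrow> a * b \<in> carrier (free_star_algebra X)"
    and "a \<in> carrier (free_star_algebra X) \<Longrightarrow> - a \<in> carrier (free_star_algebra X)"
    and "x \<in> X \<Longrightarrow> gen x \<in> carrier (free_star_algebra X)"
proof -
  show "a + b \<in> carrier (free_star_algebra X)"
    if "a \<in> carrier (free_star_algebra X)" "b \<in> carrier (free_star_algebra X)"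
    using that keys_add[of a b] by (fastforce simp: free_star_algebra_carrier)
  show "a * b \<in> carrier (free_star_algebra X)"
    if "a \<in> carrier (free_star_algebra X)" "b \<in> carrier (free_star_algebra X)"
    unfolding free_star_algebra_carrier
  proof
    fix w assume "w \<in> Poly_Mapping.keys (a * b)"
    then obtain u v where "u \<in> Poly_Mapping.keys a" "v \<in> Poly_Mapping.keys b" "w = u + v"
      using keys_mult[of a b] by blast
    then show "letter_gen ` set (letters w) \<subseteq> X"
      using that by (auto simp: free_star_algebra_carrier plus_star_word_def)
  qed
qed (auto simp: free_star_algebra_carrier zero_star_word_def gen_def in_keys_iff split: if_splits)

lemma free_star_algebra_minus_closed [simp]:
  "\<lbrakk>a \<in> carrier (free_star_algebra X); b \<in> carrier (free_star_algebra X)\<rbrakk>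
    \<Longrightarrow> a - b \<in> carrier (free_star_algebra X)"
  using free_star_algebra_closed(4)[OF _ free_star_algebra_closed(6)] by fastforce

lemma free_star_algebra_star_closed [simp]:
  assumes "a \<in> carrier (free_star_algebra X)"
  shows "poly_star a \<in> carrier (free_star_algebra X)"
  unfolding poly_star_def
  by (rule free_star_algebra_carrier_sum)
    (use assms in \<open>auto simp: free_star_algebra_carrier word_star_def image_image split: if_splits\<close>)

lemma free_star_algebra_ring: "ring (free_star_algebra X)"
proof (rule ringI)
  show "abelian_group (free_star_algebra X)"
    by (rule abelian_groupI) (auto simp: algebra_simps intro!: bexI[of _ "- _"])
  show "monoid (free_star_algebra X)"
    by (rule monoidI) (auto simp: algebra_simps)
qed (auto simp: algebra_simps)

lemma free_star_algebra_uminus [simp]: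
  assumes "a \<in> carrier (free_star_algebra X)"
  shows "\<ominus>\<^bsub>free_star_algebra X\<^esub> a = - a"
proof -
  interpret ring "free_star_algebra X"
    by (rule free_star_algebra_ring)
  show ?thesis
    using assms by (intro minus_equality) simp_all
qed

lemma free_star_algebra_minus [simp]:
  "\<lbrakk>a \<in> carrier (free_star_algebra X); b \<in> carrier (free_star_algebra X)\<rbrakk>
    \<Longrightarrow> a \<ominus>\<^bsub>free_star_algebra X\<^esub> b = a - b"
  by (simp add: a_minus_def)

section \<open>Estimates common to all C*-seminorms\<close>

lemma cstar_seminormD:
  assumes "cstar_seminorm (free_star_algebra X) N"
  shows "a \<in> carrier (free_star_algebra X) \<Longrightarrow> 0 \<le> N a"
    and "\<lbrakk>a \<in> carrier (free_star_algebra X); b \<in> carrier (free_star_algebra X)\<rbrakk> \<Longrightarrow> N (a + b) \<le> N a + N b"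
    and "a \<in> carrier (free_star_algebra X) \<Longrightarrow> N (Poly_Mapping.single 0 c * a) = cmod c * N a"
    and "\<lbrakk>a \<in> carrier (free_star_algebra X); b \<in> carrier (free_star_algebra X)\<rbrakk> \<Longrightarrow> N (a * b) \<le> N a * N b"
    and "a \<in> carrier (free_star_algebra X) \<Longrightarrow> N (poly_star a * a) = (N a)\<^sup>2"
  using assms by (simp_all add: cstar_seminorm_def)

lemma cstar_seminorm_zero:
  assumes "cstar_seminorm (free_star_algebra X) N"
  shows "N 0 = 0"
  using cstar_seminormD(3)[OF assms, of 0 0] by simp

lemma cstar_seminorm_uminus:
  assumes "cstar_seminorm (free_star_algebra X) N" "a \<in> carrier (free_star_algebra X)"
  shows "N (- a) = N a"
  using cstar_seminormD(3)[OF assms, of "-1"] by (simp add: single_uminus)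

text \<open>The C*-identity and submultiplicativity give (N b)^2 <= N (poly_star b) * N b, hence N b
  <= N (poly_star b); taking b to be a and then its star gives equality.\<close>

lemma cstar_seminorm_star:
  assumes N: "cstar_seminorm (free_star_algebra X) N" and a: "a \<in> carrier (free_star_algebra X)"
  shows "N (poly_star a) = N a"
proof -
  have le: "N b \<le> N (poly_star b)" if b: "b \<in> carrier (free_star_algebra X)" for b
  proof -
    have "N b * N b \<le> N (poly_star b) * N b"
      using cstar_seminormD(5)[OF N b] cstar_seminormD(4)[OF N _ b, of "poly_star b"] b
      by (simp add: power2_eq_square)
    then show ?thesis
      using cstar_seminormD(1)[OF N] b by (cases "N b = 0") (auto simp: order_less_le)
  qed
  from le[OF a] le[of "poly_star a"] a show ?thesis
    by simp
qed

text \<open>The C*-identity makes N 1 an idempotent real number, so it is 0 or 1; the value 0 occurs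
  for the null seminorm.\<close>

lemma cstar_seminorm_one_le:
  assumes N: "cstar_seminorm (free_star_algebra X) N"
  shows "N 1 \<le> 1"
proof -
  have "N 1 = N 1 * N 1"
    using cstar_seminormD(5)[OF N, of 1] by (simp add: power2_eq_square)
  then show ?thesis
    by (cases "N 1 = 0") auto
qed

lemma cstar_seminorm_monomial_le:
  assumes N: "cstar_seminorm (free_star_algebra X) N"
    and gens: "\<And>x. x \<in> X \<Longrightarrow> N (gen x) \<le> 1"
    and ls: "letter_gen ` set ls \<subseteq> X"
  shows "N (Poly_Mapping.single (Star_Word ls) 1) \<le> 1"
  using ls
proof (induction ls)
  case Nil
  then show ?case
    using cstar_seminorm_one_le[OF N] by (simp flip: zero_star_word_def)
next
  case (Cons l ls)
  let ?l = "Poly_Mapping.single (Star_Word [l]) 1 :: 'a star_poly"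
  let ?ls = "Poly_Mapping.single (Star_Word ls) 1 :: 'a star_poly"
  have mem: "?l \<in> carrier (free_star_algebra X)" "?ls \<in> carrier (free_star_algebra X)"
    using Cons.prems by (auto simp: free_star_algebra_carrier)
  have x: "letter_gen l \<in> X"
    using Cons.prems by simp
  have "?l = gen (letter_gen l) \<or> ?l = poly_star (gen (letter_gen l))"
    by (cases l) (simp_all add: gen_def poly_star_single word_star_def)
  then have "N ?l \<le> 1"
    using gens[OF x] cstar_seminorm_star[OF N, of "gen (letter_gen l)"] x by auto
  moreover have "N ?ls \<le> 1"
    using Cons by simp
  moreover have "Poly_Mapping.single (Star_Word (l # ls)) 1 = ?l * ?ls"
    by (simp add: mult_single plus_star_word_def)
  ultimately show ?case
    using cstar_seminormD(4)[OF N mem] mult_mono[of "N ?l" 1 "N ?ls" 1] cstar_seminormD(1)[OF N mem(2)]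
    by simp
qed

text \<open>If all generators have seminorm at most 1, so do all words, and the sum of the absolute
  values of the coefficients dominates N a. This bound is independent of N and makes the universal
  supremum finite.\<close>

lemma cstar_seminorm_le_sum:
  assumes N: "cstar_seminorm (free_star_algebra X) N"
    and gens: "\<And>x. x \<in> X \<Longrightarrow> N (gen x) \<le> 1"
    and a: "a \<in> carrier (free_star_algebra X)"
  shows "N a \<le> (\<Sum>w\<in>Poly_Mapping.keys a. cmod (Poly_Mapping.lookup a w))"
proof -
  let ?m = "\<lambda>w. Poly_Mapping.single w (Poly_Mapping.lookup a w)"
  have mem: "Poly_Mapping.single w c \<in> carrier (free_star_algebra X)"
    if "w \<in> Poly_Mapping.keys a" for w and c :: complex
    using a that by (auto simp: free_star_algebra_carrier)
  have le: "N (?m w) \<le> cmod (Poly_Mapping.lookup a w)" if w: "w \<in> Poly_Mapping.keys a" for w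
  proof -
    have "?m w = Poly_Mapping.single 0 (Poly_Mapping.lookup a w) * Poly_Mapping.single w 1"
      by (simp add: mult_single)
    moreover have "N (Poly_Mapping.single w 1) \<le> 1"
      using cstar_seminorm_monomial_le[OF N gens, of "letters w"] a w
      by (simp add: free_star_algebra_carrier)
    ultimately show ?thesis
      using cstar_seminormD(3)[OF N mem[OF w]] by (simp add: mult_left_le)
  qed
  have "N (\<Sum>w\<in>W. ?m w) \<le> (\<Sum>w\<in>W. cmod (Poly_Mapping.lookup a w))"
    if "finite W" "W \<subseteq> Poly_Mapping.keys a" for W
    using that
  proof (induction W)
    case empty
    show ?case
      by (simp add: cstar_seminorm_zero[OF N])
  next
    case (insert w W)
    then have "N (?m w + (\<Sum>w\<in>W. ?m w)) \<le> N (?m w) + N (\<Sum>w\<in>W. ?m w)"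
      by (intro cstar_seminormD(2)[OF N] mem free_star_algebra_carrier_sum) auto
    with insert le[of w] show ?case
      by simp
  qed
  then show ?thesis
    by (subst star_poly_eq_sum) simp
qed

text \<open>Witness that the supremum defining \<open>universal_seminorm\<close> runs over a
  nonempty set; it also shows that the supremum is nonnegative.\<close>

lemma cstar_seminorm_null: "cstar_seminorm A (\<lambda>a. 0)"
  by (simp add: cstar_seminorm_def)

context
  fixes X :: "'x set" and R :: "'x star_poly set" and A and N
  assumes gens: "\<And>M x. \<lbrakk>cstar_seminorm (free_star_algebra X) M; \<forall>r\<in>R. M r = 0; x \<in> X\<rbrakk> \<Longrightarrow> M (gen x) \<le> 1"
  defines "A \<equiv> free_star_algebra X"
    and "N \<equiv> universal_seminorm A R"
begin

lemma universal_seminorm_upper: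
  assumes M: "cstar_seminorm A M" "\<forall>r\<in>R. M r = 0" and a: "a \<in> carrier A"
  shows "M a \<le> N a"
  unfolding N_def universal_seminorm_def
proof (rule cSUP_upper)
  show "bdd_above ((\<lambda>M. M a) ` {M. cstar_seminorm A M \<and> (\<forall>r\<in>R. M r = 0)})"
    using gens a unfolding A_def
    by (intro bdd_aboveI2[where M = "\<Sum>w\<in>Poly_Mapping.keys a. cmod (Poly_Mapping.lookup a w)"]
        cstar_seminorm_le_sum) auto
qed (use M in simp)

lemma universal_seminorm_least:
  assumes "\<And>M. \<lbrakk>cstar_seminorm A M; \<forall>r\<in>R. M r = 0\<rbrakk> \<Longrightarrow> M a \<le> C"
  shows "N a \<le> C"
  unfolding N_def universal_seminorm_def
  by (rule cSUP_least) (use assms cstar_seminorm_null in auto)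

lemma universal_seminorm_nonneg: "a \<in> carrier A \<Longrightarrow> 0 \<le> N a"
  using universal_seminorm_upper[OF cstar_seminorm_null] by simp

lemma universal_seminorm_relator:
  assumes "r \<in> R"
  shows "N r = 0"
proof -
  have "(\<lambda>M. M r) ` {M. cstar_seminorm A M \<and> (\<forall>r\<in>R. M r = 0)} = {0}"
    using assms cstar_seminorm_null by fastforce
  then show ?thesis
    unfolding N_def universal_seminorm_def by simp
qed

text \<open>Suprema preserve inequalities; for negation and star, which are involutive, applying the
  inequality to a and to its image gives equality.\<close>

lemma seminormed_star_algebra_universal_seminorm: "seminormed_star_algebra A N"
proof -
  interpret ring A
    unfolding A_def by (rule free_star_algebra_ring)
  show ?thesis
  proof unfold_locales
    fix a assume a: "a \<in> carrier A"
    show "0 \<le> N a"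
      by (rule universal_seminorm_nonneg[OF a])
    have "N (- b) \<le> N b" if b: "b \<in> carrier A" for b
      using b universal_seminorm_upper[OF _ _ b]
      by (intro universal_seminorm_least) (simp add: A_def cstar_seminorm_uminus)
    from this[OF a] this[of "- a"] a show "N (\<ominus>\<^bsub>A\<^esub> a) = N a"
      by (simp add: A_def)
    have "N (poly_star b) \<le> N b" if b: "b \<in> carrier A" for b
      using b universal_seminorm_upper[OF _ _ b]
      by (intro universal_seminorm_least) (simp add: A_def cstar_seminorm_star)
    from this[OF a] this[of "poly_star a"] a show "N (star A a) = N a"
      by (simp add: A_def)
    fix b assume b: "b \<in> carrier A"
    show "N (a \<oplus>\<^bsub>A\<^esub> b) \<le> N a + N b"
    proof (rule universal_seminorm_least)
      fix M assume M: "cstar_seminorm A M" "\<forall>r\<in>R. M r = 0"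
      have "M (a \<oplus>\<^bsub>A\<^esub> b) \<le> M a + M b"
        using M a b by (simp add: A_def cstar_seminormD)
      also have "\<dots> \<le> N a + N b"
        by (intro add_mono universal_seminorm_upper M a b)
      finally show "M (a \<oplus>\<^bsub>A\<^esub> b) \<le> N a + N b" .
    qed
    show "N (a \<otimes>\<^bsub>A\<^esub> b) \<le> N a * N b"
    proof (rule universal_seminorm_least)
      fix M assume M: "cstar_seminorm A M" "\<forall>r\<in>R. M r = 0"
      have "M (a \<otimes>\<^bsub>A\<^esub> b) \<le> M a * M b"
        using M a b by (simp add: A_def cstar_seminormD)
      also have "\<dots> \<le> N a * N b"
        using M b by (intro mult_mono universal_seminorm_upper universal_seminorm_nonneg M a b)
          (simp add: A_def cstar_seminormD)
      finally show "M (a \<otimes>\<^bsub>A\<^esub> b) \<le> N a * N b" .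
    qed
  next
    show "N \<zero>\<^bsub>A\<^esub> = 0"
      by (rule antisym) (auto intro!: universal_seminorm_least universal_seminorm_nonneg
          simp: A_def cstar_seminorm_zero)
  qed (simp_all add: A_def poly_star_add poly_star_mult)
qed

end


section \<open>Representations by partial bijections\<close>

primrec letter_relation :: "('x \<Rightarrow> 'h rel) \<Rightarrow> 'x letter \<Rightarrow> 'h rel"
  where
    "letter_relation \<rho> (Gen x) = \<rho> x"
  | "letter_relation \<rho> (Gen_star x) = (\<rho> x)\<inverse>"

text \<open>
  A word acts as the composition of its letters applied from the right, while \<open>O\<close> composes
  relations from left to right: hence the reversed order.
\<close>

definition word_relation :: "'h set \<Rightarrow> ('x \<Rightarrow> 'h rel) \<Rightarrow> 'x star_word \<Rightarrow> 'h rel"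
  where "word_relation H \<rho> w = foldr (\<lambda>l R. R O letter_relation \<rho> l) (letters w) (Id_on H)"

definition relation_representation ::
    "'h set \<Rightarrow> ('x \<Rightarrow> 'h rel) \<Rightarrow> 'x star_poly \<Rightarrow> ('h \<Rightarrow> complex) \<Rightarrow> ('h \<Rightarrow> complex)"
  where "relation_representation H \<rho> a = (\<lambda>f\<in>ell2 H. \<lambda>y.
    \<Sum>w\<in>Poly_Mapping.keys a. Poly_Mapping.lookup a w * relation_operator H (word_relation H \<rho> w) f y)"

text \<open>Every element of the type of generators acts, not only those of a chosen set; the action
  is then defined on all polynomials and its identities hold without membership conditions.\<close>

locale partial_bijections =
  fixes H :: "'h set" and \<rho> :: "'x \<Rightarrow> 'h rel"
  assumes partial_bijection: "partial_bijection H (\<rho> x)"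
begin

abbreviation rep :: "'x star_poly \<Rightarrow> ('h \<Rightarrow> complex) \<Rightarrow> ('h \<Rightarrow> complex)"
  where "rep \<equiv> relation_representation H \<rho>"

lemma letter_relation: "partial_bijection H (letter_relation \<rho> l)"
  by (cases l) (simp_all add: partial_bijection partial_bijection_converse)

lemma foldr_letter_relation:
  assumes "R \<subseteq> H \<times> H"
  shows "foldr (\<lambda>l R. R O letter_relation \<rho> l) ls R
    = R O foldr (\<lambda>l R. R O letter_relation \<rho> l) ls (Id_on H)"
  using assms by (induction ls) auto

lemma foldr_letter_relation_partial_bijection:
  "partial_bijection H (foldr (\<lambda>l R. R O letter_relation \<rho> l) ls (Id_on H))"
  by (induction ls) (simp_all add: partial_bijection_Id_on partial_bijection_relcomp letter_relation)

lemma word_relation: "partial_bijection H (word_relation H \<rho> w)"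
  unfolding word_relation_def by (rule foldr_letter_relation_partial_bijection)

lemma word_relation_plus: "word_relation H \<rho> (v + w) = word_relation H \<rho> w O word_relation H \<rho> v"
  using foldr_letter_relation_partial_bijection[of "letters w"]
  by (simp add: word_relation_def plus_star_word_def partial_bijection_def
      foldr_letter_relation[of "foldr _ _ _"])

lemma word_relation_zero: "word_relation H \<rho> 0 = Id_on H"
  by (simp add: word_relation_def zero_star_word_def)

lemma word_relation_letter: "word_relation H \<rho> (Star_Word [l]) = letter_relation \<rho> l"
  using letter_relation[of l] by (auto simp: word_relation_def partial_bijection_def)

lemma letter_relation_star: "letter_relation \<rho> (letter_star l) = (letter_relation \<rho> l)\<inverse>"
  by (cases l) simp_all

lemma word_relation_star: "word_relation H \<rho> (word_star w) = (word_relation H \<rho> w)\<inverse>"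
proof (cases w)
  case (Star_Word ls)
  have "word_relation H \<rho> (word_star (Star_Word ls)) = (word_relation H \<rho> (Star_Word ls))\<inverse>"
  proof (induction ls)
    case Nil
    show ?case
      by (simp add: word_relation_zero flip: zero_star_word_def)
  next
    case (Cons l ls)
    have "Star_Word (l # ls) = Star_Word [l] + Star_Word ls"
      by (simp add: plus_star_word_def)
    then show ?case
      using Cons.IH by (simp add: word_star_plus word_relation_plus converse_relcomp)
        (simp add: word_star_def word_relation_letter letter_relation_star)
  qed
  then show ?thesis
    by (simp add: Star_Word)
qed

context
  fixes f
  assumes f: "f \<in> ell2 H"
begin

lemma rep_add: "rep (a + b) f = (\<lambda>y. rep a f y + rep b f y)"
  using star_poly_sum_add[of "\<lambda>w c. c * relation_operator H (word_relation H \<rho> w) f _" a b] f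
  by (simp add: relation_representation_def algebra_simps)

lemma rep_single:
  "rep (Poly_Mapping.single w c) f = (\<lambda>y. c * relation_operator H (word_relation H \<rho> w) f y)"
  using f by (cases "c = 0") (simp_all add: relation_representation_def)

lemma rep_zero: "rep 0 f = (\<lambda>y. 0)"
  using f by (simp add: relation_representation_def)

lemma rep_one: "rep 1 f = f"
  using f rep_single[of 0 1]
  by (auto simp: word_relation_zero relation_operator_Id_on ell2_outside fun_eq_iff)

lemma rep_gen: "rep (gen x) f = relation_operator H (\<rho> x) f"
  by (simp add: gen_def rep_single word_relation_letter)

lemma rep_gen_star: "rep (poly_star (gen x)) f = relation_operator H ((\<rho> x)\<inverse>) f"
  by (simp add: gen_def poly_star_single rep_single word_relation_star word_relation_letter)

lemma rep_minus: "rep (a - b) f = (\<lambda>y. rep a f y - rep b f y)"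
  using rep_add[of "a - b" b] by (simp add: fun_eq_iff)

end

lemma rep_undefined: "f \<notin> ell2 H \<Longrightarrow> rep a f = undefined"
  by (simp add: relation_representation_def)

lemma rep_eqI: "(\<And>f. f \<in> ell2 H \<Longrightarrow> rep a f = T f) \<Longrightarrow> (\<And>f. f \<notin> ell2 H \<Longrightarrow> T f = undefined) \<Longrightarrow> rep a = T"
  by (metis rep_undefined ext)

text \<open>A word acts by a partial bijection and its star by the converse relation; linear
  combinations with conjugated coefficients keep the pairing. Boundedness of the action is obtained
  here as well, as part of \<open>adjoint_pair\<close>.\<close>

lemma rep_adjoint: "adjoint_pair H (rep a) (rep (poly_star a))"
proof (induction a rule: star_poly_induct)
  case zero
  have "rep 0 = (\<lambda>f\<in>ell2 H. \<lambda>x. 0)"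
    by (rule rep_eqI) (simp_all add: rep_zero)
  then show ?case
    by (simp only: poly_star_zero adjoint_pair_zero)
next
  case (single w c)
  have "rep (Poly_Mapping.single w c) = (\<lambda>f\<in>ell2 H. \<lambda>x. c * relation_operator H (word_relation H \<rho> w) f x)"
    for w c by (rule rep_eqI) (simp_all add: rep_single)
  then show ?case
    by (simp only: poly_star_single word_relation_star)
      (intro adjoint_pair_scale relation_operator_adjoint word_relation)
next
  case (add a b)
  have "rep (a + b) = (\<lambda>f\<in>ell2 H. \<lambda>x. rep a f x + rep b f x)" for a b
    by (rule rep_eqI) (simp_all add: rep_add)
  with adjoint_pair_add[OF add] show ?case
    by (simp only: poly_star_add)
qed

lemma rep_operator: "rep a \<in> ell2_operators H"
  using rep_adjoint by (simp add: adjoint_pair_def)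

lemma rep_ell2: "f \<in> ell2 H \<Longrightarrow> rep a f \<in> ell2 H"
  by (rule ell2_operatorsD(1)[OF rep_operator])

lemma rep_mult:
  assumes f: "f \<in> ell2 H"
  shows "rep (a * b) f = rep a (rep b f)"
proof (induction a rule: star_poly_induct)
  case (single w c)
  show ?case
  proof (induction b rule: star_poly_induct)
    case zero
    show ?case
      using ell2_operatorsD(3)[OF rep_operator ell2_zero, of _ 0] by (simp add: rep_zero f)
  next
    case (single v d)
    have "relation_operator H (word_relation H \<rho> v) f \<in> ell2 H"
      by (intro relation_operator_contraction word_relation f)
    then show ?case
      by (simp add: mult_single rep_single f word_relation_plus relation_operator_relcomp word_relation
          ell2_scale ell2_operatorsD(3)[OF relation_operator_in_ell2_operators[OF word_relation]]
          mult.assoc)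
  next
    case (add a b)
    then show ?case
      by (simp add: distrib_left rep_add f ell2_operatorsD(2)[OF rep_operator] rep_ell2)
  qed
qed (simp_all add: rep_zero rep_add rep_ell2 f distrib_right)

text \<open>Once the relators act by zero, this makes the operator norm of the action one of the
  seminorms under the universal supremum. Its C*-identity comes from the explicit adjoints.\<close>

lemma cstar_seminorm_rep:
  "cstar_seminorm (free_star_algebra X) (\<lambda>a. nrm (bounded_operators H) (rep a))" (is "cstar_seminorm _ ?N")
proof -
  note bound = bounded_operators_nrm_bound[OF rep_operator]
  note nonneg = bounded_operators_nrm_nonneg[OF rep_operator]
  have add: "?N (a + b) \<le> ?N a + ?N b" for a b
  proof (rule bounded_operators_nrm_leI[OF rep_operator])
    fix f assume f: "f \<in> ell2 H"
    show "ell2_norm H (rep (a + b) f) \<le> (?N a + ?N b) * ell2_norm H f"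
      using ell2_norm_triangle[OF rep_ell2[OF f, of a] rep_ell2[OF f, of b]] bound[OF f, of a] bound[OF f, of b]
      by (simp add: rep_add f distrib_right)
  qed (simp add: nonneg)
  have mult: "?N (a * b) \<le> ?N a * ?N b" for a b
  proof (rule bounded_operators_nrm_leI[OF rep_operator])
    fix f assume f: "f \<in> ell2 H"
    show "ell2_norm H (rep (a * b) f) \<le> ?N a * ?N b * ell2_norm H f"
      using order_trans[OF bound[OF rep_ell2[OF f]] mult_left_mono[OF bound[OF f] nonneg]]
      by (simp add: rep_mult f mult.assoc)
  qed (simp add: nonneg)
  have scale: "?N (Poly_Mapping.single 0 c * a) = cmod c * ?N a" for c a
  proof -
    have le: "?N (Poly_Mapping.single 0 c * a) \<le> cmod c * ?N a" for c a
    proof (rule bounded_operators_nrm_leI[OF rep_operator])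
      fix f assume f: "f \<in> ell2 H"
      \<comment> \<open>\<open>rep_one\<close> compared with \<open>rep_single\<close> for the word
        0 and coefficient 1 shows that the empty word acts as the identity, so its multiple by c
        acts as scaling by c.\<close>
      have "rep (Poly_Mapping.single 0 c * a) f = (\<lambda>y. c * rep a f y)"
        using rep_single[OF rep_ell2[OF f], of 0 c a] rep_one[OF rep_ell2[OF f], of a]
          rep_single[OF rep_ell2[OF f], of 0 1 a]
        by (simp add: rep_mult f)
      then show "ell2_norm H (rep (Poly_Mapping.single 0 c * a) f) \<le> cmod c * ?N a * ell2_norm H f"
        using mult_left_mono[OF bound[OF f, of a], of "cmod c"] by (simp add: ell2_norm_scale mult.assoc)
    qed (simp add: nonneg)
    show ?thesis
    proof (cases "c = 0")
      case True
      then show ?thesis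
        using le[of 0 a] nonneg[of 0] by simp
    next
      case False
      \<comment> \<open>The reverse inequality is the first one with the scalar
        \<open>inverse c\<close>, applied to c times a.\<close>
      have "Poly_Mapping.single 0 (inverse c) * (Poly_Mapping.single 0 c * a) = a"
        using False by (simp add: mult_single flip: mult.assoc)
      then have "cmod c * ?N a \<le> cmod c * (cmod (inverse c) * ?N (Poly_Mapping.single 0 c * a))"
        using le[of "inverse c" "Poly_Mapping.single 0 c * a"] by (simp add: mult_left_mono)
      also have "\<dots> = ?N (Poly_Mapping.single 0 c * a)"
        using False by (simp add: norm_inverse)
      finally show ?thesis
        using le[of c a] by (rule antisym[rotated])
    qed
  qed
  have "?N (poly_star a * a) = (?N a)\<^sup>2" for a
  proof (rule antisym)
    have "rep (poly_star a * a) = compose (ell2 H) (rep (poly_star a)) (rep a)"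
      by (rule rep_eqI) (simp_all add: rep_mult compose_def)
    then show "(?N a)\<^sup>2 \<le> ?N (poly_star a * a)"
      using adjoint_pair_nrm_le(2)[OF rep_adjoint, of a] by simp
    have "?N (poly_star a * a) \<le> ?N (poly_star a) * ?N a"
      by (rule mult)
    also have "\<dots> \<le> ?N a * ?N a"
      by (intro mult_right_mono nonneg adjoint_pair_nrm_le(1)[OF adjoint_pair_commute[OF rep_adjoint]])
    finally show "?N (poly_star a * a) \<le> (?N a)\<^sup>2"
      by (simp add: power2_eq_square)
  qed
  with add mult scale nonneg show ?thesis
    by (simp add: cstar_seminorm_def)
qed

text \<open>Universal property for actions by partial bijections: if the relators act by zero, the
  operator norm is at most the universal seminorm, so the action extends to the completion. The
  contractivity of the extension is kept for the closedness of its kernel.\<close>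

lemma universal_cstar_representation:
  assumes gens: "\<And>M x. \<lbrakk>cstar_seminorm (free_star_algebra X) M; \<forall>r\<in>R. M r = 0; x \<in> X\<rbrakk> \<Longrightarrow> M (gen x) \<le> 1"
    and relators: "\<And>r f. r \<in> R \<Longrightarrow> f \<in> ell2 H \<Longrightarrow> rep r f = (\<lambda>x. 0)"
  obtains \<Phi> where "\<Phi> \<in> representations (universal_cstar X R) H"
    and "\<And>a. a \<in> carrier (free_star_algebra X) \<Longrightarrow>
      \<Phi> (completion_map (free_star_algebra X) (universal_seminorm (free_star_algebra X) R) a) = rep a"
    and "\<And>Y f. \<lbrakk>Y \<in> carrier (universal_cstar X R); f \<in> ell2 H\<rbrakk>
      \<Longrightarrow> ell2_norm H (\<Phi> Y f) \<le> nrm (universal_cstar X R) Y * ell2_norm H f"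
proof -
  let ?A = "free_star_algebra X"
  let ?N = "universal_seminorm ?A R"
  interpret seminormed_star_algebra ?A ?N
    by (rule seminormed_star_algebra_universal_seminorm) (rule gens)
  have hom: "rep \<in> star_hom ?A (bounded_operators H)"
  proof (rule star_homI)
    fix a b
    show "rep (a \<oplus>\<^bsub>?A\<^esub> b) = rep a \<oplus>\<^bsub>bounded_operators H\<^esub> rep b"
      by (rule rep_eqI) (simp_all add: rep_add)
    show "rep (a \<otimes>\<^bsub>?A\<^esub> b) = rep a \<otimes>\<^bsub>bounded_operators H\<^esub> rep b"
      by (rule rep_eqI) (simp_all add: rep_mult compose_def)
    show "rep (c \<odot>\<^bsub>?A\<^esub> a) = c \<odot>\<^bsub>bounded_operators H\<^esub> rep a" for c
    proof (rule rep_eqI)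
      fix f assume f: "f \<in> ell2 H"
      show "rep (c \<odot>\<^bsub>?A\<^esub> a) f = (c \<odot>\<^bsub>bounded_operators H\<^esub> rep a) f"
        using rep_single[OF rep_ell2[OF f], of 0 c a] rep_one[OF rep_ell2[OF f], of a]
          rep_single[OF rep_ell2[OF f], of 0 1 a]
        by (simp add: rep_mult f)
    qed simp
    show "rep (star ?A a) = star (bounded_operators H) (rep a)"
      by (simp add: adjoint_eqI[OF rep_adjoint])
    show "rep \<one>\<^bsub>?A\<^esub> = \<one>\<^bsub>bounded_operators H\<^esub>"
      by (rule rep_eqI) (simp_all add: rep_one)
  qed (simp add: rep_operator)
  have zero: "nrm (bounded_operators H) (rep r) = 0" if "r \<in> R" for r
    using bounded_operators_nrm_leI[OF rep_operator, of 0 r] bounded_operators_nrm_nonneg[OF rep_operator, of r]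
    by (simp add: relators[OF that])
  have bound: "ell2_norm H (rep a f) \<le> ?N a * ell2_norm H f" if "a \<in> carrier ?A" "f \<in> ell2 H" for a f
  proof -
    have "nrm (bounded_operators H) (rep a) \<le> ?N a"
      using universal_seminorm_upper[of X R "\<lambda>a. nrm (bounded_operators H) (rep a)" a]
        gens cstar_seminorm_rep zero that(1) by blast
    then show ?thesis
      using bounded_operators_nrm_bound[OF rep_operator that(2), of a] mult_right_mono[OF _ ell2_norm_nonneg]
        order_trans by blast
  qed
  show ?thesis
    by (rule representation_completion_extension[OF hom _ bound])
      (use that in \<open>simp_all add: rep_adjoint universal_cstar_def\<close>)
qed

end


section \<open>The C*-algebra of a semigroup\<close>

context seminormed_star_algebra
begin

lemma foldr_mult_closed:
  assumes "\<And>s. s \<in> set ss \<Longrightarrow> f s \<in> carrier A" "a \<in> carrier A"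
  shows "foldr (\<lambda>s a. f s \<otimes> a) ss a \<in> carrier A"
  using assms by (induction ss) auto

lemma foldr_mult_eq:
  assumes "\<And>s. s \<in> set ss \<Longrightarrow> f s \<in> carrier A" "a \<in> carrier A"
  shows "foldr (\<lambda>s a. f s \<otimes> a) ss a = foldr (\<lambda>s a. f s \<otimes> a) ss \<one> \<otimes> a"
  using assms by (induction ss) (auto simp: foldr_mult_closed m_assoc)

lemma star_foldr_mult:
  assumes "\<And>s. s \<in> set ss \<Longrightarrow> f s \<in> carrier A" "\<And>s. s \<in> set ss \<Longrightarrow> star A (f s) = f s"
  shows "star A (foldr (\<lambda>s a. f s \<otimes> a) ss \<one>) = foldr (\<lambda>s a. f s \<otimes> a) (rev ss) \<one>"
  using assms
proof (induction ss)
  case (Cons s ss)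
  then show ?case
    using foldr_mult_eq[of "rev ss" f "f s"] by (simp add: star_mult foldr_mult_closed)
qed (simp add: star_one)

end

lemma semigroup_relatorsI:
  shows "s \<in> carrier S \<Longrightarrow> poly_star (isom s) * isom s - 1 \<in> semigroup_relators S"
    and "X \<in> constructible_right_ideals S \<Longrightarrow> poly_star (proj X) - proj X \<in> semigroup_relators S"
    and "X \<in> constructible_right_ideals S \<Longrightarrow> proj X * proj X - proj X \<in> semigroup_relators S"
    and "\<lbrakk>s \<in> carrier S; t \<in> carrier S\<rbrakk> \<Longrightarrow> isom s * isom t - isom (s \<otimes>\<^bsub>S\<^esub> t) \<in> semigroup_relators S"
    and "\<lbrakk>s \<in> carrier S; X \<in> constructible_right_ideals S\<rbrakk>
      \<Longrightarrow> isom s * proj X * poly_star (isom s) - proj (s <#\<^bsub>S\<^esub> X) \<in> semigroup_relators S"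
    and "proj (carrier S) - 1 \<in> semigroup_relators S"
    and "proj {} \<in> semigroup_relators S"
    and "\<lbrakk>X \<in> constructible_right_ideals S; Y \<in> constructible_right_ideals S\<rbrakk>
      \<Longrightarrow> proj X * proj Y - proj (X \<inter> Y) \<in> semigroup_relators S"
  unfolding semigroup_relators_def Un_iff mem_Collect_eq singleton_iff by metis+

text \<open>For an isometry v, the relation \<open>v* v = 1\<close> bounds (M v)^2 by M 1 <= 1. For
  a projection, p* p differs from p by (p* - p) p + (p p - p), which has seminorm zero, so (M p)^2
  <= M p. This is the uniform bound under which the universal supremum is finite.\<close>

lemma semigroup_relators_norm_le:
  assumes M: "cstar_seminorm (free_star_algebra (semigroup_gens S)) M"
    and relators: "\<forall>r\<in>semigroup_relators S. M r = 0" and x: "x \<in> semigroup_gens S"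
  shows "M (gen x) \<le> 1"
proof -
  note [simp] = cstar_seminorm_uminus[OF M]
  have mem: "gen x \<in> carrier (free_star_algebra (semigroup_gens S))"
    using x by simp
  consider s where "x = Isom s" "s \<in> carrier S" | X where "x = Proj X" "X \<in> constructible_right_ideals S"
    using x by (auto simp: semigroup_gens_def)
  then show ?thesis
  proof cases
    case (1 s)
    have "poly_star (isom s) * isom s - 1 \<in> semigroup_relators S"
      using 1 by (simp add: semigroup_relatorsI)
    then have "M (poly_star (gen x) * gen x - 1) = 0"
      using relators 1 by simp
    moreover have "M (poly_star (gen x) * gen x) \<le> M (poly_star (gen x) * gen x - 1) + M 1"
      using cstar_seminormD(2)[OF M, of "poly_star (gen x) * gen x - 1" 1] mem by simp
    ultimately have "(M (gen x))\<^sup>2 \<le> 1"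
      using cstar_seminorm_one_le[OF M] cstar_seminormD(5)[OF M mem] by simp
    then show ?thesis
      by (simp add: abs_square_le_1 abs_le_iff)
  next
    case (2 X)
    let ?p = "gen x"
    have "poly_star ?p - ?p \<in> semigroup_relators S" "?p * ?p - ?p \<in> semigroup_relators S"
      using 2 by (simp_all add: semigroup_relatorsI)
    then have zero: "M (poly_star ?p - ?p) = 0" "M (?p * ?p - ?p) = 0"
      using relators by blast+
    have "poly_star ?p * ?p = (poly_star ?p - ?p) * ?p + ((?p * ?p - ?p) + ?p)"
      by (simp add: algebra_simps)
    then have "M (poly_star ?p * ?p) \<le> M ((poly_star ?p - ?p) * ?p) + M ((?p * ?p - ?p) + ?p)"
      using cstar_seminormD(2)[OF M, of "(poly_star ?p - ?p) * ?p" "(?p * ?p - ?p) + ?p"] mem by simp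
    also have "\<dots> \<le> M (poly_star ?p - ?p) * M ?p + (M (?p * ?p - ?p) + M ?p)"
      using mem by (intro add_mono cstar_seminormD(2,4)[OF M]) simp_all
    finally have "(M ?p)\<^sup>2 \<le> M ?p"
      using cstar_seminormD(5)[OF M mem] zero by simp
    then show ?thesis
      using cstar_seminormD(1)[OF M mem] by (cases "M ?p = 0") (auto simp: power2_eq_square order_less_le)
  qed
qed

lemma principal_right_ideal_constructible:
  "s \<in> carrier S \<Longrightarrow> principal_right_ideal S s \<in> constructible_right_ideals S"
  by (simp add: constructible_right_ideals_def)

context
  fixes S :: "('s, 'm) monoid_scheme" and A N C \<kappa>
  defines "A \<equiv> free_star_algebra (semigroup_gens S)"
    and "N \<equiv> universal_seminorm A (semigroup_relators S)"
    and "C \<equiv> semigroup_cstar S"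
    and "\<kappa> \<equiv> completion_map A N"
begin

interpretation A: seminormed_star_algebra A N
  unfolding A_def N_def
  by (rule seminormed_star_algebra_universal_seminorm) (rule semigroup_relators_norm_le)

lemma semigroup_cstar_eq_completion: "C = completion A N"
  by (simp add: C_def semigroup_cstar_def universal_cstar_def A_def N_def)

interpretation C: seminormed_star_algebra C "nrm C"
  unfolding semigroup_cstar_eq_completion by (rule A.seminormed_star_algebra_completion)

lemma A_closed [simp]:
  shows "1 \<in> carrier A"
    and "0 \<in> carrier A"
    and "\<lbrakk>a \<in> carrier A; b \<in> carrier A\<rbrakk> \<Longrightarrow> a * b \<in> carrier A"
    and "a \<in> carrier A \<Longrightarrow> poly_star a \<in> carrier A"
  by (simp_all add: A_def)

lemma A_minus: "\<lbrakk>a \<in> carrier A; b \<in> carrier A\<rbrakk> \<Longrightarrow> a \<ominus>\<^bsub>A\<^esub> b = a - b"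
  by (simp add: A_def)

lemma completion_map_star_hom:
  shows "a \<in> carrier A \<Longrightarrow> \<kappa> a \<in> carrier C"
    and "\<lbrakk>a \<in> carrier A; b \<in> carrier A\<rbrakk> \<Longrightarrow> \<kappa> (a * b) = \<kappa> a \<otimes>\<^bsub>C\<^esub> \<kappa> b"
    and "\<kappa> 1 = \<one>\<^bsub>C\<^esub>"
    and "\<kappa> 0 = \<zero>\<^bsub>C\<^esub>"
    and "a \<in> carrier A \<Longrightarrow> \<kappa> (poly_star a) = star C (\<kappa> a)"
proof -
  note hom = A.completion_map_hom(1)[folded \<kappa>_def semigroup_cstar_eq_completion]
  show "\<kappa> a \<in> carrier C" if "a \<in> carrier A"
    using ring_hom_closed[OF hom] that by simp
  show "\<kappa> (a * b) = \<kappa> a \<otimes>\<^bsub>C\<^esub> \<kappa> b" if "a \<in> carrier A" "b \<in> carrier A"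
    using ring_hom_mult[OF hom, of a b] that by (simp add: A_def)
  show "\<kappa> 1 = \<one>\<^bsub>C\<^esub>"
    using ring_hom_one[OF hom] by (simp add: A_def)
  show "\<kappa> 0 = \<zero>\<^bsub>C\<^esub>"
    by (simp add: \<kappa>_def semigroup_cstar_eq_completion A.completion_zero completion_map_def)
      (simp add: A_def)
  show "\<kappa> (poly_star a) = star C (\<kappa> a)" if "a \<in> carrier A"
    using A.completion_map_hom(2)[OF that] by (simp add: \<kappa>_def semigroup_cstar_eq_completion) (simp add: A_def)
qed

text \<open>A relator has universal seminorm zero, so the two sides of the relation have the same
  class in the completion; the identities between generators of C*(S) are read off in this
  way.\<close>

lemma completion_map_relator:
  assumes "a - b \<in> semigroup_relators S" "a \<in> carrier A" "b \<in> carrier A"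
  shows "\<kappa> a = \<kappa> b"
proof -
  have "N (a - b) = 0"
    unfolding N_def A_def using assms(1)
    by (intro universal_seminorm_relator semigroup_relators_norm_le)
  then show ?thesis
    using assms by (simp add: \<kappa>_def A.completion_map_eq_iff A_minus)
qed

lemma semigroup_gens_closed [simp]:
  shows "s \<in> carrier S \<Longrightarrow> isom s \<in> carrier A"
    and "X \<in> constructible_right_ideals S \<Longrightarrow> proj X \<in> carrier A"
  by (simp_all add: A_def semigroup_gens_def)

lemma semigroup_isom_eq: "semigroup_isom S s = \<kappa> (isom s)"
  and semigroup_proj_eq: "semigroup_proj S X = \<kappa> (proj X)"
  by (simp_all add: semigroup_isom_def semigroup_proj_def universal_gen_def \<kappa>_def N_def A_def)

lemma semigroup_isom_closed: "s \<in> carrier S \<Longrightarrow> semigroup_isom S s \<in> carrier C"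
  by (simp add: semigroup_isom_eq completion_map_star_hom semigroup_gens_closed)

lemma semigroup_proj_closed: "X \<in> constructible_right_ideals S \<Longrightarrow> semigroup_proj S X \<in> carrier C"
  by (simp add: semigroup_proj_eq completion_map_star_hom semigroup_gens_closed)

lemma star_semigroup_proj:
  assumes X: "X \<in> constructible_right_ideals S"
  shows "star C (semigroup_proj S X) = semigroup_proj S X"
proof -
  have "poly_star (proj X) - proj X \<in> semigroup_relators S"
    by (rule semigroup_relatorsI(2)[OF X])
  from completion_map_relator[OF this] X show ?thesis
    by (simp add: semigroup_proj_eq completion_map_star_hom(5))
qed

lemma foundation_product_closed: "set ss \<subseteq> carrier S \<Longrightarrow> foundation_product S ss \<in> carrier C"
  unfolding foundation_product_def Let_def C_def[symmetric]
  by (rule C.foldr_mult_closed)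
    (auto intro!: C.minus_closed semigroup_proj_closed principal_right_ideal_constructible)

text \<open>The factors are self-adjoint, so the star only reverses their order, and the reversed
  list enumerates the same set. Hence the generators of the boundary ideal form a set closed under
  the star.\<close>

lemma star_foundation_product:
  assumes "set ss \<subseteq> carrier S"
  shows "star C (foundation_product S ss) = foundation_product S (rev ss)"
  unfolding foundation_product_def Let_def C_def[symmetric]
proof (rule C.star_foldr_mult)
  fix s assume "s \<in> set ss"
  then have X: "principal_right_ideal S s \<in> constructible_right_ideals S"
    using assms by (auto intro: principal_right_ideal_constructible)
  show "\<one>\<^bsub>C\<^esub> \<ominus>\<^bsub>C\<^esub> semigroup_proj S (principal_right_ideal S s) \<in> carrier C"
    using semigroup_proj_closed[OF X] by simp
  show "star C (\<one>\<^bsub>C\<^esub> \<ominus>\<^bsub>C\<^esub> semigroup_proj S (principal_right_ideal S s))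
    = \<one>\<^bsub>C\<^esub> \<ominus>\<^bsub>C\<^esub> semigroup_proj S (principal_right_ideal S s)"
    using semigroup_proj_closed[OF X] by (simp add: C.star_minus C.star_one star_semigroup_proj[OF X])
qed

lemma star_ideal_boundary_ideal: "star_ideal C (boundary_ideal S)"
proof -
  let ?K = "{foundation_product S ss | ss. distinct ss \<and> foundation_set S (set ss)}"
  have K: "?K \<subseteq> carrier C"
    by (auto simp: foundation_set_def intro: foundation_product_closed)
  have star_K: "star C x \<in> ?K" if x: "x \<in> ?K" for x
  proof -
    obtain ss where ss: "x = foundation_product S ss" "distinct ss" "foundation_set S (set ss)"
      using x by blast
    then have "star C x = foundation_product S (rev ss)"
      by (simp add: star_foundation_product foundation_set_def)
    moreover have "distinct (rev ss)" "foundation_set S (set (rev ss))"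
      using ss by simp_all
    ultimately show ?thesis
      by blast
  qed
  show ?thesis
    unfolding boundary_ideal_def C_def[symmetric]
  proof (intro star_ideal.intro star_ideal_axioms.intro)
    show "ideal (closed_ideal_generated_by C ?K) C"
      by (rule ideal_closed_ideal_generated_by[OF C.ring_axioms K])
    show "star C x \<in> closed_ideal_generated_by C ?K" if "x \<in> closed_ideal_generated_by C ?K" for x
      by (rule closed_ideal_generated_by_star[OF C.seminormed_star_algebra_axioms K star_K that])
  qed (rule C.seminormed_star_algebra_axioms)
qed

interpretation I: star_ideal C "boundary_ideal S"
  by (rule star_ideal_boundary_ideal)

section \<open>Products and orthogonality of the isometries\<close>

lemma semigroup_isom_mult:
  assumes "s \<in> carrier S" "t \<in> carrier S" "s \<otimes>\<^bsub>S\<^esub> t \<in> carrier S"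
  shows "semigroup_isom S s \<otimes>\<^bsub>C\<^esub> semigroup_isom S t = semigroup_isom S (s \<otimes>\<^bsub>S\<^esub> t)"
proof -
  have "isom s * isom t - isom (s \<otimes>\<^bsub>S\<^esub> t) \<in> semigroup_relators S"
    by (rule semigroup_relatorsI(4)[OF assms(1,2)])
  from completion_map_relator[OF this] assms show ?thesis
    by (simp add: semigroup_isom_eq completion_map_star_hom(2))
qed

lemma boundary_isom_mult:
  assumes "s \<in> carrier S" "t \<in> carrier S" "s \<otimes>\<^bsub>S\<^esub> t \<in> carrier S"
  shows "boundary_isom S s \<otimes>\<^bsub>boundary_quotient S\<^esub> boundary_isom S t = boundary_isom S (s \<otimes>\<^bsub>S\<^esub> t)"
  unfolding boundary_isom_def boundary_quotient_def C_def[symmetric] semigroup_isom_mult[OF assms, symmetric]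
  by (rule I.cstar_quotient_mult[OF semigroup_isom_closed[OF assms(1)] semigroup_isom_closed[OF assms(2)]])

lemma semigroup_isom_orthogonal:
  assumes "monoid S" and s: "s \<in> carrier S" and t: "t \<in> carrier S"
    and disjoint: "principal_right_ideal S s \<inter> principal_right_ideal S t = {}"
  shows "star C (semigroup_isom S s) \<otimes>\<^bsub>C\<^esub> semigroup_isom S t = \<zero>\<^bsub>C\<^esub>"
proof -
  interpret S: monoid S by fact
  let ?e = "\<lambda>s. semigroup_proj S (principal_right_ideal S s)"
  let ?v = "semigroup_isom S"
  have "principal_right_ideal S \<one>\<^bsub>S\<^esub> = carrier S"
    by (auto simp: l_coset_def)
  then have carrier: "carrier S \<in> constructible_right_ideals S"
    using principal_right_ideal_constructible[OF S.one_closed] by simp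
  have isometry: "star C (?v s) \<otimes>\<^bsub>C\<^esub> ?v s = \<one>\<^bsub>C\<^esub>" if s: "s \<in> carrier S" for s
  proof -
    have "poly_star (isom s) * isom s - 1 \<in> semigroup_relators S"
      by (rule semigroup_relatorsI(1)[OF s])
    from completion_map_relator[OF this] s show ?thesis
      by (simp add: semigroup_isom_eq completion_map_star_hom)
  qed
  \<comment> \<open>Since the projection of the whole semigroup is 1, the relation
    \<open>v_s e_X v_s* = e_sX\<close> with X the carrier says that \<open>v_s v_s*\<close> is the
    projection of sS.\<close>
  have range: "?v s \<otimes>\<^bsub>C\<^esub> star C (?v s) = ?e s" if s: "s \<in> carrier S" for s
  proof -
    from completion_map_relator[OF semigroup_relatorsI(6)] carrier have "\<kappa> (proj (carrier S)) = \<one>\<^bsub>C\<^esub>"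
      by (simp add: completion_map_star_hom)
    moreover from completion_map_relator[OF semigroup_relatorsI(5)[OF s carrier]] s carrier
    have "\<kappa> (isom s) \<otimes>\<^bsub>C\<^esub> \<kappa> (proj (carrier S)) \<otimes>\<^bsub>C\<^esub> star C (\<kappa> (isom s)) = \<kappa> (proj (principal_right_ideal S s))"
      by (simp add: completion_map_star_hom principal_right_ideal_constructible)
    ultimately show ?thesis
      using s by (simp add: semigroup_isom_eq semigroup_proj_eq completion_map_star_hom)
  qed
  have empty: "{} \<in> constructible_right_ideals S"
    by (simp add: constructible_right_ideals_def)
  \<comment> \<open>The relator \<open>proj {}\<close> is written as a difference with 0 so that it
    has the shape a - b expected by \<open>completion_map_relator\<close>.\<close>
  have "proj {} - 0 \<in> semigroup_relators S"
    by (simp add: semigroup_relatorsI(7))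
  from completion_map_relator[OF this] empty have zero: "\<kappa> (proj {}) = \<zero>\<^bsub>C\<^esub>"
    by (simp add: completion_map_star_hom)
  have "proj (principal_right_ideal S s) * proj (principal_right_ideal S t)
      - proj (principal_right_ideal S s \<inter> principal_right_ideal S t) \<in> semigroup_relators S"
    by (intro semigroup_relatorsI(8) principal_right_ideal_constructible s t)
  from completion_map_relator[OF this[unfolded disjoint]] s t empty
  have orthogonal: "?e s \<otimes>\<^bsub>C\<^esub> ?e t = \<zero>\<^bsub>C\<^esub>"
    by (simp add: completion_map_star_hom principal_right_ideal_constructible semigroup_proj_eq zero)
  have mem: "?v s \<in> carrier C" "?v t \<in> carrier C" "?e s \<in> carrier C" "?e t \<in> carrier C"
    using s t by (simp_all add: semigroup_isom_closed semigroup_proj_closed principal_right_ideal_constructible)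
  have "star C (?v s) \<otimes>\<^bsub>C\<^esub> ?v t
      = (star C (?v s) \<otimes>\<^bsub>C\<^esub> ?v s) \<otimes>\<^bsub>C\<^esub> star C (?v s) \<otimes>\<^bsub>C\<^esub> (?v t \<otimes>\<^bsub>C\<^esub> (star C (?v t) \<otimes>\<^bsub>C\<^esub> ?v t))"
    using mem by (simp add: isometry s t)
  also have "\<dots> = star C (?v s) \<otimes>\<^bsub>C\<^esub> ((?v s \<otimes>\<^bsub>C\<^esub> star C (?v s)) \<otimes>\<^bsub>C\<^esub> (?v t \<otimes>\<^bsub>C\<^esub> star C (?v t))) \<otimes>\<^bsub>C\<^esub> ?v t"
    using mem by (simp add: C.m_assoc)
  also have "\<dots> = \<zero>\<^bsub>C\<^esub>"
    using mem by (simp add: range s t orthogonal)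
  finally show ?thesis .
qed

end


section \<open>Algebraic dynamical systems\<close>

context algebraic_dynamical_system
begin

abbreviation GP :: "('g \<times> 'p) monoid"
  where "GP \<equiv> semidirect_product G P \<theta>"

lemma semidirect_simps [simp]:
  "carrier GP = carrier G \<times> carrier P"
  "(g, p) \<otimes>\<^bsub>GP\<^esub> (h, q) = (g \<otimes> \<theta> p h, p \<otimes>\<^bsub>P\<^esub> q)"
  "\<one>\<^bsub>GP\<^esub> = (\<one>, \<one>\<^bsub>P\<^esub>)"
  by (simp_all add: semidirect_product_def)

lemma theta_closed [simp]: "\<lbrakk>p \<in> carrier P; g \<in> carrier G\<rbrakk> \<Longrightarrow> \<theta> p g \<in> carrier G"
  using hom_in_carrier[OF endomorphism] .

lemma theta_mult:
  "\<lbrakk>p \<in> carrier P; g \<in> carrier G; h \<in> carrier G\<rbrakk> \<Longrightarrow> \<theta> p (g \<otimes> h) = \<theta> p g \<otimes> \<theta> p h"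
  using hom_mult[OF endomorphism] .

lemma theta_one [simp]: "p \<in> carrier P \<Longrightarrow> \<theta> p \<one> = \<one>"
  using hom_one[OF endomorphism G.is_group G.is_group] .

lemma monoid_semidirect: "monoid GP"
  by (rule monoidI) (auto simp: theta_mult action_mult action_one G.m_assoc P.m_assoc)

text \<open>The second coordinate of a product does not involve the group elements, so a translate
  of a rectangle is a rectangle; intersections of principal ideals are then decided in G and P
  separately.\<close>

lemma l_coset_semidirect:
  "(g, p) <#\<^bsub>GP\<^esub> (A \<times> B) = (\<lambda>h. g \<otimes> \<theta> p h) ` A \<times> (p <#\<^bsub>P\<^esub> B)"
  by (force simp: l_coset_def)

lemma Domain_principal_right_ideal:
  assumes "g \<in> carrier G" "p \<in> carrier P"
  shows "Domain (principal_right_ideal GP (g, p)) = (\<lambda>h. g \<otimes> \<theta> p h) ` carrier G"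
proof -
  \<comment> \<open>Without a point in the second factor the \<open>Domain\<close> of the rectangle
    would be empty.\<close>
  have "p \<in> principal_right_ideal P p"
    unfolding l_coset_def using assms by (auto intro!: bexI[of _ "\<one>\<^bsub>P\<^esub>"])
  then show ?thesis
    by (auto simp: l_coset_semidirect)
qed

text \<open>
  A constructible right ideal is a product of a left coset of some \<open>\<theta> p ` G\<close> with a right ideal of
  \<open>P\<close>, so its \<^const>\<open>Domain\<close> is that coset.
\<close>

primrec gen_relation :: "('g \<times> 'p) semigroup_gen \<Rightarrow> 'g rel"
  where
    "gen_relation (Isom s) = {(h, fst s \<otimes> \<theta> (snd s) h) | h. h \<in> carrier G \<and> s \<in> carrier GP}"
  | "gen_relation (Proj Y) = Id_on (Domain Y \<inter> carrier G)"

lemma inj_on_affine: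
  assumes "g \<in> carrier G" "p \<in> carrier P"
  shows "inj_on (\<lambda>h. g \<otimes> \<theta> p h) (carrier G)"
proof (rule inj_onI)
  fix h k assume hk: "h \<in> carrier G" "k \<in> carrier G" "g \<otimes> \<theta> p h = g \<otimes> \<theta> p k"
  then have "\<theta> p h = \<theta> p k"
    using assms by simp
  then show "h = k"
    using inj_onD[OF injective[OF assms(2)]] hk by blast
qed

text \<open>All generators of the type are covered: \<open>Isom s\<close> acts by the empty relation
  when s is outside the carrier, and \<open>Proj Y\<close> is cut down to
  \<open>carrier G\<close>.\<close>

sublocale gen: partial_bijections "carrier G" gen_relation
proof
  fix x
  show "partial_bijection (carrier G) (gen_relation x)"
  proof (cases x)
    case (Isom s)
    obtain g p where s: "s = (g, p)"
      by (cases s)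
    show ?thesis
    proof (cases "s \<in> carrier GP")
      case True
      then have "gen_relation x = {(h, g \<otimes> \<theta> p h) | h. h \<in> carrier G}"
        by (simp add: Isom s)
      then show ?thesis
        using True s by (simp only:) (rule partial_bijection_graph, auto simp: inj_on_affine)
    qed (auto simp: Isom partial_bijection_def)
  qed (simp add: partial_bijection_Id_on)
qed

text \<open>Both factors are operators of graphs, and composing the graphs, the one of
  \<open>\<theta> p\<close> first, gives the graph of the affine map assigned to (g, p).\<close>

lemma translation_endomorphism_eq:
  assumes g: "g \<in> carrier G" and p: "p \<in> carrier P"
  shows "translation_unitary G g \<otimes>\<^bsub>bounded_operators (carrier G)\<^esub> endomorphism_isometry G \<theta> p
    = relation_operator (carrier G) (gen_relation (Isom (g, p)))"
proof -
  let ?R = "{(h, \<theta> p h) | h. h \<in> carrier G}" and ?R' = "{(h, g \<otimes> h) | h. h \<in> carrier G}"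
  have R: "inj_on (\<theta> p) (carrier G)" "\<theta> p ` carrier G \<subseteq> carrier G"
    and R': "inj_on (\<lambda>h. g \<otimes> h) (carrier G)" "(\<lambda>h. g \<otimes> h) ` carrier G \<subseteq> carrier G"
    using g p injective G.inj_on_cmult by auto
  have "gen_relation (Isom (g, p)) = ?R O ?R'"
    using g p by (auto simp: relcomp_unfold)
  moreover have "relation_operator (carrier G) (?R O ?R')
    = compose (ell2 (carrier G)) (relation_operator (carrier G) ?R') (relation_operator (carrier G) ?R)"
  proof
    fix f
    show "relation_operator (carrier G) (?R O ?R') f
      = compose (ell2 (carrier G)) (relation_operator (carrier G) ?R') (relation_operator (carrier G) ?R) f"
    proof (cases "f \<in> ell2 (carrier G)")
      case True
      then show ?thesis
        using relation_operator_relcomp[OF partial_bijection_graph[OF R] partial_bijection_graph[OF R'] True]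
        by (simp add: compose_def)
    qed (simp add: relation_operator_def compose_def)
  qed
  ultimately show ?thesis
    by (simp only: bounded_operators_simps translation_unitary_def endomorphism_isometry_def
        induced_isometry_eq_relation_operator[OF R] induced_isometry_eq_relation_operator[OF R'])
qed

section \<open>The defining relations of C*(S) as identities between partial bijections\<close>

lemma single_valued_converse_relcomp: "single_valued (R\<inverse>) \<Longrightarrow> R O R\<inverse> = Id_on (Domain R)"
  by (auto simp: single_valued_def)

text \<open>In operator order this composite is v_s* v_s: the relation is injective and defined on
  all of G, so going forth and back is the identity.\<close>

lemma gen_relation_Isom_isometry:
  assumes "s \<in> carrier GP"
  shows "gen_relation (Isom s) O (gen_relation (Isom s))\<inverse> = Id_on (carrier G)"
proof -
  have "single_valued ((gen_relation (Isom s))\<inverse>)"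
    using gen.partial_bijection by (simp add: partial_bijection_def del: gen_relation.simps)
  moreover have "Domain (gen_relation (Isom s)) = carrier G"
    using assms by auto
  ultimately show ?thesis
    by (simp only: single_valued_converse_relcomp)
qed

lemma gen_relation_Isom_mult:
  assumes "s \<in> carrier GP" "t \<in> carrier GP"
  shows "gen_relation (Isom t) O gen_relation (Isom s) = gen_relation (Isom (s \<otimes>\<^bsub>GP\<^esub> t))"
proof -
  obtain g p h q where st: "s = (g, p)" "t = (h, q)" "g \<in> carrier G" "p \<in> carrier P"
    "h \<in> carrier G" "q \<in> carrier P"
    using assms by (cases s; cases t) auto
  have "gen_relation (Isom t) O gen_relation (Isom s)
      = {(k, g \<otimes> \<theta> p (h \<otimes> \<theta> q k)) | k. k \<in> carrier G}"
    using st by (auto simp: relcomp_unfold)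
  also have "\<dots> = {(k, g \<otimes> \<theta> p h \<otimes> \<theta> (p \<otimes>\<^bsub>P\<^esub> q) k) | k. k \<in> carrier G}"
    using st by (intro Collect_cong) (auto simp: theta_mult action_mult G.m_assoc)
  finally show ?thesis
    using st by simp
qed

lemma single_valued_converse_Id_on:
  "single_valued R \<Longrightarrow> R\<inverse> O (Id_on D O R) = Id_on (R `` D)"
  by (auto simp: single_valued_def)

text \<open>Going back along a single-valued relation, staying in D and going forth again is the
  identity on the image of D. Here D is \<open>Domain Y\<close>, whose image under the affine map of
  s is the \<open>Domain\<close> of the translate.\<close>

lemma gen_relation_Proj_l_coset:
  assumes "s \<in> carrier GP" "Y \<subseteq> carrier GP"
  shows "(gen_relation (Isom s))\<inverse> O (gen_relation (Proj Y) O gen_relation (Isom s))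
    = gen_relation (Proj (s <#\<^bsub>GP\<^esub> Y))"
proof -
  obtain g p where s: "s = (g, p)" "g \<in> carrier G" "p \<in> carrier P"
    using assms(1) by (cases s) auto
  have "Domain (s <#\<^bsub>GP\<^esub> Y) = (\<lambda>h. g \<otimes> \<theta> p h) ` Domain Y"
    by (force simp: s l_coset_def)
  then have "gen_relation (Isom s) `` (Domain Y \<inter> carrier G) = Domain (s <#\<^bsub>GP\<^esub> Y) \<inter> carrier G"
    using s assms(2) by (fastforce simp: Image_iff)
  moreover have "single_valued (gen_relation (Isom s))"
    using gen.partial_bijection by (simp add: partial_bijection_def del: gen_relation.simps)
  ultimately show ?thesis
    by (simp only: gen_relation.simps(2) single_valued_converse_Id_on)
qed

lemma constructible_subset: "Y \<in> constructible_right_ideals GP \<Longrightarrow> Y \<subseteq> carrier GP"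
  using monoid.m_closed[OF monoid_semidirect] by (auto simp: constructible_right_ideals_def l_coset_def)

lemma gen_relation_Proj_carrier: "gen_relation (Proj (carrier GP)) = Id_on (carrier G)"
  using P.one_closed by auto

text \<open>Nonempty ideals intersect in a rectangle, the intersection of the two cosets times that
  of pP and qP. Taking \<open>Domain\<close> forgets the second factor, which loses nothing because
  directedness makes that factor nonempty; this is where the action of C*(S) draws on
  directedness.\<close>

lemma Domain_Int_constructible:
  assumes "directed P" and Y: "Y \<in> constructible_right_ideals GP" and Z: "Z \<in> constructible_right_ideals GP"
  shows "Domain (Y \<inter> Z) = Domain Y \<inter> Domain Z"
proof (cases "Y = {} \<or> Z = {}")
  case False
  then obtain g p h q where *: "g \<in> carrier G" "p \<in> carrier P" "Y = principal_right_ideal GP (g, p)"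
    "h \<in> carrier G" "q \<in> carrier P" "Z = principal_right_ideal GP (h, q)"
    using Y Z by (auto simp: constructible_right_ideals_def)
  have "principal_right_ideal P p \<inter> principal_right_ideal P q \<noteq> {}"
    using assms(1) *(2,5) by (simp add: directed_def)
  then show ?thesis
    by (auto simp: * l_coset_semidirect)
qed auto

text \<open>Products of generators act by composites of partial bijections, so a relator of the form
  a - b reduces to an equality of two relations on G, and \<open>proj {}\<close> acts by the empty
  relation.\<close>

lemma rep_relators:
  assumes "directed P" and r: "r \<in> semigroup_relators GP" and f: "f \<in> ell2 (carrier G)"
  shows "gen.rep r f = (\<lambda>x. 0)"
proof -
  have eq: "gen.rep (a - b) f = (\<lambda>x. 0)" if "gen.rep a f = gen.rep b f" for a b
    using that by (simp add: gen.rep_minus f)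
  have Id: "relation_operator (carrier G) (Id_on (carrier G)) f = f"
    using ell2_outside[OF f] by (simp add: relation_operator_Id_on f fun_eq_iff)
  note pb = gen.partial_bijection partial_bijection_converse[OF gen.partial_bijection]
  note simps = gen.rep_mult f gen.rep_gen gen.rep_gen_star gen.rep_one
    relation_operator_contraction(1) pb partial_bijection_relcomp Id
    relation_operator_relcomp[symmetric]
  consider (isometry) s where "r = poly_star (isom s) * isom s - 1" "s \<in> carrier GP"
    | (star) X where "r = poly_star (proj X) - proj X"
    | (idem) X where "r = proj X * proj X - proj X"
    | (mult) s t where "r = isom s * isom t - isom (s \<otimes>\<^bsub>GP\<^esub> t)" "s \<in> carrier GP" "t \<in> carrier GP"
    | (coset) s X where "r = isom s * proj X * poly_star (isom s) - proj (s <#\<^bsub>GP\<^esub> X)"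
      "s \<in> carrier GP" "X \<in> constructible_right_ideals GP"
    | (one) "r = proj (carrier GP) - 1"
    | (empty) "r = proj {}"
    | (Int) X Y where "r = proj X * proj Y - proj (X \<inter> Y)"
      "X \<in> constructible_right_ideals GP" "Y \<in> constructible_right_ideals GP"
    using r unfolding semigroup_relators_def Un_iff mem_Collect_eq singleton_iff
    by (elim disjE exE conjE) blast+
  then show ?thesis
  proof cases
    case isometry
    show ?thesis
      unfolding isometry by (rule eq) (simp add: simps gen_relation_Isom_isometry isometry(2) del: gen_relation.simps semidirect_simps)
  next
    case star
    show ?thesis
      unfolding star by (rule eq) (simp add: gen.rep_gen gen.rep_gen_star f)
  next
    case idem
    have "gen_relation (Proj X) O gen_relation (Proj X) = gen_relation (Proj X)"
      by auto
    then show ?thesis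
      unfolding idem by (intro eq) (simp add: simps del: gen_relation.simps)
  next
    case mult
    show ?thesis
      unfolding mult by (rule eq) (simp add: simps gen_relation_Isom_mult mult del: gen_relation.simps semidirect_simps)
  next
    case coset
    show ?thesis
      unfolding coset
      by (rule eq) (simp add: simps coset constructible_subset O_assoc del: gen_relation.simps semidirect_simps
          flip: gen_relation_Proj_l_coset)
  next
    case one
    show ?thesis
      unfolding one
      by (rule eq) (simp add: simps gen_relation_Proj_carrier del: gen_relation.simps semidirect_simps)
  next
    case empty
    show ?thesis
      by (simp add: empty gen.rep_gen f relation_operator_def)
  next
    case (Int Y Z)
    have "gen_relation (Proj Z) O gen_relation (Proj Y)
        = Id_on (Domain Y \<inter> Domain Z \<inter> carrier G)"
      by auto
    then have "gen_relation (Proj Z) O gen_relation (Proj Y) = gen_relation (Proj (Y \<inter> Z))"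
      by (simp only: gen_relation.simps Domain_Int_constructible[OF assms(1) Int(2,3)])
    then show ?thesis
      unfolding Int by (intro eq) (simp add: simps del: gen_relation.simps)
  qed
qed

section \<open>Foundation sets over a directed semigroup\<close>

text \<open>Directedness gives common multiples of two elements, and being a right multiple is
  transitive; finite sets follow by induction, with the identity serving for the empty set.\<close>

lemma directed_common_multiple:
  assumes "directed P" "finite F" "F \<subseteq> carrier P"
  shows "\<exists>r\<in>carrier P. \<forall>p\<in>F. r \<in> principal_right_ideal P p"
  using assms(2,3)
proof (induction F)
  case empty
  show ?case
    using P.one_closed by blast
next
  case (insert p F)
  then obtain r where r: "r \<in> carrier P" "\<forall>q\<in>F. r \<in> principal_right_ideal P q"
    by auto
  have "principal_right_ideal P p \<inter> principal_right_ideal P r \<noteq> {}"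
    using assms(1) insert.prems r(1) by (simp add: directed_def)
  then obtain x where x: "x \<in> principal_right_ideal P p" "x \<in> principal_right_ideal P r"
    by blast
  have "x \<in> principal_right_ideal P q" if q: "q \<in> F" for q
  proof -
    obtain y z where "y \<in> carrier P" "z \<in> carrier P" "r = q \<otimes>\<^bsub>P\<^esub> y" "x = r \<otimes>\<^bsub>P\<^esub> z"
      using r q x by (auto simp: l_coset_def)
    then have "x = q \<otimes>\<^bsub>P\<^esub> (y \<otimes>\<^bsub>P\<^esub> z)" "y \<otimes>\<^bsub>P\<^esub> z \<in> carrier P"
      using insert.prems q by (auto simp: P.m_assoc)
    then show ?thesis
      by (auto simp: l_coset_def)
  qed
  moreover have "x \<in> carrier P"
    using x insert.prems by (auto simp: l_coset_def)
  ultimately show ?case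
    using x by blast
qed

lemma foundation_set_cover:
  assumes "directed P" and F: "foundation_set GP F" and y: "y \<in> carrier G"
  shows "\<exists>s\<in>F. y \<in> Domain (principal_right_ideal GP s)"
proof -
  have F': "finite F" "F \<subseteq> carrier G \<times> carrier P"
    using F by (auto simp: foundation_set_def)
  have "finite (snd ` F)" "snd ` F \<subseteq> carrier P"
    using F' by auto
  from directed_common_multiple[OF assms(1) this] obtain r
    where r: "r \<in> carrier P" "\<forall>p\<in>snd ` F. r \<in> principal_right_ideal P p"
    by blast
  then obtain g p where gp: "(g, p) \<in> F"
    "principal_right_ideal GP (y, r) \<inter> principal_right_ideal GP (g, p) \<noteq> {}"
    using F y unfolding foundation_set_def by fastforce
  have mem: "g \<in> carrier G" "p \<in> carrier P"
    using gp F' by auto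
  obtain h k where hk: "h \<in> carrier G" "k \<in> carrier G" "y \<otimes> \<theta> r h = g \<otimes> \<theta> p k"
    using gp(2) mem y r(1) by (auto simp: l_coset_semidirect)
  \<comment> \<open>r was chosen as a common multiple before (g, p) was found, so it is a multiple
    of this p too.\<close>
  obtain x where x: "x \<in> carrier P" "r = p \<otimes>\<^bsub>P\<^esub> x"
    using r(2) gp(1) by (force simp: l_coset_def)
  have "\<theta> r h = \<theta> p (\<theta> x h)"
    using x mem hk by (simp add: action_mult)
  moreover have "\<theta> p (inv (\<theta> x h)) = inv (\<theta> p (\<theta> x h))"
    using mem x hk by (intro G.inv_equality[symmetric]) (simp_all flip: theta_mult)
  \<comment> \<open>Because r = p x, the factor \<open>\<theta> r h\<close> lies in the image of
    \<open>\<theta> p\<close> and can be moved to the right-hand side, which exhibits y in the coset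
    of (g, p).\<close>
  ultimately have "y = g \<otimes> \<theta> p (k \<otimes> inv (\<theta> x h))"
    using hk mem x y r(1) by (simp add: theta_mult G.inv_solve_right flip: G.m_assoc)
  then show ?thesis
    using gp(1) mem hk x by (intro bexI[of _ "(g, p)"]) (auto simp: Domain_principal_right_ideal simp del: semidirect_simps(1))
qed

section \<open>Sufficiency of directedness\<close>

lemma directed_imp_representation:
  assumes "directed P"
  obtains \<Lambda> where "\<Lambda> \<in> representations (boundary_quotient GP) (carrier G)"
    and "\<And>g p. \<lbrakk>g \<in> carrier G; p \<in> carrier P\<rbrakk> \<Longrightarrow> \<Lambda> (boundary_isom GP (g, p)) =
      translation_unitary G g \<otimes>\<^bsub>bounded_operators (carrier G)\<^esub> endomorphism_isometry G \<theta> p"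
proof -
  let ?C = "semigroup_cstar GP" and ?H = "carrier G"
  obtain \<Phi> where \<Phi>: "\<Phi> \<in> representations ?C ?H"
    and \<Phi>_map: "\<And>a. a \<in> carrier (free_star_algebra (semigroup_gens GP)) \<Longrightarrow>
      \<Phi> (completion_map (free_star_algebra (semigroup_gens GP))
        (universal_seminorm (free_star_algebra (semigroup_gens GP)) (semigroup_relators GP)) a) = gen.rep a"
    and bound: "\<And>Y f. \<lbrakk>Y \<in> carrier ?C; f \<in> ell2 ?H\<rbrakk> \<Longrightarrow> ell2_norm ?H (\<Phi> Y f) \<le> nrm ?C Y * ell2_norm ?H f"
    unfolding semigroup_cstar_def
  proof (rule gen.universal_cstar_representation[of "semigroup_gens GP" "semigroup_relators GP"])
    show "M (gen x) \<le> 1" if "cstar_seminorm (free_star_algebra (semigroup_gens GP)) M"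
      "\<forall>r\<in>semigroup_relators GP. M r = 0" "x \<in> semigroup_gens GP" for M x
      by (rule semigroup_relators_norm_le[OF that])
    show "gen.rep r f = (\<lambda>x. 0)" if "r \<in> semigroup_relators GP" "f \<in> ell2 ?H" for r f
      by (rule rep_relators[OF assms that])
  qed blast
  have \<Phi>_gen: "\<Phi> (universal_gen (semigroup_gens GP) (semigroup_relators GP) x)
      = relation_operator ?H (gen_relation x)" if "x \<in> semigroup_gens GP" for x
  proof -
    have "gen.rep (gen x) = relation_operator ?H (gen_relation x)"
      by (rule gen.rep_eqI) (simp_all add: gen.rep_gen relation_operator_def)
    then show ?thesis
      using that by (simp add: universal_gen_def \<Phi>_map)
  qed
  interpret star_ideal ?C "boundary_ideal GP"
    by (rule star_ideal_boundary_ideal)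
  \<comment> \<open>Each factor acts as the restriction to the complement of one coset, so the
    product restricts to the complement of their union. Membership in the carrier is proved along,
    since \<Phi> is known to be multiplicative only there.\<close>
  have product: "foundation_product GP ss \<in> carrier ?C \<and> (\<forall>f\<in>ell2 ?H. \<Phi> (foundation_product GP ss) f
      = (\<lambda>y. if \<exists>s\<in>set ss. y \<in> Domain (principal_right_ideal GP s) then 0 else f y))"
    if "set ss \<subseteq> carrier GP" for ss
    using that
  proof (induction ss)
    case Nil
    then show ?case
      by (simp add: foundation_product_def Let_def representationsD(3)[OF \<Phi>])
  next
    case (Cons s ss)
    let ?e = "semigroup_proj GP (principal_right_ideal GP s)"
    have X: "principal_right_ideal GP s \<in> constructible_right_ideals GP"
      using Cons.prems by (intro principal_right_ideal_constructible) simp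
    have e: "?e \<in> carrier ?C"
      by (rule semigroup_proj_closed[OF X])
    have IH: "foundation_product GP ss \<in> carrier ?C" "\<And>f. f \<in> ell2 ?H \<Longrightarrow> \<Phi> (foundation_product GP ss) f
      = (\<lambda>y. if \<exists>s\<in>set ss. y \<in> Domain (principal_right_ideal GP s) then 0 else f y)"
      using Cons by auto
    have eq: "foundation_product GP (s # ss) = (\<one>\<^bsub>?C\<^esub> \<ominus>\<^bsub>?C\<^esub> ?e) \<otimes>\<^bsub>?C\<^esub> foundation_product GP ss"
      by (simp add: foundation_product_def Let_def)
    have "\<Phi> (foundation_product GP (s # ss)) f
      = (\<lambda>y. if \<exists>s\<in>set (s # ss). y \<in> Domain (principal_right_ideal GP s) then 0 else f y)"
      if f: "f \<in> ell2 ?H" for f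
    proof -
      have mem: "\<Phi> (foundation_product GP ss) f \<in> ell2 ?H"
        using star_homD(1)[OF \<Phi> IH(1)] f by (simp add: ell2_operatorsD)
      have "\<Phi> ?e = relation_operator ?H (gen_relation (Proj (principal_right_ideal GP s)))"
        unfolding semigroup_proj_def using X by (intro \<Phi>_gen) (simp add: semigroup_gens_def)
      moreover have "Domain (principal_right_ideal GP s) \<subseteq> carrier G"
        using constructible_subset[OF X] by auto
      ultimately have "\<Phi> (foundation_product GP (s # ss)) f = (\<lambda>y. \<Phi> (foundation_product GP ss) f y
          - (if y \<in> Domain (principal_right_ideal GP s) then \<Phi> (foundation_product GP ss) f y else 0))"
        using mem e IH(1) f
        by (simp add: eq representationsD[OF \<Phi>] representations_minus[OF ring_axioms \<Phi>]
            relation_operator_Id_on Int_absorb2)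
      then show ?thesis
        by (auto simp: IH(2)[OF f] fun_eq_iff)
    qed
    then show ?case
      using e IH(1) by (auto simp: eq)
  qed
  have mem: "foundation_product GP ss \<in> {a \<in> carrier ?C. \<Phi> a = \<zero>\<^bsub>bounded_operators ?H\<^esub>}"
    if "distinct ss" "foundation_set GP (set ss)" for ss
  proof -
    have ss: "set ss \<subseteq> carrier GP"
      using that by (simp add: foundation_set_def)
    have "\<Phi> (foundation_product GP ss) f = (\<lambda>y. 0)" if f: "f \<in> ell2 ?H" for f
    proof
      fix y
      show "\<Phi> (foundation_product GP ss) f y = 0"
        using product[OF ss] f foundation_set_cover[OF assms \<open>foundation_set GP (set ss)\<close>, of y]
          ell2_outside[OF f, of y] by (cases "y \<in> carrier G") auto
    qed
    then show ?thesis
      using product[OF ss] by (simp add: representation_eq_zero_iff[OF \<Phi>] del: bounded_operators_simps)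
  qed
  have kernel: "boundary_ideal GP \<subseteq> {a \<in> carrier ?C. \<Phi> a = \<zero>\<^bsub>bounded_operators ?H\<^esub>}"
    unfolding boundary_ideal_def
    by (intro closed_ideal_generated_by_least closed_ideal_representation_kernel[OF ring_axioms \<Phi> bound])
      (use mem in \<open>auto simp del: bounded_operators_simps\<close>)
  obtain \<Lambda> where \<Lambda>: "\<Lambda> \<in> star_hom (boundary_quotient GP) (bounded_operators ?H)"
    "\<And>x. x \<in> carrier ?C \<Longrightarrow> \<Lambda> (boundary_ideal GP +>\<^bsub>?C\<^esub> x) = \<Phi> x"
  proof (rule star_hom_quotient_lift[OF \<Phi>])
    show "\<Phi> x = \<zero>\<^bsub>bounded_operators ?H\<^esub>" if "x \<in> boundary_ideal GP" for x
      using kernel that by blast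
    show "\<zero>\<^bsub>bounded_operators ?H\<^esub> \<oplus>\<^bsub>bounded_operators ?H\<^esub> T = T" if "T \<in> carrier (bounded_operators ?H)" for T
      using that ell2_operatorsD(4)[of T ?H] by (auto simp: fun_eq_iff)
  qed (unfold boundary_quotient_def, blast)
  show ?thesis
  proof (rule that[OF \<Lambda>(1)])
    fix g p assume gp: "g \<in> carrier G" "p \<in> carrier P"
    have "\<Lambda> (boundary_isom GP (g, p)) = \<Phi> (semigroup_isom GP (g, p))"
      unfolding boundary_isom_def using gp by (intro \<Lambda>(2) semigroup_isom_closed) simp
    also have "\<dots> = relation_operator ?H (gen_relation (Isom (g, p)))"
      unfolding semigroup_isom_def using gp by (intro \<Phi>_gen) (simp add: semigroup_gens_def)
    finally show "\<Lambda> (boundary_isom GP (g, p)) =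
      translation_unitary G g \<otimes>\<^bsub>bounded_operators (carrier G)\<^esub> endomorphism_isometry G \<theta> p"
      by (simp only: translation_endomorphism_eq[OF gp])
  qed
qed

section \<open>Necessity of directedness\<close>

lemma representation_imp_directed:
  assumes \<Lambda>: "\<Lambda> \<in> representations (boundary_quotient GP) (carrier G)"
    and \<Lambda>_isom: "\<And>p. p \<in> carrier P \<Longrightarrow> \<Lambda> (boundary_isom GP (\<one>, p)) =
      translation_unitary G \<one> \<otimes>\<^bsub>bounded_operators (carrier G)\<^esub> endomorphism_isometry G \<theta> p"
  shows "directed P"
proof (rule ccontr)
  let ?C = "semigroup_cstar GP" and ?Q = "boundary_quotient GP" and ?H = "carrier G"
  assume "\<not> directed P"
  then obtain p q where pq: "p \<in> carrier P" "q \<in> carrier P"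
    "principal_right_ideal P p \<inter> principal_right_ideal P q = {}"
    unfolding directed_def by blast
  interpret star_ideal ?C "boundary_ideal GP"
    by (rule star_ideal_boundary_ideal)
  note Q = boundary_quotient_def boundary_isom_def
  let ?v = "\<lambda>p. semigroup_isom GP (\<one>, p)" and ?R = "\<lambda>p. gen_relation (Isom (\<one>, p))"
  have v: "?v p \<in> carrier ?C" if "p \<in> carrier P" for p
    using that by (intro semigroup_isom_closed) simp
  have \<Lambda>_eq: "\<Lambda> (boundary_isom GP (\<one>, p)) = relation_operator ?H (?R p)" if "p \<in> carrier P" for p
    using that by (simp only: \<Lambda>_isom translation_endomorphism_eq G.one_closed)
  \<comment> \<open>Injectivity of \<open>\<theta> p\<close> keeps every other basis point from
    being sent to the identity.\<close>
  have ket: "relation_operator ?H (?R p) (ket \<one>) = ket \<one>" if "p \<in> carrier P" for p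
  proof (rule relation_operator_eqI[OF gen.partial_bijection])
    show "ket \<one> \<in> ell2 ?H"
      by (simp add: ket_in_ell2)
  next
    fix h k assume "(h, k) \<in> ?R p"
    then have "h \<in> carrier G" "k = \<theta> p h"
      using that by auto
    then show "ket \<one> k = ket \<one> h"
      using that inj_onD[OF injective[OF that], of h \<one>] by (auto simp: ket_def)
  next
    fix k assume "k \<notin> Range (?R p)"
    then have "k \<noteq> \<one>"
      using that by force
    then show "ket \<one> k = 0"
      by (simp add: ket_def)
  qed
  have "principal_right_ideal GP (\<one>, p) \<inter> principal_right_ideal GP (\<one>, q) = {}"
    using pq by (auto simp: l_coset_semidirect)
  then have "star ?C (?v p) \<otimes>\<^bsub>?C\<^esub> ?v q = \<zero>\<^bsub>?C\<^esub>"
    using pq by (intro semigroup_isom_orthogonal monoid_semidirect) simp_all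
  then have zero: "star ?Q (boundary_isom GP (\<one>, p)) \<otimes>\<^bsub>?Q\<^esub> boundary_isom GP (\<one>, q)
      = boundary_ideal GP +>\<^bsub>?C\<^esub> \<zero>\<^bsub>?C\<^esub>"
    using v[OF pq(1)] v[OF pq(2)] by (simp add: Q cstar_quotient_star cstar_quotient_mult)
  have mem: "boundary_isom GP (\<one>, p) \<in> carrier ?Q" if "p \<in> carrier P" for p
    unfolding Q by (intro cstar_quotient_carrier v that)
  have star_mem: "star ?Q (boundary_isom GP (\<one>, p)) \<in> carrier ?Q"
    unfolding Q using v[OF pq(1)] by (simp add: cstar_quotient_star cstar_quotient_carrier)
  \<comment> \<open>The zero of the quotient enters as the coset of zero. That \<Lambda> sends it to
    zero follows from z + z = z by cancelling functions, so additivity of \<Lambda> is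
    enough.\<close>
  let ?z = "boundary_ideal GP +>\<^bsub>?C\<^esub> \<zero>\<^bsub>?C\<^esub>"
  have k: "ket \<one> \<in> ell2 ?H"
    by (simp add: ket_in_ell2)
  have "?z \<in> carrier ?Q" "?z \<oplus>\<^bsub>?Q\<^esub> ?z = ?z"
    unfolding Q by (simp_all add: cstar_quotient_carrier cstar_quotient_add)
  then have "\<Lambda> ?z (ket \<one>) = (\<lambda>x. 0)"
    using representationsD(1)[OF \<Lambda> k, of ?z ?z] by (simp add: fun_eq_iff)
  moreover have "\<Lambda> ?z (ket \<one>) = relation_operator ?H ((?R p)\<inverse>) (ket \<one>)"
    using pq(1,2) by (simp only: zero[symmetric] representationsD(2)[OF \<Lambda> k star_mem mem] star_homD(6)[OF \<Lambda> mem]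
        \<Lambda>_eq ket bounded_operators_simps adjoint_eqI[OF relation_operator_adjoint[OF gen.partial_bijection]])
  moreover have "relation_operator ?H ((?R p)\<inverse>) (ket \<one>) \<one> = ket \<one> \<one>"
    using pq(1) by (intro relation_operator_related k partial_bijection_converse gen.partial_bijection) auto
  ultimately have "ket \<one> \<one> = (0 :: complex)"
    by metis
  then show False
    by (simp add: ket_def)
qed

text \<open>The factorisation (g, 1)(1, p) = (g, p) passes to the quotient; it reconciles the
  products in the theorem with the isometries of (g, p) used throughout.\<close>

lemma boundary_isom_factor:
  assumes "g \<in> carrier G" "p \<in> carrier P"
  shows "boundary_isom GP (g, \<one>\<^bsub>P\<^esub>) \<otimes>\<^bsub>boundary_quotient GP\<^esub> boundary_isom GP (\<one>, p) = boundary_isom GP (g, p)"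
  using boundary_isom_mult[of "(g, \<one>\<^bsub>P\<^esub>)" GP "(\<one>, p)"] assms by simp

end

theorem proposition4p3:
  fixes G :: "('g, 'm) monoid_scheme"
    and P :: "('p, 'n) monoid_scheme"
    and \<theta> :: "'p \<Rightarrow> 'g \<Rightarrow> 'g"
  defines "S \<equiv> semidirect_product G P \<theta>"
  defines "Q \<equiv> boundary_quotient S"
  defines "u \<equiv> (\<lambda>g. boundary_isom S (g, \<one>\<^bsub>P\<^esub>))"
  defines "s \<equiv> (\<lambda>p. boundary_isom S (\<one>\<^bsub>G\<^esub>, p))"
  assumes "algebraic_dynamical_system G P \<theta>"
  shows "(\<exists>\<Lambda>\<in>representations Q (carrier G). \<forall>g\<in>carrier G. \<forall>p\<in>carrier P.
            \<Lambda> (u g \<otimes>\<^bsub>Q\<^esub> s p) =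
              translation_unitary G g \<otimes>\<^bsub>bounded_operators (carrier G)\<^esub> endomorphism_isometry G \<theta> p)
         \<longleftrightarrow> directed P"
proof -
  interpret algebraic_dynamical_system G P \<theta>
    by fact
  have us: "u g \<otimes>\<^bsub>Q\<^esub> s p = boundary_isom S (g, p)" if "g \<in> carrier G" "p \<in> carrier P" for g p
    using boundary_isom_factor[OF that] by (simp add: u_def s_def Q_def S_def)
  show ?thesis
  proof
    assume "\<exists>\<Lambda>\<in>representations Q (carrier G). \<forall>g\<in>carrier G. \<forall>p\<in>carrier P.
      \<Lambda> (u g \<otimes>\<^bsub>Q\<^esub> s p) =
        translation_unitary G g \<otimes>\<^bsub>bounded_operators (carrier G)\<^esub> endomorphism_isometry G \<theta> p"
    then obtain \<Lambda> where \<Lambda>: "\<Lambda> \<in> representations Q (carrier G)"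
      and \<Lambda>_us: "\<And>g p. \<lbrakk>g \<in> carrier G; p \<in> carrier P\<rbrakk> \<Longrightarrow> \<Lambda> (u g \<otimes>\<^bsub>Q\<^esub> s p) =
        translation_unitary G g \<otimes>\<^bsub>bounded_operators (carrier G)\<^esub> endomorphism_isometry G \<theta> p"
      by blast
    show "directed P"
      by (rule representation_imp_directed[OF \<Lambda>[unfolded Q_def S_def]])
        (use \<Lambda>_us[OF G.one_closed] us[OF G.one_closed] S_def in simp)
  next
    assume "directed P"
    then obtain \<Lambda> where "\<Lambda> \<in> representations Q (carrier G)"
      "\<And>g p. \<lbrakk>g \<in> carrier G; p \<in> carrier P\<rbrakk> \<Longrightarrow> \<Lambda> (boundary_isom S (g, p)) =
        translation_unitary G g \<otimes>\<^bsub>bounded_operators (carrier G)\<^esub> endomorphism_isometry G \<theta> p"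
      unfolding Q_def S_def by (rule directed_imp_representation) blast
    then show "\<exists>\<Lambda>\<in>representations Q (carrier G). \<forall>g\<in>carrier G. \<forall>p\<in>carrier P.
      \<Lambda> (u g \<otimes>\<^bsub>Q\<^esub> s p) =
        translation_unitary G g \<otimes>\<^bsub>bounded_operators (carrier G)\<^esub> endomorphism_isometry G \<theta> p"
      using us by (intro bexI ballI) (auto simp only:)
  qed
qed

end
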